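(* Let $k\ge2$ be an integer and let $q\in\mathbb{Z}/k^2$ be primitive (a unit). Then the triple $(p=k^2,q,k)$ is genus-minimizing if and only if $q\in\mathbb{Z}/k^2$ can be expressed in one or more of the following forms, where $i$ is an integer, $d$ is a positive integer, and all fractions shown represent integers: (0) $q=ik\pm1$ with $\gcd(i,k)\in\{1,2\}$; (1) $q=\pm\frac{k+1}{d}(k+1)$ with $\frac{k+1}{d}$ odd; or $q=\pm\frac{k-1}{d}(k-1)$ with $\frac{k-1}{d}$ odd; (2) $q=\pm\frac{k-1}{d}(2k+1)$ with $d$ odd; or $q=\pm\frac{k+1}{d}(2k-1)$ with $d$ odd; (3) $q=\pm\frac{2k+1}{d}(k-1)$ with $d$ odd; or $q=\pm\frac{2k-1}{d}(k+1)$ with $d$ odd.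
   Context: For an integer $p\ge2$, a nonzero $k\in\mathbb{Z}/p$ and a unit $q\in\mathbb{Z}/p$, let $[k]_p$ be the representative of $k$ in $\{0,\dots,p-1\}$, let $Q=\{aq: a\in\{0,\dots,[k]_p-1\}\}\subset\mathbb{Z}/p$, and let $\tilde Q\subset\mathbb{Z}$ be the preimage of $Q$ under $\mathbb{Z}\to\mathbb{Z}/p$. For $x,y\in\mathbb{Z}/p$ put $v_{(p,q,k)}(x,y)=\#(\mathbb{Z}\cap(\tilde x,\tilde y])\,[k]_p-\#(\tilde Q\cap(\tilde x,\tilde y])\,p$, where $\tilde x<\tilde y$ are any integer lifts of $x,y$ (the value does not depend on the lifts). Put $\bar G(p,q,k)=\max_{x,y\in\mathbb{Z}/p}v_{(p,q,k)}(x,y)$. The triple $(p,q,k)$ is genus-minimizing if $\bar G(p,q,k)<2p$. *)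

theory Defs
  imports "HOL-Number_Theory.Cong"
begin

text \<open>
  An element of the ring of integers modulo \<open>p\<close> is given by an integer, taken up to congruence
  modulo \<open>p\<close>. The subset \<open>Q_res p q k\<close> is recorded by its representatives in \<open>{0..<p}\<close>;
  there \<open>k mod p\<close> is the number written \<open>[k]_p\<close>.
\<close>

definition Q_res :: "int \<Rightarrow> int \<Rightarrow> int \<Rightarrow> int set" where
  "Q_res p q k = {(a * q) mod p | a. 0 \<le> a \<and> a \<le> k mod p - 1}"

definition Q_lift :: "int \<Rightarrow> int \<Rightarrow> int \<Rightarrow> int set" where
  "Q_lift p q k = {n. n mod p \<in> Q_res p q k}"

definition v_lift :: "int \<Rightarrow> int \<Rightarrow> int \<Rightarrow> int \<Rightarrow> int \<Rightarrow> int" where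
  "v_lift p q k x y =
     int (card {x<..y}) * (k mod p) - int (card (Q_lift p q k \<inter> {x<..y})) * p"

text \<open>
  For residues \<open>x\<close>, \<open>y\<close>, both in \<open>{0..<p}\<close>, the integers \<open>x < y + p\<close> are lifts as required.
  The lemma \<open>v_lift_eq_v_res\<close> below shows that every other choice of lifts gives the same value.
\<close>

definition v_res :: "int \<Rightarrow> int \<Rightarrow> int \<Rightarrow> int \<Rightarrow> int \<Rightarrow> int" where
  "v_res p q k x y = v_lift p q k x (y + p)"

definition G_bar :: "int \<Rightarrow> int \<Rightarrow> int \<Rightarrow> int" where
  "G_bar p q k = Max ((\<lambda>(x, y). v_res p q k x y) ` ({0..<p} \<times> {0..<p}))"

definition genus_minimizing :: "int \<Rightarrow> int \<Rightarrow> int \<Rightarrow> bool" where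
  "genus_minimizing p q k \<longleftrightarrow> G_bar p q k < 2 * p"

lemma Q_lift_add_period: "n + m * p \<in> Q_lift p q k \<longleftrightarrow> n \<in> Q_lift p q k"
  by (simp add: Q_lift_def)

lemma v_lift_shift: "v_lift p q k (x + m * p) (y + m * p) = v_lift p q k x y"
proof -
  let ?f = "\<lambda>n. n + m * p"
  have "{x + m * p<..y + m * p} = ?f ` {x<..y}"
  proof (intro equalityI subsetI)
    fix n assume "n \<in> {x + m * p<..y + m * p}"
    then show "n \<in> ?f ` {x<..y}"
      by (intro image_eqI[of _ _ "n - m * p"]) auto
  qed auto
  moreover have "Q_lift p q k \<inter> ?f ` {x<..y} = ?f ` (Q_lift p q k \<inter> {x<..y})"
    using Q_lift_add_period by blast
  moreover have "card (?f ` A) = card A" for A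
    by (rule card_image) (simp add: inj_on_def)
  ultimately show ?thesis
    by (simp only: v_lift_def)
qed

lemma v_lift_trans:
  assumes "x \<le> y" "y \<le> z"
  shows "v_lift p q k x z = v_lift p q k x y + v_lift p q k y z"
proof -
  let ?Q = "Q_lift p q k"
  have split: "{x<..z} = {x<..y} \<union> {y<..z}"
    using assms by auto
  have "card {x<..z} = card {x<..y} + card {y<..z}"
    unfolding split by (rule card_Un_disjoint) auto
  moreover have "card (?Q \<inter> {x<..z}) = card (?Q \<inter> {x<..y}) + card (?Q \<inter> {y<..z})"
    unfolding split Int_Un_distrib by (rule card_Un_disjoint) auto
  ultimately show ?thesis
    by (simp add: v_lift_def algebra_simps)
qed

lemma v_lift_period:
  assumes "p \<ge> 2" "coprime q p"
  shows "v_lift p q k x (x + p) = 0"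
proof -
  have p: "p > 0" using assms by simp
  have "bij_betw (\<lambda>n. n mod p) (Q_lift p q k \<inter> {x<..x + p}) (Q_res p q k)"
    unfolding bij_betw_def
  proof
    show "inj_on (\<lambda>n. n mod p) (Q_lift p q k \<inter> {x<..x + p})"
    proof (rule inj_onI)
      fix m n assume "m \<in> Q_lift p q k \<inter> {x<..x + p}" "n \<in> Q_lift p q k \<inter> {x<..x + p}"
        and eq: "m mod p = n mod p"
      then have "\<bar>m - n\<bar> < p" by auto
      moreover have "p dvd m - n" using eq by (simp add: mod_eq_dvd_iff)
      ultimately show "m = n" using zdvd_not_zless[of "\<bar>m - n\<bar>" p] by force
    qed
    show "(\<lambda>n. n mod p) ` (Q_lift p q k \<inter> {x<..x + p}) = Q_res p q k"
    proof (intro equalityI subsetI)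
      fix r assume r: "r \<in> Q_res p q k"
      then have r': "r mod p = r" by (auto simp: Q_res_def)
      define n where "n = x + 1 + (r - x - 1) mod p"
      have "n mod p = r" unfolding n_def by (simp add: mod_simps r')
      moreover have "0 \<le> (r - x - 1) mod p" "(r - x - 1) mod p < p"
        using p by simp_all
      then have "n \<in> {x<..x + p}" by (simp add: n_def)
      ultimately show "r \<in> (\<lambda>n. n mod p) ` (Q_lift p q k \<inter> {x<..x + p})"
        using r by (auto simp: Q_lift_def intro!: image_eqI[of _ _ n])
    qed (auto simp: Q_lift_def)
  qed
  then have "card (Q_lift p q k \<inter> {x<..x + p}) = card (Q_res p q k)"
    by (rule bij_betw_same_card)
  moreover have "Q_res p q k = (\<lambda>a. (a * q) mod p) ` {0..<k mod p}"
    by (auto simp: Q_res_def)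
  moreover have "inj_on (\<lambda>a. (a * q) mod p) {0..<k mod p}"
  proof (rule inj_onI)
    fix a b assume ab: "a \<in> {0..<k mod p}" "b \<in> {0..<k mod p}"
      and eq: "a * q mod p = b * q mod p"
    have "[a = b] (mod p)"
      using eq assms(2) by (simp add: cong_def[symmetric] cong_mult_rcancel)
    moreover have "k mod p < p" using p by simp
    then have "a < p" "b < p" using ab by auto
    ultimately show "a = b" using ab by (simp add: cong_def)
  qed
  ultimately show ?thesis
    using p by (simp add: v_lift_def card_image)
qed

lemma v_lift_eq_v_res:
  assumes "p \<ge> 2" "coprime q p" "x < y"
  shows "v_lift p q k x y = v_res p q k (x mod p) (y mod p)"
proof -
  have p: "p > 0" using assms by simp
  have ext: "v_lift p q k s (t + int n * p) = v_lift p q k s t" if "s \<le> t" for s t n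
  proof (induction n)
    case (Suc n)
    have "0 \<le> int n * p" using p by simp
    with that have "s \<le> t + int n * p" by linarith
    then have "v_lift p q k s (t + int n * p + p) =
        v_lift p q k s (t + int n * p) + v_lift p q k (t + int n * p) (t + int n * p + p)"
      using p by (intro v_lift_trans) auto
    then show ?case
      using Suc v_lift_period[OF assms(1,2), of k "t + int n * p"] by (simp add: algebra_simps)
  qed simp
  let ?x = "x mod p" and ?y = "y mod p"
  define b where "b = y div p - x div p"
  have x: "x = ?x + (x div p) * p" and y: "y = (?y + b * p) + (x div p) * p"
    by (simp_all add: b_def algebra_simps)
  have b: "b \<ge> 0"
    using assms(3) p by (simp add: b_def zdiv_mono1)
  have lt: "?x < ?y + b * p" using x y assms(3) by linarith
  have "?x < p" "?y \<ge> 0" using p by simp_all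
  then have le: "?x \<le> ?y + p" by linarith
  have "v_lift p q k x y = v_lift p q k ?x (?y + b * p)"
    by (subst x, subst y) (rule v_lift_shift)
  also have "\<dots> = v_lift p q k ?x (?y + b * p + int 1 * p)"
    using ext[of ?x "?y + b * p" 1] lt by simp
  also have "\<dots> = v_lift p q k ?x (?y + p + int (nat b) * p)"
    using b by (simp add: algebra_simps)
  also have "\<dots> = v_lift p q k ?x (?y + p)"
    by (rule ext[OF le])
  finally show ?thesis
    by (simp add: v_res_def)
qed

end

theory Submission
  imports Defs
begin

text \<open>
  Being genus-minimizing means that the \<open>k\<close> points \<open>aq\<close> with \<open>0 \<le> a < k\<close> have discrepancy less than \<open>2\<close>
  on every arc of \<open>\<int>/k\<^sup>2\<close>. As they are distinct modulo \<open>k\<close>, this holds iff for some \<open>m\<close> each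
  block \<open>[m + jk, m + (j + 1)k)\<close> contains exactly one of them. Two points share a block only because
  of a vector \<open>(d, s)\<close> with \<open>0 < d < k\<close>, \<open>\<bar>s\<bar> < k\<close> of the lattice \<open>{(d, s). s = qd mod k\<^sup>2}\<close>, and
  such a vector is harmless iff a certain box of size \<open>(k - d) \<times> (k - \<bar>s\<bar>)\<close> at \<open>(0, m)\<close> contains no
  point of the coarser lattice \<open>{(x, y). y = qx mod k}\<close>. This criterion is invariant under
  \<open>q \<mapsto> -q\<close> and, exchanging the coordinates, under \<open>q \<mapsto> q\<inverse>\<close>.

  By Dirichlet there is always a short vector, and up to sign there are at most two, one in each
  quadrant. Away from \<open>q = \<plusminus>1 mod k\<close>, one short vector leaves only the families with a vector
  \<open>(d, \<plusminus>(k + 1))\<close> or \<open>(\<plusminus>(k + 1), d)\<close> in the lattice. For two short vectors, applying the strip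
  lemma twice forces one of the boxes to have a side of length \<open>1\<close>, so that \<open>\<plusminus>q\<close> or \<open>\<plusminus>q\<inverse>\<close>
  is \<open>E(k + 1)\<close>. For such \<open>q\<close> the block numbers are \<open>b + (-b/k mod E)\<close>, and the criterion says
  that \<open>i/k mod E\<close> exceeds \<open>i\<close> exactly for \<open>i < E/2\<close>, which forces \<open>1/k = 2\<close> or \<open>1/k = -1\<close> modulo \<open>E\<close>.
\<close>

section \<open>Separating shifts\<close>

text \<open>A single empty box yields only \<open>W + H \<le> k\<close>, which settles the matter
  for two short vectors only when one box is contained in the other in size. The strip lemma gives
  more: an identity \<open>a * (y1 - y2) + b * (x2 - x1) = k\<close> whose two differences are
  bounded below by the sides of the box. Combined with the determinant k^2 of two neighbouring
  lattice vectors it turns all estimates into near equalities, and the few integer solutions of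
  these are the families. The classes q = 1 and q = -1 modulo k stand apart because the coarse
  lattice then contains (1, 1) or (1, -1). With a = b = 1 the estimates exclude nothing, so family
  (0) gets a direct argument. Up to sign, inversion modulo k^2 exchanges the families (1) and (2)
  and maps (3) to itself, by \<open>(k + 1)^2 * (2 * k - 1) = -1\<close> and
  \<open>(k - 1)^2 * (2 * k + 1) = 1\<close> modulo k^2. Hence only multiples E(k + 1) and E(1 - k)
  with E < k have to be examined by their block numbers.\<close>

lemma genus_minimizing_iff_v_lift:
  assumes "p \<ge> 2" "coprime q p"
  shows "genus_minimizing p q k \<longleftrightarrow> (\<forall>x y. x < y \<longrightarrow> v_lift p q k x y < 2 * p)"
proof -
  have "genus_minimizing p q k \<longleftrightarrow> (\<forall>x\<in>{0..<p}. \<forall>y\<in>{0..<p}. v_res p q k x y < 2 * p)"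
    using assms(1) unfolding genus_minimizing_def G_bar_def
    by (subst Max_less_iff) auto
  also have "\<dots> \<longleftrightarrow> (\<forall>x y. x < y \<longrightarrow> v_lift p q k x y < 2 * p)"
  proof (intro iffI allI impI ballI)
    fix x y :: int
    assume *: "\<forall>x\<in>{0..<p}. \<forall>y\<in>{0..<p}. v_res p q k x y < 2 * p" and "x < y"
    have "x mod p \<in> {0..<p}" "y mod p \<in> {0..<p}" using assms(1) by auto
    with * show "v_lift p q k x y < 2 * p"
      using v_lift_eq_v_res[OF assms \<open>x < y\<close>] by auto
  next
    fix x y :: int
    assume "\<forall>x y. x < y \<longrightarrow> v_lift p q k x y < 2 * p" "x \<in> {0..<p}" "y \<in> {0..<p}"
    then show "v_res p q k x y < 2 * p" by (auto simp: v_res_def)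
  qed
  finally show ?thesis .
qed

lemma mem_Q_lift_iff:
  assumes "k \<ge> 2"
  shows "n \<in> Q_lift (k\<^sup>2) q k \<longleftrightarrow> (\<exists>a. 0 \<le> a \<and> a < k \<and> k\<^sup>2 dvd n - a * q)"
proof -
  have "k < k\<^sup>2" using assms by (simp add: power2_eq_square)
  then have "k mod k\<^sup>2 = k" using assms by simp
  then show ?thesis
    by (auto simp: Q_lift_def Q_res_def mod_eq_dvd_iff)
qed

lemma v_lift_square:
  assumes "k \<ge> 2" "x \<le> y"
  shows "v_lift (k\<^sup>2) q k x y = k * (y - x - k * int (card (Q_lift (k\<^sup>2) q k \<inter> {x<..y})))"
proof -
  have "k < k\<^sup>2" using assms by (simp add: power2_eq_square)
  then have "k mod k\<^sup>2 = k" using assms by simp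
  then show ?thesis
    using assms by (simp add: v_lift_def power2_eq_square algebra_simps)
qed

text \<open>Adding k^2 to a point raises its block number by k, so block numbers are meaningful
  modulo k only. There are k points and k classes of blocks, hence injectivity already says one
  point per block.\<close>

definition separating_shift :: "int \<Rightarrow> int \<Rightarrow> int \<Rightarrow> bool" where
  "separating_shift k q m \<longleftrightarrow> (\<forall>a b. 0 \<le> a \<longrightarrow> a < k \<longrightarrow> 0 \<le> b \<longrightarrow> b < k \<longrightarrow>
     k dvd (a * q - m) div k - (b * q - m) div k \<longrightarrow> a = b)"

lemma separating_shift_surj:
  assumes "k \<ge> 2" "separating_shift k q m"
  shows "\<exists>a. 0 \<le> a \<and> a < k \<and> k dvd (a * q - m) div k - j"
proof -
  let ?f = "\<lambda>a. ((a * q - m) div k) mod k"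
  have "inj_on ?f {0..<k}"
    using assms(2) by (auto simp: inj_on_def separating_shift_def mod_eq_dvd_iff)
  moreover have "?f ` {0..<k} \<subseteq> {0..<k}" using assms(1) by auto
  ultimately have "?f ` {0..<k} = {0..<k}"
    by (simp add: endo_inj_surj)
  moreover have "j mod k \<in> {0..<k}" using assms(1) by auto
  ultimately have "j mod k \<in> ?f ` {0..<k}" by simp
  then obtain a where "a \<in> {0..<k}" "?f a = j mod k" by (metis (no_types, lifting) imageE)
  then show ?thesis by (auto simp: mod_eq_dvd_iff)
qed

text \<open>An arc contains a point for each complete block inside it, and the two incomplete blocks
  at its ends hold at most 2k - 2 further integers.\<close>

lemma separating_shift_imp_genus_minimizing:
  assumes k: "k \<ge> 2" and "coprime q (k\<^sup>2)" and sep: "separating_shift k q m"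
  shows "genus_minimizing (k\<^sup>2) q k"
proof -
  let ?Q = "Q_lift (k\<^sup>2) q k"
  have k2: "k\<^sup>2 \<ge> 2" using k power_mono[of 2 k 2] by simp
  have "v_lift (k\<^sup>2) q k x y < 2 * k\<^sup>2" if "x < y" for x y
  proof -
    have "\<exists>r. r \<in> ?Q \<and> (r - m) div k = j" for j
    proof -
      obtain a where a: "0 \<le> a" "a < k" "k dvd (a * q - m) div k - j"
        using separating_shift_surj[OF k sep] by blast
      then obtain i where i: "(a * q - m) div k = j + k * i" by (metis add.commute diff_eq_eq dvdE)
      define r where "r = a * q - k\<^sup>2 * i"
      have "r - m = (a * q - m) + - k * i * k" by (simp add: r_def power2_eq_square)
      then have "(r - m) div k = - k * i + (a * q - m) div k"
        using k by (simp only: div_mult_self1)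
      then have "(r - m) div k = j" using i by simp
      moreover have "r \<in> ?Q" using a k by (auto simp: mem_Q_lift_iff r_def)
      ultimately show ?thesis by blast
    qed
    then obtain r where r: "\<And>j. r j \<in> ?Q" "\<And>j. (r j - m) div k = j" by metis
    have rb: "m + k * j \<le> r j" "r j < m + k * j + k" for j
    proof -
      have "r j - m = k * j + (r j - m) mod k" using r(2)[of j] by (metis mult_div_mod_eq)
      moreover have "0 \<le> (r j - m) mod k" "(r j - m) mod k < k" using k by auto
      ultimately show "m + k * j \<le> r j" "r j < m + k * j + k" by linarith+
    qed
    \<comment> \<open>Arcs exclude \<open>x\<close> and include \<open>y\<close>: block j lies in
      the arc iff \<open>m + j * k > x\<close> and \<open>m + (j + 1) * k \<le> y + 1\<close>, that
      is iff \<open>lo \<le> j < hi\<close>.\<close>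
    define lo hi where "lo = (x - m) div k + 1" and "hi = (y + 1 - m) div k"
    have d1: "(x - m) = k * ((x - m) div k) + (x - m) mod k"
      and d2: "(y + 1 - m) = k * hi + (y + 1 - m) mod k" by (simp_all add: hi_def)
    have d3: "0 \<le> (x - m) mod k" "(x - m) mod k < k" "0 \<le> (y+1 - m) mod k" "(y+1 - m) mod k < k"
      using k by auto
    have lo: "k * lo = k * ((x - m) div k) + k" by (simp add: lo_def algebra_simps)
    have "r ` {lo..<hi} \<subseteq> ?Q \<inter> {x<..y}"
    proof
      fix z assume "z \<in> r ` {lo..<hi}"
      then obtain j where j: "lo \<le> j" "j < hi" "z = r j" by auto
      have "k * lo \<le> k * j" "k * (j + 1) \<le> k * hi" using j k by (simp_all add: mult_left_mono)
      then have "k * lo \<le> k * j" "k * j + k \<le> k * hi" by (simp_all add: algebra_simps)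
      then have "x < r j" "r j \<le> y" using rb[of j] d1 d2 d3 lo by linarith+
      then show "z \<in> ?Q \<inter> {x<..y}" using r(1) j by auto
    qed
    then have "card (r ` {lo..<hi}) \<le> card (?Q \<inter> {x<..y})"
      by (intro card_mono) auto
    moreover have "inj r" using r(2) by (metis injI)
    then have "card (r ` {lo..<hi}) = nat (hi - lo)"
      by (simp add: card_image inj_on_subset[of r UNIV])
    ultimately have "nat (hi - lo) \<le> card (?Q \<inter> {x<..y})" by simp
    then have "hi - lo \<le> int (card (?Q \<inter> {x<..y}))" by linarith
    then have "k * (hi - lo) \<le> k * int (card (?Q \<inter> {x<..y}))" using k by simp
    moreover have "k * (hi - lo) = k * hi - k * lo" by (simp add: algebra_simps)
    ultimately have "y - x - k * int (card (?Q \<inter> {x<..y})) < 2 * k"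
      using d1 d2 d3 lo by linarith
    then have "k * (y - x - k * int (card (?Q \<inter> {x<..y}))) < k * (2 * k)"
      using k by simp
    moreover have "k * (2 * k) = 2 * k\<^sup>2" by (simp add: power2_eq_square)
    moreover have "v_lift (k\<^sup>2) q k x y = k * (y - x - k * int (card (?Q \<inter> {x<..y})))"
      using v_lift_square[OF k] that by simp
    ultimately show ?thesis by simp
  qed
  then show ?thesis using genus_minimizing_iff_v_lift[OF k2 assms(2)] by blast
qed

text \<open>The discrepancy is k times a difference of the potential \<open>f\<close>, which rises
  by 1 at ordinary integers and drops by k - 1 at points. Stepping back over a point turns the bound
  2k into \<open>f r - f r' \<le> k\<close>, and equality would make two points congruent modulo k.
  So the values of \<open>f\<close> at the points fit into a window [m, m + k). Since
  \<open>r - m = (f r - m) + cnt r * k\<close>, the block number of a point is then its rank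
  \<open>cnt r\<close>.\<close>

lemma genus_minimizing_imp_separating_shift:
  assumes k: "k \<ge> 2" and cop: "coprime q (k\<^sup>2)" and gm: "genus_minimizing (k\<^sup>2) q k"
  shows "\<exists>m. separating_shift k q m"
proof -
  let ?Q = "Q_lift (k\<^sup>2) q k" and ?p = "k\<^sup>2"
  have k2: "?p \<ge> 2" using k power_mono[of 2 k 2] by simp
  have copk: "coprime q k" using cop by simp
  define cnt where "cnt y = int (card (?Q \<inter> {0<..y}))" for y
  define f where "f y = y - k * cnt y" for y
  have vf: "v_lift ?p q k x y = k * (f y - f x)" if "0 \<le> x" "x \<le> y" for x y
  proof -
    have "v_lift ?p q k 0 y = v_lift ?p q k 0 x + v_lift ?p q k x y"
      using that by (rule v_lift_trans)
    then show ?thesis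
      using that k by (simp add: v_lift_square f_def cnt_def algebra_simps)
  qed
  have per: "f (y + ?p) = f y" if "0 \<le> y" for y
    using vf[of y "y + ?p"] v_lift_period[OF k2 cop, of k y] that k by simp
  have up: "f y - f x < 2 * k" if "0 \<le> x" "x < y" for x y
  proof -
    have "v_lift ?p q k x y < 2 * ?p"
      using gm genus_minimizing_iff_v_lift[OF k2 cop] that by blast
    then have "k * (f y - f x) < k * (2 * k)"
      using vf[of x y] that by (simp add: power2_eq_square)
    then show ?thesis using k by simp
  qed
  \<comment> \<open>The arc from x to y may wrap around the circle; adding a period to y leaves
    \<open>f\<close> unchanged.\<close>
  have up': "f y - f x < 2 * k" if "0 \<le> x" "x \<le> ?p" "0 \<le> y" for x y
  proof (cases "x < y + ?p")
    case True
    then show ?thesis using up[of x "y + ?p"] per[of y] that by simp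
  next
    case False
    then have "x = y + ?p" using that by simp
    then show ?thesis using per[of y] that k by simp
  qed
  have step: "f (r - 1) = f r + k - 1" if "r \<in> ?Q" "0 < r" for r
  proof -
    have "?Q \<inter> {0<..r} = insert r (?Q \<inter> {0<..r - 1})" using that by auto
    then have "card (?Q \<inter> {0<..r}) = card (?Q \<inter> {0<..r - 1}) + 1" by simp
    then show ?thesis by (simp add: f_def cnt_def algebra_simps)
  qed
  define S where "S = ?Q \<inter> {0<..?p}"
  have inj: "r = r'" if S: "r \<in> S" "r' \<in> S" and dvd: "k dvd r - r'" for r r'
  proof -
    obtain a b where a: "0 \<le> a" "a < k" "?p dvd r - a * q" and b: "0 \<le> b" "b < k" "?p dvd r' - b * q"
      using S unfolding S_def by (metis Int_iff mem_Q_lift_iff[OF k])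
    have "k dvd r - a * q" "k dvd r' - b * q"
      using a b by (auto simp: power2_eq_square dest: dvd_mult_left)
    then have "k dvd (r - r') - (r - a * q) + (r' - b * q)"
      using dvd by (meson dvd_add dvd_diff)
    then have "k dvd (a - b) * q" by (simp add: algebra_simps)
    then have "k dvd a - b" using copk by (simp add: coprime_dvd_mult_left_iff coprime_commute)
    then have "a = b" using a b zdvd_not_zless[of "\<bar>a - b\<bar>" k] by force
    then have "?p dvd r - r'" using dvd_diff[OF a(3) b(3)] by simp
    moreover have "\<bar>r - r'\<bar> < ?p" using S by (auto simp: S_def)
    ultimately show ?thesis using zdvd_not_zless[of "\<bar>r - r'\<bar>" ?p] by force
  qed
  have close: "f r - f r' < k" if "r \<in> S" "r' \<in> S" for r r'
  proof -
    have "f (r - 1) - f r' < 2 * k" using that up'[of r' "r - 1"] by (auto simp: S_def)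
    then have le: "f r - f r' \<le> k" using step[of r] that by (auto simp: S_def)
    have "f r - f r' \<noteq> k"
    proof
      assume eq: "f r - f r' = k"
      then have "r - r' = k * (1 + cnt r - cnt r')" by (simp add: f_def algebra_simps)
      then have "r = r'" using inj[OF that] by simp
      then show False using eq k by simp
    qed
    with le show ?thesis by simp
  qed
  have "?p \<in> ?Q" using k by (auto simp: mem_Q_lift_iff intro!: exI[of _ 0])
  then have "?p \<in> S" using k by (simp add: S_def)
  then have ne: "finite (f ` S)" "f ` S \<noteq> {}" by (auto simp: S_def)
  define m where "m = Min (f ` S)"
  have m: "m \<le> f r \<and> f r < m + k" if "r \<in> S" for r
  proof -
    obtain r' where "r' \<in> S" "m = f r'" using Min_in[OF ne] by (auto simp: m_def)
    moreover have "m \<le> f r" unfolding m_def using that ne(1) by (intro Min_le) auto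
    ultimately show ?thesis using close[OF that, of r'] by simp
  qed
  have div: "(r - m) div k = cnt r" if "r \<in> S" for r
  proof -
    have "r - m = (f r - m) + cnt r * k" by (simp add: f_def algebra_simps)
    then have "(r - m) div k = cnt r + (f r - m) div k" using k by (simp only: div_mult_self1)
    moreover have "(f r - m) div k = 0" using m[OF that] by simp
    ultimately show ?thesis by simp
  qed
  have cntmono: "cnt r < cnt r'" if "r \<in> S" "r' \<in> S" "r < r'" for r r'
  proof -
    have "r' \<in> ?Q \<inter> {0<..r'}" "r' \<notin> ?Q \<inter> {0<..r}" "?Q \<inter> {0<..r} \<subseteq> ?Q \<inter> {0<..r'}"
      using that by (auto simp: S_def)
    then have "?Q \<inter> {0<..r} \<subset> ?Q \<inter> {0<..r'}" by blast
    then show ?thesis by (simp add: cnt_def psubset_card_mono)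
  qed
  have cntp: "cnt ?p = k"
    using v_lift_period[OF k2 cop, of k 0] v_lift_square[of k 0 ?p q] k
    by (simp add: cnt_def power2_eq_square)
  have cntr: "1 \<le> cnt r \<and> cnt r \<le> k" if "r \<in> S" for r
  proof -
    have "cnt r \<le> cnt ?p" unfolding cnt_def using that
      by (intro of_nat_mono card_mono) (auto simp: S_def)
    moreover have "r \<in> ?Q \<inter> {0<..r}" using that by (auto simp: S_def)
    then have "0 < card (?Q \<inter> {0<..r})" by (auto simp: card_gt_0_iff)
    then have "1 \<le> cnt r" by (simp add: cnt_def)
    ultimately show ?thesis using cntp by simp
  qed
  have "separating_shift k q m"
    unfolding separating_shift_def
  proof (intro allI impI)
    fix a b assume a: "0 \<le> a" "a < k" and b: "0 \<le> b" "b < k"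
      and dvd: "k dvd (a * q - m) div k - (b * q - m) div k"
    have rep: "\<exists>r\<in>S. \<exists>i. r = a * q + ?p * i \<and> (a * q - m) div k = cnt r - k * i" if "0 \<le> a" "a < k" for a
    proof -
      define i where "i = - ((a * q - 1) div ?p)"
      define r where "r = a * q + ?p * i"
      have "r - 1 = (a * q - 1) mod ?p"
        by (simp add: r_def i_def minus_mult_div_eq_mod[symmetric])
      then have "0 < r" "r \<le> ?p"
        using k2 pos_mod_bound[of ?p "a * q - 1"] pos_mod_sign[of ?p "a * q - 1"] by linarith+
      moreover have "r \<in> ?Q" using that k by (auto simp: mem_Q_lift_iff r_def)
      ultimately have "r \<in> S" by (simp add: S_def)
      moreover have "a * q - m = (r - m) + (- k * i) * k" by (simp add: r_def power2_eq_square)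
      then have "(a * q - m) div k = - k * i + (r - m) div k" using k by (simp only: div_mult_self1)
      then have "(a * q - m) div k = cnt r - k * i" using div[OF \<open>r \<in> S\<close>] by simp
      ultimately show ?thesis using r_def by blast
    qed
    obtain r i where r: "r \<in> S" "r = a * q + ?p * i" "(a * q - m) div k = cnt r - k * i"
      using rep[OF a] by blast
    obtain r' i' where r': "r' \<in> S" "r' = b * q + ?p * i'" "(b * q - m) div k = cnt r' - k * i'"
      using rep[OF b] by blast
    have "k dvd (cnt r - cnt r') - k * (i - i')" using dvd r r' by (simp add: algebra_simps)
    then have "k dvd cnt r - cnt r'" by (simp add: dvd_diff_left_iff)
    then have "cnt r = cnt r'"
      using cntr[OF r(1)] cntr[OF r'(1)] zdvd_not_zless[of "\<bar>cnt r - cnt r'\<bar>" k] by force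
    then have "r = r'" using cntmono[OF r(1) r'(1)] cntmono[OF r'(1) r(1)] by linarith
    then have "(a - b) * q = k * (k * (i' - i))" using r(2) r'(2) by (simp add: algebra_simps power2_eq_square)
    then have "k dvd (a - b) * q" by simp
    then have "k dvd a - b" using copk by (simp add: coprime_dvd_mult_left_iff coprime_commute)
    then show "a = b" using a b zdvd_not_zless[of "\<bar>a - b\<bar>" k] by force
  qed
  then show ?thesis by blast
qed

section \<open>Lattice boxes\<close>

definition empty_box :: "int \<Rightarrow> int \<Rightarrow> int \<Rightarrow> int \<Rightarrow> int \<Rightarrow> int \<Rightarrow> bool" where
  "empty_box k c x0 W y0 H \<longleftrightarrow> (\<forall>x y. x0 \<le> x \<longrightarrow> x < x0 + W \<longrightarrow> y0 \<le> y \<longrightarrow> y < y0 + H \<longrightarrow> \<not> k dvd y - c * x)"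

text \<open>The points aq and (a + d)q share a block iff a < k - d and the representative of aq
  modulo k in [m, m + k) stays in that range when s is added. For s < 0 the admissible range is
  moved down by k, so that the two kinds of boxes sit above and below the same corner (r, m). The
  abscissa \<open>r\<close> is a parameter because exchanging the coordinates exchanges
  \<open>r\<close> and \<open>m\<close>.\<close>

definition box_condition :: "int \<Rightarrow> int \<Rightarrow> int \<Rightarrow> int \<Rightarrow> bool" where
  "box_condition k q r m \<longleftrightarrow> (\<forall>d s. 0 < d \<longrightarrow> d < k \<longrightarrow> k\<^sup>2 dvd s - q * d \<longrightarrow>
     (0 < s \<longrightarrow> s < k \<longrightarrow> empty_box k q r (k - d) m (k - s)) \<and>
     (s < 0 \<longrightarrow> - k < s \<longrightarrow> empty_box k q r (k - d) (m - (k + s)) (k + s)))"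

lemma empty_boxD:
  "empty_box k c x0 W y0 H \<Longrightarrow> k dvd y - c * x \<Longrightarrow> x0 \<le> x \<Longrightarrow> x < x0 + W \<Longrightarrow> y0 \<le> y \<Longrightarrow> y < y0 + H \<Longrightarrow> False"
  by (auto simp: empty_box_def)

lemma empty_box_translate:
  assumes "k dvd w - c * u" "empty_box k c x0 W y0 H" "x1 = x0 + u" "y1 = y0 + w"
  shows "empty_box k c x1 W y1 H"
  unfolding empty_box_def
proof (intro allI impI notI)
  fix x y assume *: "x1 \<le> x" "x < x1 + W" "y1 \<le> y" "y < y1 + H" "k dvd y - c * x"
  have "k dvd (y - c * x) - (w - c * u)" using *(5) assms(1) by (rule dvd_diff)
  then have "k dvd (y - w) - c * (x - u)" by (simp add: algebra_simps)
  then show False using empty_boxD[OF assms(2), of "y - w" "x - u"] * assms(3,4) by simp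
qed

lemma box_condition_translate:
  assumes "k dvd w - q * u" "box_condition k q r m"
  shows "box_condition k q (r + u) (m + w)"
proof -
  have "empty_box k q (r + u) W (m + w) H" if "empty_box k q r W m H" for W H
    using empty_box_translate[OF assms(1) that] by simp
  moreover have "empty_box k q (r + u) W (m + w - a) H" if "empty_box k q r W (m - a) H" for a W H
    using empty_box_translate[OF assms(1) that, of "r + u" "m + w - a"] by simp
  ultimately show ?thesis using assms(2) unfolding box_condition_def by blast
qed

text \<open>If two block numbers agree modulo k, the difference of the points is congruent modulo
  k^2 to the difference s of their offsets inside the blocks. The coarse lattice records the offset
  of the first point. The case s = 0 cannot occur, since q is a unit.\<close>

lemma separating_shift_iff_box_condition:
  assumes k: "k \<ge> 2" and cop: "coprime q (k\<^sup>2)"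
  shows "separating_shift k q m \<longleftrightarrow> box_condition k q 0 m"
proof
  assume sep: "separating_shift k q m"
  have key: False if "0 \<le> a" "0 < d" "a + d < k" and sd: "k\<^sup>2 dvd s - q * d" and ya: "k dvd y - q * a"
     and
      "m \<le> y" "y < m + k" "m \<le> y + s" "y + s < m + k" for a d s y
  proof -
    obtain i where i: "y - q * a = k * i" using ya by blast
    obtain l where l: "s - q * d = k\<^sup>2 * l" using sd by blast
    have "a * q - m = (y - m) + (- i) * k" using i by (simp add: algebra_simps)
    then have "(a * q - m) div k = - i + (y - m) div k" using k by (simp only: div_mult_self1)
    moreover have "(y - m) div k = 0" using that by simp
    moreover have "(a + d) * q - m = (y + s - m) + (- i - k * l) * k"
      using i l by (simp add: algebra_simps power2_eq_square)
    then have "((a + d) * q - m) div k = (- i - k * l) + (y + s - m) div k" using k by (simp only: div_mult_self1)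
    moreover have "(y + s - m) div k = 0" using that by simp
    ultimately have "k dvd (a * q - m) div k - ((a + d) * q - m) div k" by simp
    moreover have "0 \<le> a + d" "a < k" using that by auto
    ultimately have "a = a + d" using sep that unfolding separating_shift_def by blast
    then show False using that by simp
  qed
  show "box_condition k q 0 m"
    unfolding box_condition_def empty_box_def
  proof (intro allI impI conjI notI)
    fix d s x y
    assume *: "0 < d" "d < k" "k\<^sup>2 dvd s - q * d" "0 < s" "s < k" "0 \<le> x" "x < 0 + (k - d)"
      "m \<le> y" "y < m + (k - s)" "k dvd y - q * x"
    show False using key[of x d s y] * by simp
  next
    fix d s x y
    assume *: "0 < d" "d < k" "k\<^sup>2 dvd s - q * d" "s < 0" "- k < s" "0 \<le> x" "x < 0 + (k - d)"
      "m - (k + s) \<le> y" "y < m - (k + s) + (k + s)" "k dvd y - q * x"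
    \<comment> \<open>This undoes the downward move by k in the box for negative
      \<open>s\<close>.\<close>
    have "k dvd (y - q * x) + k" using * by simp
    then have "k dvd (y + k) - q * x" by (simp add: algebra_simps)
    then show False using key[of x d s "y + k"] * by simp
  qed
next
  assume box: "box_condition k q 0 m"
  have copk: "coprime q k" using cop by simp
  have lt: False if ab: "0 \<le> a" "a < b" "b < k" and dvd: "k dvd (b * q - m) div k - (a * q - m) div k" for a b
  proof -
    define i j u v where "i = (a * q - m) div k" and "j = (b * q - m) div k"
      and "u = (a * q - m) mod k" and "v = (b * q - m) mod k"
    have u: "a * q - m = k * i + u" "0 \<le> u" "u < k" and v: "b * q - m = k * j + v" "0 \<le> v" "v < k"
      using k by (auto simp: i_def j_def u_def v_def)
    obtain l where l: "j - i = k * l" using dvd by (auto simp: i_def j_def)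
    define d s where "d = b - a" and "s = v - u"
    have "s - q * d = k * (i - j)" using u(1) v(1) by (simp add: d_def s_def algebra_simps)
    also have "i - j = k * (- l)" using l by simp
    finally have sd: "k\<^sup>2 dvd s - q * d" by (simp add: power2_eq_square mult.assoc[symmetric])
    have d: "0 < d" "d < k" using ab by (auto simp: d_def)
    consider "s = 0" | "0 < s" | "s < 0" by linarith
    then show False
    proof cases
      case 1
      then have "k\<^sup>2 dvd d" using sd cop by (simp add: coprime_commute coprime_dvd_mult_right_iff)
      then have "k dvd d" by (auto simp: power2_eq_square dest: dvd_mult_left)
      then show False using d zdvd_not_zless by blast
    next
      case 2
      have "s < k" using u v by (simp add: s_def)
      then have "empty_box k q 0 (k - d) m (k - s)" using box d sd 2 by (simp add: box_condition_def)
      moreover have "m + u - q * a = k * (- i)" using u by (simp add: algebra_simps)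
      then have "k dvd m + u - q * a" by simp
      ultimately show False
        by (rule empty_boxD) (use ab u v in \<open>auto simp: s_def d_def\<close>)
    next
      case 3
      have "- k < s" using u v by (simp add: s_def)
      then have "empty_box k q 0 (k - d) (m - (k + s)) (k + s)" using box d sd 3 by (simp add: box_condition_def)
      moreover have "m + u - k - q * a = k * (- i - 1)" using u by (simp add: algebra_simps)
      then have "k dvd m + u - k - q * a" by simp
      ultimately show False
        by (rule empty_boxD) (use ab u v in \<open>auto simp: s_def d_def\<close>)
    qed
  qed
  show "separating_shift k q m"
    unfolding separating_shift_def
  proof (intro allI impI)
    fix a b assume *: "0 \<le> a" "a < k" "0 \<le> b" "b < k" "k dvd (a * q - m) div k - (b * q - m) div k"
    have "k dvd (b * q - m) div k - (a * q - m) div k" using *(5) by (simp add: dvd_diff_commute)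
    then show "a = b" using lt[of a b] lt[of b a] * by (metis linorder_neqE_linordered_idom)
  qed
qed

theorem genus_minimizing_iff_box_condition:
  assumes "k \<ge> 2" "coprime q (k\<^sup>2)"
  shows "genus_minimizing (k\<^sup>2) q k \<longleftrightarrow> (\<exists>m. box_condition k q 0 m)"
  using separating_shift_imp_genus_minimizing[OF assms] genus_minimizing_imp_separating_shift[OF assms]
    separating_shift_iff_box_condition[OF assms] by blast

section \<open>Symmetries: sign change, inversion, congruence\<close>

lemma empty_box_mirror:
  assumes "empty_box k q x0 W y0 H" "y1 = 1 - y0 - H"
  shows "empty_box k (- q) x0 W y1 H"
  unfolding empty_box_def
proof (intro allI impI notI)
  fix x y assume *: "x0 \<le> x" "x < x0 + W" "y1 \<le> y" "y < y1 + H" "k dvd y - - q * x"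
  have "k dvd - (y - - q * x)" using *(5) by (simp only: dvd_minus_iff)
  then have "k dvd - y - q * x" by (simp add: algebra_simps)
  then show False using empty_boxD[OF assms(1), of "- y" x] * assms(2) by simp
qed

text \<open>The reflection y \<mapsto> -y exchanges the vectors with s > 0 and s < 0 and the boxes
  above and below the corner. Boxes are half-open, hence \<open>1 - m\<close> and not
  \<open>- m\<close>.\<close>

lemma box_condition_uminus:
  assumes "box_condition k q r m"
  shows "box_condition k (- q) r (1 - m)"
  unfolding box_condition_def
proof (intro allI impI conjI)
  fix d s assume *: "0 < d" "d < k" "k\<^sup>2 dvd s - - q * d"
  have "k\<^sup>2 dvd - (s - - q * d)" using *(3) by (simp only: dvd_minus_iff)
  then have dvd: "k\<^sup>2 dvd - s - q * d" by (simp add: algebra_simps)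
  show "empty_box k (- q) r (k - d) (1 - m) (k - s)" if "0 < s" "s < k"
  proof (rule empty_box_mirror)
    show "empty_box k q r (k - d) (m - (k + - s)) (k - s)"
      using assms * dvd that unfolding box_condition_def by force
  qed simp
  show "empty_box k (- q) r (k - d) (1 - m - (k + s)) (k + s)" if "s < 0" "- k < s"
  proof (rule empty_box_mirror)
    show "empty_box k q r (k - d) m (k + s)"
      using assms * dvd that unfolding box_condition_def by force
  qed simp
qed

lemma genus_minimizing_uminus:
  assumes "k \<ge> 2" "coprime q (k\<^sup>2)"
  shows "genus_minimizing (k\<^sup>2) (- q) k \<longleftrightarrow> genus_minimizing (k\<^sup>2) q k"
  using assms box_condition_uminus[of k q 0] box_condition_uminus[of k "- q" 0]
  by (metis genus_minimizing_iff_box_condition coprime_minus_left_iff minus_minus)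

lemma dvd_inverse_swap:
  assumes "p dvd q * q' - 1" "p dvd x - q' * (y::int)"
  shows "p dvd y - q * x"
proof -
  have "p dvd (- q) * (x - q' * y) - y * (q * q' - 1)" using assms by (meson dvd_diff dvd_mult)
  then show ?thesis by (simp add: algebra_simps)
qed

lemma empty_box_swap:
  assumes "k dvd q * q' - 1" "empty_box k q x0 W y0 H"
  shows "empty_box k q' y0 H x0 W"
  unfolding empty_box_def
  using dvd_inverse_swap[OF assms(1)] assms(2) by (auto simp: empty_box_def)

text \<open>For s > 0 the transposed vector is again admissible. For s < 0 it must also be negated,
  and its box then lies to the lower right of the corner (r, m), whereas the upper left is wanted;
  the coarse lattice vector \<open>(- k - s, k - d)\<close> carries one to the other.\<close>

lemma box_condition_swap:
  assumes inv: "k\<^sup>2 dvd q * q' - 1" and box: "box_condition k q r m"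
  shows "box_condition k q' m r"
  unfolding box_condition_def
proof (intro allI impI conjI)
  fix d s assume *: "0 < d" "d < k" "k\<^sup>2 dvd s - q' * d"
  have inv': "k dvd q * q' - 1" using inv by (auto simp: power2_eq_square dest: dvd_mult_left)
  have dvd: "k\<^sup>2 dvd d - q * s" using dvd_inverse_swap[OF inv *(3)] .
  show "empty_box k q' m (k - d) r (k - s)" if "0 < s" "s < k"
    by (rule empty_box_swap[OF inv'])
      (use box * dvd that in \<open>auto simp: box_condition_def\<close>)
  show "empty_box k q' m (k - d) (r - (k + s)) (k + s)" if s: "s < 0" "- k < s"
  proof (rule empty_box_swap[OF inv'])
    have "k\<^sup>2 dvd - (d - q * s)" using dvd by (simp only: dvd_minus_iff)
    then have dvd': "k\<^sup>2 dvd (- d) - q * (- s)" by (simp add: algebra_simps)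
    then have "empty_box k q r (k - - s) (m - (k + - d)) (k + - d)"
      using box[unfolded box_condition_def, rule_format, of "- s" "- d"] * s by simp
    moreover have "k dvd (- d) - q * (- s)" using dvd' by (auto simp: power2_eq_square dest: dvd_mult_left)
    then have "k dvd ((- d) - q * (- s)) + k * (1 + q)" by simp
    then have "k dvd (k - d) - q * (- k - s)" by (simp add: algebra_simps)
    ultimately show "empty_box k q (r - (k + s)) (k + s) m (k - d)"
      using empty_box_translate[of k "k - d" q "- k - s" r "k + s" "m - (k - d)" "k - d" "r - (k + s)" m]
      by simp
  qed
qed

lemma genus_minimizing_inverse_imp:
  assumes k: "k \<ge> 2" and inv: "k\<^sup>2 dvd q * q' - 1" and gm: "genus_minimizing (k\<^sup>2) q k"
  shows "genus_minimizing (k\<^sup>2) q' k"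
proof -
  have "coprime (q * q') (k\<^sup>2)"
    using inv by (metis coprime_iff_gcd_eq_1 cong_iff_dvd_diff cong_gcd_eq gcd_1_int gcd.commute)
  then have cop: "coprime q (k\<^sup>2)" "coprime q' (k\<^sup>2)" by simp_all
  obtain m where "box_condition k q 0 m" using gm genus_minimizing_iff_box_condition[OF k cop(1)] by blast
  then have "box_condition k q' m 0" using box_condition_swap inv by blast
  \<comment> \<open>The exchange has moved the corner to (m, 0); a coarse lattice vector brings its
    abscissa back to 0.\<close>
  then have "box_condition k q' (m + (- m)) (0 + (- q' * m))"
    by (rule box_condition_translate[rotated]) simp
  then show ?thesis using genus_minimizing_iff_box_condition[OF k cop(2)] by auto
qed

text \<open>Successive columns meet the lattice in distinct residues because c is a unit, and
  emptiness keeps all of them out of \<open>0..<H\<close>.\<close>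

lemma empty_box_dims:
  assumes cop: "coprime c k" and k: "k > 0" and box: "empty_box k c x0 W y0 H" and WH: "W \<ge> 1" "H \<ge> 1"
  shows "W + H \<le> k"
proof -
  \<comment> \<open>Only k successive columns are distinct modulo k. The resulting bound
    \<open>M \<le> k - H\<close> excludes M = k, so M is W in the end.\<close>
  define M where "M = min W k"
  let ?f = "\<lambda>x. (c * x - y0) mod k"
  have inj: "inj_on ?f {x0..<x0 + M}"
  proof (rule inj_onI)
    fix x y assume xy: "x \<in> {x0..<x0 + M}" "y \<in> {x0..<x0 + M}" "?f x = ?f y"
    then have "k dvd c * (x - y)" by (simp add: mod_eq_dvd_iff algebra_simps)
    then have "k dvd x - y" using cop by (simp add: coprime_commute coprime_dvd_mult_right_iff)
    moreover have "\<bar>x - y\<bar> < k" using xy by (auto simp: M_def)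
    ultimately show "x = y" using zdvd_not_zless[of "\<bar>x - y\<bar>" k] by force
  qed
  have "?f ` {x0..<x0 + M} \<subseteq> {H..<k}"
  proof
    fix r assume "r \<in> ?f ` {x0..<x0 + M}"
    then obtain x where x: "x0 \<le> x" "x < x0 + M" "r = ?f x" by auto
    have "k dvd (c * x - y0) - r" using x by (simp add: mod_eq_dvd_iff[symmetric])
    then have "k dvd - ((c * x - y0) - r)" by (simp only: dvd_minus_iff)
    then have "k dvd (y0 + r) - c * x" by (simp add: algebra_simps)
    moreover have "0 \<le> r" "r < k" using x k by simp_all
    ultimately have "H \<le> r" using empty_boxD[OF box, of "y0 + r" x] x by (force simp: M_def)
    then show "r \<in> {H..<k}" using \<open>r < k\<close> by simp
  qed
  then have "card (?f ` {x0..<x0 + M}) \<le> card {H..<k}" by (intro card_mono) auto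
  then have "nat M \<le> nat (k - H)" using inj by (simp add: card_image)
  then show ?thesis using WH k by (auto simp: M_def min_def split: if_splits)
qed

lemma box_condition_cong:
  assumes cong: "k\<^sup>2 dvd q - q'" and box: "box_condition k q r m"
  shows "box_condition k q' r m"
proof -
  have dvd: "p dvd y - q' * x \<longleftrightarrow> p dvd y - q * x" if "p dvd q - q'" for p x y
  proof -
    have "y - q' * x = (y - q * x) + (q - q') * x" by (simp add: algebra_simps)
    then show ?thesis using that by (metis dvd_add_left_iff dvd_mult2)
  qed
  have "k dvd q - q'" using cong by (auto simp: power2_eq_square dest: dvd_mult_left)
  then show ?thesis
    using box unfolding box_condition_def empty_box_def by (simp add: dvd[OF cong] dvd)
qed

lemma genus_minimizing_cong:
  assumes k: "k \<ge> 2" and cop: "coprime q (k\<^sup>2)" and cong: "[q = q'] (mod k\<^sup>2)"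
  shows "genus_minimizing (k\<^sup>2) q k \<longleftrightarrow> genus_minimizing (k\<^sup>2) q' k"
proof -
  have "coprime q' (k\<^sup>2)" using cop cong cong_imp_coprime by blast
  moreover have "k\<^sup>2 dvd q - q'" "k\<^sup>2 dvd q' - q"
    using cong by (simp_all add: cong_iff_dvd_diff dvd_diff_commute)
  ultimately show ?thesis
    using genus_minimizing_iff_box_condition[OF k] cop box_condition_cong by metis
qed

text \<open>In the next two lemmas, \<open>b = a * c - e * k\<close> with \<open>coprime a e\<close> expresses that \<open>(a, b)\<close> is a primitive
  vector of the lattice \<open>{(x, y). k dvd y - c * x}\<close>.\<close>

lemma lattice_primitive_multiple:
  fixes k c e a b x y :: int
  assumes "k \<noteq> 0" "a \<noteq> 0" and b: "b = a * c - e * k" and cop: "coprime a e"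
    and "k dvd y - c * x" and eq: "a * y = b * x"
  obtains t where "x = t * a" "y = t * b"
proof -
  obtain f where f: "y - c * x = k * f" using assms(5) by blast
  have "k * (a * f) = k * (- (e * x))"
    using eq b f by (simp add: algebra_simps)
  then have "a * f = - (e * x)" using assms(1) by (metis mult_left_cancel)
  then have "a dvd e * x" by (metis dvd_minus_iff dvd_triv_left)
  then obtain t where t: "x = a * t" using cop by (auto simp: coprime_dvd_mult_right_iff)
  then have "a * y = a * (t * b)" using eq by (simp add: mult.commute mult.left_commute)
  then have "y = t * b" using assms(2) by (metis mult_left_cancel)
  then show ?thesis using that[of t] t by (simp add: mult.commute)
qed

text \<open>The translates of an empty box by the multiples of \<open>(a, b)\<close> form a staircase, and the two points
  obtained lie on the rows of lattice points just above and just below it.\<close>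

lemma empty_box_strip:
  fixes k c e a b :: int
  assumes k: "k > 0" and b: "b = a * c - e * k" and cop: "coprime a e" and ab: "a \<ge> 1" "b \<ge> 1"
    and WH: "W \<ge> a" "H \<ge> b" and box: "empty_box k c x0 W y0 H"
  obtains x1 y1 x2 y2 where "k dvd y1 - c * x1" "k dvd y2 - c * x2" "x0 \<le> x1" "x1 < x0 + a"
    "y0 + H \<le> y1" "y0 \<le> y2" "y2 < y0 + b" "x0 + W \<le> x2" "a * (y1 - y2) + b * (x2 - x1) = k"
proof -
  obtain u v where uv: "u * a + v * e = 1"
    using bezout_int[of a e] cop by (auto simp: coprime_iff_gcd_eq_1)
  have auv: "a * u + e * v = 1" using uv by (simp add: mult.commute)
  \<comment> \<open>\<open>(v, h)\<close> completes \<open>(a, b)\<close> to a basis of the lattice,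
    as \<open>a * h - b * v = k\<close>. The rows are the level sets of
    \<open>a * y - b * x\<close>, whose values on the lattice are the multiples of k.\<close>
  define h where "h = v * c + u * k"
  have row: "a * (i * h + j * b) - b * (i * v + j * a) = i * k" for i j
  proof -
    have "a * (i * h + j * b) - b * (i * v + j * a) = i * k * (a * u + e * v)"
      by (simp add: h_def b algebra_simps)
    then show ?thesis using auv by simp
  qed
  have mem: "k dvd (i * h + j * b) - c * (i * v + j * a)" for i j
  proof -
    have "(i * h + j * b) - c * (i * v + j * a) = k * (i * u - j * e)"
      by (simp add: h_def b algebra_simps)
    then show ?thesis by simp
  qed
  \<comment> \<open>The value of the form at the lower left corner: row \<open>i\<close> is the
    first strictly above that corner, row \<open>i - 1\<close> passes through it or below.\<close>
  define f where "f = a * y0 - b * x0"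
  define i where "i = f div k + 1"
  have "f = k * (f div k) + f mod k" "0 \<le> f mod k" "f mod k < k" using k by auto
  moreover have "i * k = k * (f div k) + k" "(i - 1) * k = k * (f div k)" by (auto simp: i_def algebra_simps)
  ultimately have i: "f < i * k" "(i - 1) * k \<le> f" by linarith+
  \<comment> \<open>Row \<open>i\<close> has one point in each \<open>a\<close> successive columns.
    The one in the first \<open>a\<close> columns of the box cannot lie below the box, by the value
    of the form, nor inside it.\<close>
  define j where "j = - ((i * v - x0) div a)"
  define x1 y1 where "x1 = i * v + j * a" and "y1 = i * h + j * b"
  have "x1 = x0 + (i * v - x0) mod a"
    by (simp add: x1_def j_def minus_mult_div_eq_mod[symmetric] algebra_simps)
  then have x1: "x0 \<le> x1" "x1 < x0 + a" using ab by simp_all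
  have f1: "a * y1 - b * x1 = i * k" using row by (simp add: x1_def y1_def)
  have "\<not> y1 < y0"
  proof
    assume "y1 < y0"
    then have "a * y1 \<le> a * y0" "b * x0 \<le> b * x1" using ab x1 by (simp_all add: mult_left_mono)
    then show False using f1 i by (simp add: f_def)
  qed
  then have y1: "y0 + H \<le> y1"
    using empty_boxD[OF box, of y1 x1] mem[of i j] x1 WH by (fastforce simp: x1_def y1_def)
  \<comment> \<open>The same for row \<open>i - 1\<close> and the lowest \<open>b\<close> lines: its
    point there cannot lie left of the box or inside it.\<close>
  define l where "l = - (((i - 1) * h - y0) div b)"
  define x2 y2 where "x2 = (i - 1) * v + l * a" and "y2 = (i - 1) * h + l * b"
  have "y2 = y0 + ((i - 1) * h - y0) mod b"
    by (simp add: y2_def l_def minus_mult_div_eq_mod[symmetric] algebra_simps)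
  then have y2: "y0 \<le> y2" "y2 < y0 + b" using ab by simp_all
  have f2: "a * y2 - b * x2 = (i - 1) * k" using row by (simp add: x2_def y2_def)
  have "\<not> x2 < x0"
  proof
    assume "x2 < x0"
    then have "b * x2 < b * x0" "a * y0 \<le> a * y2" using ab y2 by (simp_all add: mult_left_mono)
    then show False using f2 i by (simp add: f_def)
  qed
  then have x2: "x0 + W \<le> x2"
    using empty_boxD[OF box, of y2 x2] mem[of "i - 1" l] y2 WH by (fastforce simp: x2_def y2_def)
  have "a * (y1 - y2) + b * (x2 - x1) = (a * y1 - b * x1) - (a * y2 - b * x2)" by (simp add: algebra_simps)
  also have "\<dots> = k" using f1 f2 by (simp add: algebra_simps)
  finally show ?thesis
    using that[of y1 x1 y2 x2] mem x1 y1 x2 y2 by (simp add: x1_def y1_def x2_def y2_def)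
qed

section \<open>The residues congruent to 1 modulo k\<close>

text \<open>The coarse lattice is y = x modulo k. With g = gcd(i, k), the vector (k/g, k/g) is short
  when g > 1, and for g \<ge> 3 its box is too large for \<open>empty_box_dims\<close>. For g = 2 it
  is the only vector with s > 0, and there is none with s < 0. For g = 1 only vectors (d, d - k)
  remain.\<close>

lemma genus_minimizing_type0_iff:
  fixes i k :: int
  assumes k: "k \<ge> 2"
  shows "genus_minimizing (k\<^sup>2) (i * k + 1) k \<longleftrightarrow> gcd i k \<in> {1, 2}"
proof -
  let ?q = "i * k + 1" and ?g = "gcd i k"
  have "coprime ?q k" by (rule coprimeI) (metis dvd_add_right_iff dvd_mult)
  then have cop: "coprime ?q (k\<^sup>2)" by simp
  have mod1: "k dvd y - ?q * x \<longleftrightarrow> k dvd y - x" for x y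
  proof -
    have "y - ?q * x = (y - x) - k * (i * x)" by (simp add: algebra_simps)
    then show ?thesis by (metis dvd_diff_left_iff dvd_triv_left)
  qed
  have g: "?g > 0" "?g dvd k" "?g dvd i" using k by auto
  then obtain k' i' where k': "k = ?g * k'" and i': "i = ?g * i'" by (meson dvdE)
  have k'0: "k' > 0" using k' g k by (metis zero_less_mult_pos less_le_trans zero_less_numeral)
  show ?thesis
  proof
    assume "genus_minimizing (k\<^sup>2) ?q k"
    then obtain m where box: "box_condition k ?q 0 m"
      using genus_minimizing_iff_box_condition[OF k cop] by blast
    show "?g \<in> {1, 2}"
    proof (rule ccontr)
      assume "?g \<notin> {1, 2}"
      then have "?g \<noteq> 1 \<and> ?g \<noteq> 2" by (metis insertI1 insertI2)
      then have g3: "?g \<ge> 3" using g(1) by linarith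
      have "3 * k' \<le> ?g * k'" using g3 k'0 by (simp add: mult_right_mono)
      then have k3: "3 * k' \<le> k" using k' by simp
      have "k' - ?q * k' = k\<^sup>2 * (- i')"
      proof -
        have "i * k' = k * i'" using k' i' by (metis mult.assoc mult.commute)
        then show ?thesis by (simp add: power2_eq_square algebra_simps)
      qed
      then have "k\<^sup>2 dvd k' - ?q * k'" by simp
      moreover have "k' < k" using k3 k'0 by linarith
      ultimately have "empty_box k ?q 0 (k - k') m (k - k')"
        using box k'0 unfolding box_condition_def by blast
      then have "(k - k') + (k - k') \<le> k"
        by (rule empty_box_dims[rotated 2]) (use \<open>coprime ?q k\<close> k k3 k'0 in auto)
      then show False using k3 k'0 by simp
    qed
  next
    assume g12: "?g \<in> {1, 2}"
    \<comment> \<open>For gcd 2 the k' x k' box at (0, k') fits between two diagonals; for gcd 1 all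
      boxes hang below the corner (0, 0) and miss them.\<close>
    define m where "m = (if ?g = 1 then 0 else k')"
    have "box_condition k ?q 0 m"
      unfolding box_condition_def
    proof (intro allI impI conjI)
      fix d s assume d: "0 < d" "d < k" and sd: "k\<^sup>2 dvd s - ?q * d"
      then obtain l where l: "s - ?q * d = k\<^sup>2 * l" by blast
      have "k dvd s - ?q * d" using sd by (auto simp: power2_eq_square dest: dvd_mult_left)
      then have ksd: "k dvd s - d" using mod1 by simp
      show "empty_box k ?q 0 (k - d) m (k - s)" if s: "0 < s" "s < k"
      proof -
        have "s = d" using ksd s d zdvd_not_zless[of "\<bar>s - d\<bar>" k] by force
        then have "k * (i * d) = k * (k * (- l))" using l by (simp add: power2_eq_square algebra_simps)
        then have "i * d = k * (- l)" using k by (metis mult_left_cancel not_numeral_le_zero)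
        then have "?g * (i' * d) = ?g * (k' * (- l))" using i' k' by (metis mult.assoc)
        then have "i' * d = k' * (- l)" using g by (metis mult_left_cancel less_irrefl)
        then have "k' dvd i' * d" by (metis dvd_triv_left)
        moreover have "coprime k' i'"
        proof -
          have "coprime (i div ?g) (k div ?g)" using k by (intro div_gcd_coprime) simp
          moreover have "i div ?g = i'" "k div ?g = k'"
            using k' i' g by (metis nonzero_mult_div_cancel_left less_irrefl)+
          ultimately show ?thesis by (simp add: coprime_commute)
        qed
        ultimately have "k' dvd d" by (simp add: coprime_dvd_mult_right_iff)
        then have "k' \<le> d" using d by (simp add: zdvd_imp_le)
        with g12 d k' have g2: "?g = 2" by auto
        then have k2: "k = 2 * k'" using k' by simp
        show ?thesis
          unfolding empty_box_def mod1
        proof (intro allI impI notI)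
          fix x y assume "0 \<le> x" "x < 0 + (k - d)" "m \<le> y" "y < m + (k - s)" "k dvd y - x"
          then show False using zdvd_not_zless[of "y - x" k] \<open>k' \<le> d\<close> \<open>s = d\<close> k2 g2 by (simp add: m_def)
        qed
      qed
      show "empty_box k ?q 0 (k - d) (m - (k + s)) (k + s)" if s: "s < 0" "- k < s"
      proof -
        have "k dvd (s - d) + k" using ksd by simp
        then have "s = d - k" using s d zdvd_not_zless[of "\<bar>s - d + k\<bar>" k] by force
        then have "k * (i * d + 1) = k * (k * (- l))" using l by (simp add: power2_eq_square algebra_simps)
        then have id: "i * d + 1 = k * (- l)" using k by (metis mult_left_cancel not_numeral_le_zero)
        have "?g dvd k * (- l) - i * d" using g by (meson dvd_diff dvd_mult2)
        then have "?g dvd 1" using id by (metis add_diff_cancel_left')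
        then have "?g = 1" using g by auto
        show ?thesis
          unfolding empty_box_def mod1
        proof (intro allI impI notI)
          fix x y assume *: "0 \<le> x" "x < 0 + (k - d)" "m - (k + s) \<le> y" "y < m - (k + s) + (k + s)" "k dvd y - x"
          then have "k dvd (y - x) + k" by simp
          then show False using * zdvd_not_zless[of "y - x + k" k] \<open>s = d - k\<close> \<open>?g = 1\<close> by (simp add: m_def)
        qed
      qed
    qed
    then show "genus_minimizing (k\<^sup>2) ?q k"
      using genus_minimizing_iff_box_condition[OF k cop] by blast
  qed
qed

section \<open>Multiples of \<open>k + 1\<close> and \<open>k - 1\<close>\<close>

lemma separating_shift_add_period:
  assumes "k > 0" "separating_shift k q m"
  shows "separating_shift k q (m + k * t)"
proof -
  have "(x - (m + k * t)) div k = - t + (x - m) div k" for x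
  proof -
    have "x - (m + k * t) = (x - m) + (- t) * k" by (simp add: algebra_simps)
    then show ?thesis using assms(1) by (simp only: div_mult_self1)
  qed
  then show ?thesis using assms(2) by (simp add: separating_shift_def)
qed

text \<open>Write \<open>a * E = b + k * i\<close> with \<open>0 \<le> i < E\<close>. The quotient
  \<open>i\<close> is determined by \<open>b\<close>: reduction modulo E gives
  \<open>i = \<tau> * b\<close>, where \<tau> = -1/k. So the block number of the point with index a
  depends modulo k only on the residue b, which runs through all classes modulo k as a does.\<close>

lemma separating_shift_iff_residues:
  fixes k E s \<tau> m :: int
  assumes k: "k \<ge> 2" and E: "0 < E" "coprime E k" and \<tau>: "E dvd k * \<tau> + 1"
  defines "val \<equiv> \<lambda>b. s * b + (\<tau> * b) mod E + (b - m) div k"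
  shows "separating_shift k (E * (1 + s * k)) m \<longleftrightarrow>
    (\<forall>b b'. 0 \<le> b \<longrightarrow> b < k \<longrightarrow> 0 \<le> b' \<longrightarrow> b' < k \<longrightarrow> k dvd val b - val b' \<longrightarrow> b = b')"
proof -
  let ?q = "E * (1 + s * k)"
  have val: "k dvd (a * ?q - m) div k - val ((a * E) mod k)" if a: "0 \<le> a" "a < k" for a
  proof -
    define b i where "b = (a * E) mod k" and "i = (a * E) div k"
    have ab: "a * E = b + k * i" by (simp add: b_def i_def)
    have "a * E < k * E" using a E by simp
    moreover have "0 \<le> b" "0 \<le> a * E" using k a E by (auto simp: b_def)
    ultimately have "k * i < k * E" using ab by linarith
    then have i: "0 \<le> i" "i < E"
      using k \<open>0 \<le> a * E\<close> by (simp_all add: i_def pos_imp_zdiv_nonneg_iff)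
    have "b = a * E - k * i" using ab by simp
    have "\<tau> * b - i = \<tau> * a * E - i * (k * \<tau> + 1)"
      by (subst \<open>b = a * E - k * i\<close>) (simp add: algebra_simps)
    then have "E dvd \<tau> * b - i" using \<tau> by simp
    then have "(\<tau> * b) mod E = i" using i by (metis mod_eq_dvd_iff mod_pos_pos_trivial)
    moreover have "a * ?q - m = (b - m) + (i + s * (a * E)) * k"
    proof -
      define X where "X = s * (a * E) * k"
      have "a * ?q = a * E + X" "(i + s * (a * E)) * k = k * i + X"
        by (simp_all add: X_def algebra_simps)
      then show ?thesis using ab by simp
    qed
    then have "(a * ?q - m) div k = (i + s * (a * E)) + (b - m) div k" using k by (simp only: div_mult_self1)
    moreover have "s * (a * E) - s * b = k * (s * i)" by (subst ab) (simp add: algebra_simps)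
    ultimately have "(a * ?q - m) div k - val b = k * (s * i)"
      by (simp add: val_def)
    then show ?thesis by (simp add: b_def)
  qed
  have iff: "k dvd (a * ?q - m) div k - (a' * ?q - m) div k \<longleftrightarrow> k dvd val ((a * E) mod k) - val ((a' * E) mod k)"
    if "0 \<le> a" "a < k" "0 \<le> a'" "a' < k" for a a'
    using val[of a] val[of a'] that by (simp add: mod_eq_dvd_iff[symmetric])
  have inj: "a = a'" if "(a * E) mod k = (a' * E) mod k" "0 \<le> a" "a < k" "0 \<le> a'" "a' < k" for a a'
  proof -
    have "k dvd (a - a') * E" using that by (simp add: mod_eq_dvd_iff algebra_simps)
    then have "k dvd a - a'" using E by (simp add: coprime_commute coprime_dvd_mult_left_iff)
    then show ?thesis using that zdvd_not_zless[of "\<bar>a - a'\<bar>" k] by force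
  qed
  have surj: "\<exists>a. 0 \<le> a \<and> a < k \<and> (a * E) mod k = b" if "0 \<le> b" "b < k" for b
  proof -
    obtain u where "[E * u = 1] (mod k)" using E(2) cong_solve_coprime_int by blast
    then have "[E * u * b = 1 * b] (mod k)" by (rule cong_mult) simp
    then have "((b * u) mod k * E) mod k = b"
      using that by (simp add: cong_def mod_simps mult_ac)
    then show ?thesis using k by (intro exI[of _ "(b * u) mod k"]) simp
  qed
  show ?thesis
  proof
    assume sep: "separating_shift k ?q m"
    show "\<forall>b b'. 0 \<le> b \<longrightarrow> b < k \<longrightarrow> 0 \<le> b' \<longrightarrow> b' < k \<longrightarrow> k dvd val b - val b' \<longrightarrow> b = b'"
    proof (intro allI impI)
      fix b b' assume b: "0 \<le> b" "b < k" "0 \<le> b'" "b' < k" and dvd: "k dvd val b - val b'"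
      obtain a a' where a: "0 \<le> a" "a < k" "(a * E) mod k = b" "0 \<le> a'" "a' < k" "(a' * E) mod k = b'"
        using surj b by metis
      then have "a = a'" using sep iff[of a a'] dvd unfolding separating_shift_def by blast
      then show "b = b'" using a by simp
    qed
  next
    assume *: "\<forall>b b'. 0 \<le> b \<longrightarrow> b < k \<longrightarrow> 0 \<le> b' \<longrightarrow> b' < k \<longrightarrow> k dvd val b - val b' \<longrightarrow> b = b'"
    show "separating_shift k ?q m"
      unfolding separating_shift_def
    proof (intro allI impI)
      fix a a' assume a: "0 \<le> a" "a < k" "0 \<le> a'" "a' < k"
        and "k dvd (a * ?q - m) div k - (a' * ?q - m) div k"
      then have "k dvd val ((a * E) mod k) - val ((a' * E) mod k)" using iff by blast
      moreover have "0 \<le> (a * E) mod k" "(a * E) mod k < k" "0 \<le> (a' * E) mod k" "(a' * E) mod k < k"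
        using k by auto
      ultimately have "(a * E) mod k = (a' * E) mod k" using * by blast
      then show "a = a'" using inj a by blast
    qed
  qed
qed

lemma mod_add_one_int:
  fixes x E :: int
  assumes "E > 0" "\<not> E dvd x + 1"
  shows "(x + 1) mod E = x mod E + 1"
proof -
  have "(x + 1) mod E = (x mod E + 1) mod E" by (simp add: mod_simps)
  moreover have "x mod E + 1 \<noteq> E"
    using assms by (metis calculation mod_0_imp_dvd mod_self)
  then have "(x mod E + 1) mod E = x mod E + 1"
    using assms(1) pos_mod_bound[of E x] pos_mod_sign[of E x] by (intro mod_pos_pos_trivial) linarith+
  ultimately show ?thesis by simp
qed

text \<open>For m = k - w the term \<open>(b - m) div k\<close> only distinguishes the last w
  residues. Replacing such a residue by b - k lowers \<open>\<tau> * b\<close> by -1 modulo E in the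
  opposite direction, which absorbs that term. No multiple of E lies among -w, ..., -1, so the
  residue of \<open>\<tau> * b\<close> changes by exactly 1 without wrapping.\<close>

lemma separating_shift_iff_window:
  fixes k E s \<tau> w :: int
  assumes k: "k \<ge> 2" and E: "0 < E" "E < k" "coprime E k" and \<tau>: "E dvd k * \<tau> + 1" and w: "0 \<le> w" "w < E"
  defines "\<psi> \<equiv> \<lambda>b. s * b + (\<tau> * b) mod E"
  shows "separating_shift k (E * (1 + s * k)) (k - w) \<longleftrightarrow>
    (\<forall>b b'. - w \<le> b \<longrightarrow> b < k - w \<longrightarrow> - w \<le> b' \<longrightarrow> b' < k - w \<longrightarrow> k dvd \<psi> b - \<psi> b' \<longrightarrow> b = b')"
proof -
  define val where "val b = s * b + (\<tau> * b) mod E + (b - (k - w)) div k" for b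
  have cop\<tau>: "coprime \<tau> E"
  proof (rule coprimeI)
    fix d assume "d dvd \<tau>" "d dvd E"
    then have "d dvd (k * \<tau> + 1) - k * \<tau>" using \<tau> by (meson dvd_diff dvd_mult dvd_trans)
    then show "is_unit d" by simp
  qed
  have v1: "val b = \<psi> b - 1" if "0 \<le> b" "b < k - w" for b
  proof -
    have "b - (k - w) = (b + w) + (- 1) * k" by simp
    then have "(b - (k - w)) div k = - 1 + (b + w) div k" using k by (simp only: div_mult_self1)
    moreover have "(b + w) div k = 0" using that w by simp
    ultimately have "(b - (k - w)) div k = - 1" by simp
    then show ?thesis by (simp add: val_def \<psi>_def)
  qed
  have v2: "val (b + k) = \<psi> b - 1 + k * s" if b: "- w \<le> b" "b < 0" for b
  proof -
    have "(b + k - (k - w)) div k = 0" using that w E by simp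
    obtain l where l: "k * \<tau> = E * l - 1" using \<tau> by (metis dvdE eq_diff_eq)
    have "\<not> E dvd b" using b w zdvd_not_zless[of "- b" E] by simp
    then have "\<not> E dvd \<tau> * b" using cop\<tau> by (simp add: coprime_commute coprime_dvd_mult_right_iff)
    then have "(\<tau> * b - 1 + 1) mod E = (\<tau> * b - 1) mod E + 1"
      using E by (intro mod_add_one_int) auto
    moreover have "(\<tau> * (b + k)) mod E = (\<tau> * b - 1) mod E"
    proof -
      have "\<tau> * (b + k) = (\<tau> * b - 1) + E * l" using l by (simp add: algebra_simps)
      then show ?thesis by simp
    qed
    ultimately show ?thesis
      using \<open>(b + k - (k - w)) div k = 0\<close> by (simp add: val_def \<psi>_def algebra_simps)
  qed
  define rep where "rep b = (if b < 0 then b + k else b)" for b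
  have vrep: "k dvd val (rep b) - (\<psi> b - 1)" if "- w \<le> b" "b < k - w" for b
    using v1[of b] v2[of b] that by (simp add: rep_def)
  have iff: "k dvd \<psi> b - \<psi> b' \<longleftrightarrow> k dvd val (rep b) - val (rep b')"
    if "- w \<le> b" "b < k - w" "- w \<le> b'" "b' < k - w" for b b'
  proof -
    have "\<psi> b - \<psi> b' = (\<psi> b - 1) - (\<psi> b' - 1)" by simp
    then show ?thesis using vrep[of b] vrep[of b'] that
      by (simp only: mod_eq_dvd_iff[symmetric])
  qed
  have rep_inj: "b = b'" if "rep b = rep b'" "- w \<le> b" "b < k - w" "- w \<le> b'" "b' < k - w" for b b'
    using that by (auto simp: rep_def split: if_splits)
  have rep_surj: "\<exists>b'. - w \<le> b' \<and> b' < k - w \<and> rep b' = b" if "0 \<le> b" "b < k" for b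
    using that w E by (intro exI[of _ "if b < k - w then b else b - k"]) (auto simp: rep_def)
  have rep_range: "0 \<le> rep b \<and> rep b < k" if "- w \<le> b" "b < k - w" for b
    using that w E by (auto simp: rep_def)
  have "separating_shift k (E * (1 + s * k)) (k - w) \<longleftrightarrow>
    (\<forall>b b'. 0 \<le> b \<longrightarrow> b < k \<longrightarrow> 0 \<le> b' \<longrightarrow> b' < k \<longrightarrow> k dvd val b - val b' \<longrightarrow> b = b')"
    using separating_shift_iff_residues[OF k E(1) E(3) \<tau>, of s "k - w"] by (simp only: val_def)
  also have "\<dots> \<longleftrightarrow>
    (\<forall>b b'. - w \<le> b \<longrightarrow> b < k - w \<longrightarrow> - w \<le> b' \<longrightarrow> b' < k - w \<longrightarrow> k dvd \<psi> b - \<psi> b' \<longrightarrow> b = b')"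
  proof (intro iffI allI impI)
    fix b b'
    assume sep: "\<forall>b b'. 0 \<le> b \<longrightarrow> b < k \<longrightarrow> 0 \<le> b' \<longrightarrow> b' < k \<longrightarrow> k dvd val b - val b' \<longrightarrow> b = b'"
      and b: "- w \<le> b" "b < k - w" "- w \<le> b'" "b' < k - w" and "k dvd \<psi> b - \<psi> b'"
    then have "rep b = rep b'" using iff[OF b] rep_range[OF b(1,2)] rep_range[OF b(3,4)] by blast
    then show "b = b'" using rep_inj b by blast
  next
    fix c c'
    assume inj: "\<forall>b b'. - w \<le> b \<longrightarrow> b < k - w \<longrightarrow> - w \<le> b' \<longrightarrow> b' < k - w \<longrightarrow> k dvd \<psi> b - \<psi> b' \<longrightarrow> b = b'"
      and c: "0 \<le> c" "c < k" "0 \<le> c'" "c' < k" and dvd: "k dvd val c - val c'"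
    obtain b where b: "- w \<le> b" "b < k - w" "rep b = c" using rep_surj[OF c(1,2)] by blast
    obtain b' where b': "- w \<le> b'" "b' < k - w" "rep b' = c'" using rep_surj[OF c(3,4)] by blast
    have "b = b'" using inj b b' iff[OF b(1,2) b'(1,2)] dvd by blast
    then show "c = c'" using b b' by simp
  qed
  finally show ?thesis .
qed

section \<open>Sufficiency: divisors of \<open>k + 1\<close>, \<open>2 * k - 1\<close>,
  \<open>k - 1\<close> and \<open>2 * k + 1\<close>\<close>

lemma odd_mod_cases:
  fixes E h w :: int
  assumes "E = 2 * w + 1" "0 \<le> w" "\<bar>h\<bar> < E" "E dvd 2 * h + 1"
  shows "h = w \<or> h = - w - 1"
proof -
  obtain l where l: "2 * h + 1 = E * l" using assms(4) by blast
  have "E * l < E * 2" "E * (-2) < E * l" using assms l by linarith+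
  moreover have "0 < E" using assms by simp
  ultimately have "l < 2" "-2 < l" using mult_less_cancel_left_pos by blast+
  moreover have "l \<noteq> 0"
  proof
    assume "l = 0"
    with l have "2 * h + 1 = 0" by simp
    then show False by presburger
  qed
  ultimately have "l = 1 \<or> l = -1" by linarith
  then show ?thesis using l assms(1) by auto
qed

lemma dvd_small_cases:
  fixes E h :: int
  assumes "0 < E" "\<bar>h\<bar> < E" "E dvd h - 1"
  shows "h = 1 \<or> h = 1 - E"
proof -
  obtain l where l: "h - 1 = E * l" using assms(3) by blast
  have "E * l < E * 1" "E * (-2) < E * l" using assms l by linarith+
  then have "l < 1" "-2 < l" using mult_less_cancel_left_pos[OF assms(1)] by blast+
  then have "l = 0 \<or> l = -1" by linarith
  then show ?thesis using l by auto
qed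

text \<open>For two window elements at distance g the values differ by s * g + h with 0 < g < k and
  |h| < E < k. Up to the sign s this is \<open>g + s * h\<close>, which lies strictly between -k and
  2k, so as a multiple of k it can only be 0 or k. These are excluded by \<open>zero\<close> and
  \<open>wrap\<close>.\<close>

lemma window_injectiveI:
  fixes k E s \<tau> w :: int
  assumes E: "0 < E" "E < k" and s: "\<bar>s\<bar> = 1"
    and zero: "\<And>g h. 0 < g \<Longrightarrow> \<bar>h\<bar> < E \<Longrightarrow> E dvd h - \<tau> * g \<Longrightarrow> s * g + h \<noteq> 0"
    and wrap: "\<And>b b'. - w \<le> b \<Longrightarrow> b' < k - w \<Longrightarrow> b < b' \<Longrightarrow>
      b' - b + s * ((\<tau> * b') mod E - (\<tau> * b) mod E) \<noteq> k"
    and b: "- w \<le> b" "b < k - w" "- w \<le> b'" "b' < k - w"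
    and dvd: "k dvd (s * b + (\<tau> * b) mod E) - (s * b' + (\<tau> * b') mod E)"
  shows "b = b'"
proof -
  have *: False if "- w \<le> b" "b' < k - w" "b < b'"
    "k dvd (s * b' + (\<tau> * b') mod E) - (s * b + (\<tau> * b) mod E)" for b b'
  proof -
    define g h where "g = b' - b" and "h = (\<tau> * b') mod E - (\<tau> * b) mod E"
    have ss: "s * s = 1" using s by (metis abs_mult_self_eq mult_1)
    have h: "\<bar>h\<bar> < E"
      using pos_mod_bound[OF E(1), of "\<tau> * b"] pos_mod_bound[OF E(1), of "\<tau> * b'"]
        pos_mod_sign[OF E(1), of "\<tau> * b"] pos_mod_sign[OF E(1), of "\<tau> * b'"]
      unfolding h_def by linarith
    have hE: "E dvd h - \<tau> * g"
      unfolding h_def g_def by (simp add: mod_eq_dvd_iff[symmetric] mod_simps algebra_simps)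
    have "k dvd s * g + h" using that(4) by (simp add: g_def h_def algebra_simps)
    then have "k dvd s * (s * g + h)" by (rule dvd_mult)
    moreover have sgh: "s * (s * g + h) = g + s * h" using ss by (simp add: distrib_left mult.assoc[symmetric])
    ultimately have "k dvd g + s * h" by simp
    then obtain l where l: "g + s * h = k * l" by blast
    have "\<bar>s * h\<bar> < E" using h s by (simp add: abs_mult)
    then have "- E < s * h" "s * h < E" by linarith+
    moreover have "0 < g" "g < k" using that by (auto simp: g_def)
    ultimately have "k * l < k * 2" "k * (- 1) < k * l" using l E by linarith+
    moreover have "0 < k" using E by simp
    ultimately have "l < 2" "- 1 < l" using mult_less_cancel_left_pos by blast+
    then consider "l = 0" | "l = 1" by linarith
    then show False
    proof cases
      case 1
      then have "s * (s * g + h) = 0" using l sgh by simp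
      then have "s * g + h = 0" using s by auto
      then show False using zero[OF \<open>0 < g\<close> h hE] by simp
    next
      case 2
      then show False using wrap[of b b'] that l by (simp add: g_def h_def)
    qed
  qed
  have "k dvd (s * b' + (\<tau> * b') mod E) - (s * b + (\<tau> * b) mod E)" using dvd by (simp add: dvd_diff_commute)
  then show ?thesis using *[of b b'] *[of b' b] b dvd by (metis linorder_neqE_linordered_idom)
qed

lemma genus_minimizing_of_window:
  fixes k E s \<tau> :: int
  assumes k: "k \<ge> 2" and E: "0 < E" "E < k" "odd E" and s: "\<bar>s\<bar> = 1" and \<tau>: "E dvd k * \<tau> + 1"
    and zero: "\<And>g h. 0 < g \<Longrightarrow> \<bar>h\<bar> < E \<Longrightarrow> E dvd h - \<tau> * g \<Longrightarrow> s * g + h \<noteq> 0"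
    and wrap: "\<And>b b'. - (E div 2) \<le> b \<Longrightarrow> b' < k - E div 2 \<Longrightarrow> b < b' \<Longrightarrow>
      b' - b + s * ((\<tau> * b') mod E - (\<tau> * b) mod E) \<noteq> k"
  shows "genus_minimizing (k\<^sup>2) (E * (1 + s * k)) k"
proof -
  have copE: "coprime E k"
  proof (rule coprimeI)
    fix d assume "d dvd E" "d dvd k"
    then have "d dvd (k * \<tau> + 1) - k * \<tau>" using \<tau> by (meson dvd_diff dvd_mult2 dvd_trans)
    then show "is_unit d" by simp
  qed
  have "coprime (1 + s * k) k" by (rule coprimeI) (metis dvd_add_left_iff dvd_mult)
  then have cop: "coprime (E * (1 + s * k)) (k\<^sup>2)" using copE by simp
  \<comment> \<open>For s = 1 the half \<open>E div 2\<close> is the only possible window parameter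
    below E, as the necessity argument shows.\<close>
  have "separating_shift k (E * (1 + s * k)) (k - E div 2)"
    using E window_injectiveI[OF E(1,2) s zero wrap]
    by (subst separating_shift_iff_window[OF k E(1,2) copE \<tau>]) auto
  then show ?thesis by (rule separating_shift_imp_genus_minimizing[OF k cop])
qed

context
  fixes k E :: int
  assumes k: "k \<ge> 2" and E: "0 < E" "E < k" "odd E"
begin

lemma mod_modulus_facts: "0 \<le> x mod E" "x mod E < E" "E dvd x mod E - x"
  using E by (auto simp: mod_eq_dvd_iff[symmetric])

lemma modulus_half: "E = 2 * (E div 2) + 1" "0 \<le> E div 2"
  using E by auto

text \<open>Here and in the next three lemmas \<tau> is the value of -1/k modulo E, namely 1, -2, -1
  and 2. The congruence \<open>h = \<tau> * g\<close> turns a collision modulo k into one or two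
  values of h. These fail either because the window is shorter than the required distance or because
  a residue would leave \<open>0..<E\<close>.\<close>

lemma genus_minimizing_mult_Suc_of_dvd_Suc:
  assumes "E dvd k + 1"
  shows "genus_minimizing (k\<^sup>2) (E * (1 + k)) k"
proof -
  have "genus_minimizing (k\<^sup>2) (E * (1 + 1 * k)) k"
  proof (rule genus_minimizing_of_window[OF k E, where \<tau> = 1])
    fix g h :: int assume g: "0 < g" "\<bar>h\<bar> < E" "E dvd h - 1 * g"
    show "1 * g + h \<noteq> 0"
    proof
      assume "1 * g + h = 0"
      then have "h - 1 * g = 2 * h" by linarith
      then have "E dvd 2 * h" using g(3) by (simp only:)
      then have "E dvd h" using E by (simp add: coprime_dvd_mult_right_iff)
      then have "h = 0" using g(2) zdvd_not_zless[of "\<bar>h\<bar>" E] by force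
      then show False using \<open>1 * g + h = 0\<close> g by simp
    qed
  next
    fix b b' assume b: "- (E div 2) \<le> b" "b' < k - E div 2" "b < b'"
    define w h where "w = E div 2" and "h = b' mod E - b mod E"
    show "b' - b + 1 * ((1 * b') mod E - (1 * b) mod E) \<noteq> k"
    proof
      assume "b' - b + 1 * ((1 * b') mod E - (1 * b) mod E) = k"
      then have g: "b' - b = k - h" by (simp add: h_def)
      have "E dvd (b' mod E - b') - (b mod E - b)" by (rule dvd_diff[OF mod_modulus_facts(3) mod_modulus_facts(3)])
      then have "E dvd h - (b' - b)" by (simp add: h_def algebra_simps)
      then have "E dvd (h - (b' - b)) + (k + 1)" using assms by (rule dvd_add)
      then have "E dvd 2 * h + 1" using g by (simp add: algebra_simps)
      moreover have "\<bar>h\<bar> < E" using mod_modulus_facts[of b] mod_modulus_facts[of b'] unfolding h_def by linarith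
      ultimately have "h = w \<or> h = - w - 1" using odd_mod_cases[of E w h] modulus_half by (simp add: w_def)
      then show False
      proof
        \<comment> \<open>The distance is k - w, so b is negative and has residue at least w + 1;
          adding w exceeds E - 1.\<close>
        assume h: "h = w"
        have "b < 0" using b g h by (simp add: w_def)
        then have "(b + E) mod E = b + E" using b modulus_half by (intro mod_pos_pos_trivial) linarith+
        then have "b mod E = b + E" by simp
        then show False using h b mod_modulus_facts[of b'] modulus_half(1) by (simp add: h_def w_def)
      next
        assume "h = - w - 1"
        then show False using b g modulus_half by (simp add: w_def)
      qed
    qed
  qed (use assms in auto)
  then show ?thesis by simp
qed

lemma genus_minimizing_mult_Suc_of_dvd_double_pred:
  assumes "E dvd 2 * k - 1"
  shows "genus_minimizing (k\<^sup>2) (E * (1 + k)) k"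
proof -
  have "genus_minimizing (k\<^sup>2) (E * (1 + 1 * k)) k"
  proof (rule genus_minimizing_of_window[OF k E, where \<tau> = "- 2"])
    have "E dvd - (2 * k - 1)" using assms by (simp only: dvd_minus_iff)
    then show "E dvd k * - 2 + 1" by (simp add: algebra_simps)
  next
    fix g h :: int assume g: "0 < g" "\<bar>h\<bar> < E" "E dvd h - - 2 * g"
    show "1 * g + h \<noteq> 0"
    proof
      assume "1 * g + h = 0"
      then have "h = - g" by simp
      then have "E dvd g" using g by simp
      then show False using \<open>h = - g\<close> g zdvd_not_zless[of g E] by simp
    qed
  next
    fix b b' assume b: "- (E div 2) \<le> b" "b' < k - E div 2" "b < b'"
    define w h where "w = E div 2" and "h = (- 2 * b') mod E - (- 2 * b) mod E"
    show "b' - b + 1 * ((- 2 * b') mod E - (- 2 * b) mod E) \<noteq> k"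
    proof
      assume "b' - b + 1 * ((- 2 * b') mod E - (- 2 * b) mod E) = k"
      then have g: "b' - b = k - h" by (simp add: h_def)
      have "E dvd ((- 2 * b') mod E - (- 2 * b')) - ((- 2 * b) mod E - (- 2 * b))"
        by (rule dvd_diff[OF mod_modulus_facts(3) mod_modulus_facts(3)])
      then have "E dvd h + 2 * (b' - b)" by (simp add: h_def algebra_simps)
      then have "E dvd (2 * k - 1) - (h + 2 * (b' - b))" using assms by (rule dvd_diff[rotated])
      then have "E dvd h - 1" using g by (simp add: algebra_simps)
      moreover have "\<bar>h\<bar> < E" using mod_modulus_facts[of "- 2 * b"] mod_modulus_facts[of "- 2 * b'"] unfolding h_def by linarith
      ultimately have "h = 1 \<or> h = 1 - E" using dvd_small_cases[of E h] E by simp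
      moreover have "h \<noteq> 1 - E" using b g E by auto
      ultimately have h: "h = 1" by simp
      \<comment> \<open>The distance k - 1 forces the two ends of the window. At the left end the
        residue is already the maximal E - 1, so it cannot increase by 1.\<close>
      then have "b = - w" using b g by (simp add: w_def)
      then have "- 2 * b = E - 1" using modulus_half by (simp add: w_def)
      then have "(- 2 * b) mod E = (E - 1) mod E" by (rule arg_cong)
      also have "\<dots> = E - 1" using E by (intro mod_pos_pos_trivial) auto
      finally have "(- 2 * b) mod E = E - 1" .
      then show False using h mod_modulus_facts[of "- 2 * b'"] by (simp add: h_def)
    qed
  qed auto
  then show ?thesis by simp
qed

lemma genus_minimizing_mult_pred_of_dvd_pred:
  assumes "E dvd k - 1"
  shows "genus_minimizing (k\<^sup>2) (E * (1 - k)) k"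
proof -
  have "genus_minimizing (k\<^sup>2) (E * (1 + (- 1) * k)) k"
  proof (rule genus_minimizing_of_window[OF k E, where \<tau> = "- 1"])
    have "E dvd - (k - 1)" using assms by (simp only: dvd_minus_iff)
    then show "E dvd k * - 1 + 1" by (simp add: algebra_simps)
  next
    fix g h :: int assume g: "0 < g" "\<bar>h\<bar> < E" "E dvd h - - 1 * g"
    show "- 1 * g + h \<noteq> 0"
    proof
      assume "- 1 * g + h = 0"
      then have "h - - 1 * g = 2 * h" by linarith
      then have "E dvd 2 * h" using g(3) by (simp only:)
      then have "E dvd h" using E by (simp add: coprime_dvd_mult_right_iff)
      then have "h = 0" using g(2) zdvd_not_zless[of "\<bar>h\<bar>" E] by force
      then show False using \<open>- 1 * g + h = 0\<close> g by simp
    qed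
  next
    fix b b' assume b: "- (E div 2) \<le> b" "b' < k - E div 2" "b < b'"
    define w h where "w = E div 2" and "h = (- 1 * b') mod E - (- 1 * b) mod E"
    show "b' - b + - 1 * ((- 1 * b') mod E - (- 1 * b) mod E) \<noteq> k"
    proof
      assume "b' - b + - 1 * ((- 1 * b') mod E - (- 1 * b) mod E) = k"
      then have g: "b' - b = k + h" by (simp add: h_def)
      have "E dvd ((- 1 * b') mod E - (- 1 * b')) - ((- 1 * b) mod E - (- 1 * b))"
        by (rule dvd_diff[OF mod_modulus_facts(3) mod_modulus_facts(3)])
      then have "E dvd h + (b' - b)" by (simp add: h_def algebra_simps)
      then have "E dvd (h + (b' - b)) - (k - 1)" using assms by (rule dvd_diff)
      then have "E dvd 2 * h + 1" using g by (simp add: algebra_simps)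
      moreover have "\<bar>h\<bar> < E" using mod_modulus_facts[of "- 1 * b"] mod_modulus_facts[of "- 1 * b'"] unfolding h_def by linarith
      ultimately have "h = w \<or> h = - w - 1" using odd_mod_cases[of E w h] modulus_half by (simp add: w_def)
      moreover have "h \<noteq> w" using b g modulus_half by (simp add: w_def)
      ultimately have h: "h = - w - 1" by simp
      \<comment> \<open>Then the residue of -b is -b \<le> w, and lowering it by w + 1 makes it
        negative.\<close>
      then have "b \<le> 0" using b g by (simp add: w_def)
      then have "(- 1 * b) mod E = - b" using b modulus_half E by (intro trans[OF mod_pos_pos_trivial]) auto
      then show False using h b mod_modulus_facts[of "- 1 * b'"] by (simp add: h_def w_def)
    qed
  qed auto
  then show ?thesis by simp
qed

lemma genus_minimizing_mult_pred_of_dvd_double_Suc: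
  assumes "E dvd 2 * k + 1"
  shows "genus_minimizing (k\<^sup>2) (E * (1 - k)) k"
proof -
  have "genus_minimizing (k\<^sup>2) (E * (1 + (- 1) * k)) k"
  proof (rule genus_minimizing_of_window[OF k E, where \<tau> = 2])
    show "E dvd k * 2 + 1" using assms by (simp add: algebra_simps)
  next
    fix g h :: int assume g: "0 < g" "\<bar>h\<bar> < E" "E dvd h - 2 * g"
    show "- 1 * g + h \<noteq> 0"
    proof
      assume "- 1 * g + h = 0"
      then have "h = g" by simp
      then have "E dvd g" using g by simp
      then show False using \<open>h = g\<close> g zdvd_not_zless[of g E] by simp
    qed
  next
    fix b b' assume b: "- (E div 2) \<le> b" "b' < k - E div 2" "b < b'"
    define w h where "w = E div 2" and "h = (2 * b') mod E - (2 * b) mod E"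
    show "b' - b + - 1 * ((2 * b') mod E - (2 * b) mod E) \<noteq> k"
    proof
      assume "b' - b + - 1 * ((2 * b') mod E - (2 * b) mod E) = k"
      then have g: "b' - b = k + h" by (simp add: h_def)
      have "E dvd ((2 * b') mod E - (2 * b')) - ((2 * b) mod E - (2 * b))"
        by (rule dvd_diff[OF mod_modulus_facts(3) mod_modulus_facts(3)])
      then have "E dvd h - 2 * (b' - b)" by (simp add: h_def algebra_simps)
      then have "E dvd - ((h - 2 * (b' - b)) + (2 * k + 1))" using assms by (simp only: dvd_minus_iff dvd_add)
      then have "E dvd h - 1" using g by (simp add: algebra_simps)
      moreover have hE: "\<bar>h\<bar> < E" using mod_modulus_facts[of "2 * b"] mod_modulus_facts[of "2 * b'"] unfolding h_def by linarith
      ultimately have "h = 1 \<or> h = 1 - E" using dvd_small_cases[of E h] E by simp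
      moreover have "h < 0" using b g by simp
      ultimately have h: "h = 1 - E" by simp
      then have r: "(2 * b) mod E = E - 1" using mod_modulus_facts(1,2)[of "2 * b"] mod_modulus_facts(1,2)[of "2 * b'"] unfolding h_def by linarith
      \<comment> \<open>The maximal residue means that E divides the odd number 2b + 1, but -w \<le>
        b < w keeps its absolute value below E.\<close>
      have "E dvd E - ((2 * b) mod E - 2 * b)" by (rule dvd_diff[OF dvd_refl mod_modulus_facts(3)])
      then have "E dvd 2 * b + 1" using r by (simp add: add.commute)
      moreover have "b < w" using b g h modulus_half by (simp add: w_def)
      moreover have "2 * b + 1 \<noteq> 0" by presburger
      moreover have "E = 2 * w + 1" "- w \<le> b" using modulus_half(1) b(1) by (simp_all add: w_def)
      then have "\<bar>2 * b + 1\<bar> < E" using \<open>b < w\<close> by linarith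
      ultimately show False using zdvd_not_zless[of "\<bar>2 * b + 1\<bar>" E] by simp
    qed
  qed auto
  then show ?thesis by simp
qed

end

section \<open>Necessity for multiples of k + 1\<close>

text \<open>Normalise the shift to m' in 1, ..., k. If m' \<le> k - E, the residues 0 and k - E
  collide: the first gets the block number -1, and the second k - E + (E - 1) = k - 1.\<close>

lemma mult_Suc_window:
  fixes k E \<tau> m :: int
  assumes k: "k \<ge> 2" and E: "0 < E" "E < k" "coprime E k" and \<tau>: "E dvd k * \<tau> + 1"
    and sep: "separating_shift k (E * (1 + k)) m"
  obtains w where "0 \<le> w" "w < E" "separating_shift k (E * (1 + k)) (k - w)"
proof -
  define m' where "m' = (m - 1) mod k + 1"
  have m': "1 \<le> m'" "m' \<le> k" using k pos_mod_bound[of k "m - 1"] pos_mod_sign[of k "m - 1"] unfolding m'_def by linarith+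
  have "m' = m + k * (- ((m - 1) div k))"
    by (simp add: m'_def minus_mult_div_eq_mod[symmetric])
  moreover have "k > 0" using k by simp
  ultimately have sep': "separating_shift k (E * (1 + 1 * k)) m'"
    using separating_shift_add_period[OF _ sep] by (simp only: mult_1)
  have "k - m' < E"
  proof (rule ccontr)
    assume "\<not> k - m' < E"
    then have mE: "m' \<le> k - E" by simp
    have "(0 - m') = (k - m') + (- 1) * k" by simp
    then have "(0 - m') div k = - 1 + (k - m') div k" using k by (simp only: div_mult_self1)
    moreover have "(k - m') div k = 0" using m' by simp
    moreover have "(k - E - m') div k = 0" using mE m' E by simp
    moreover obtain l where l: "k * \<tau> = E * l - 1" using \<tau> by (metis dvdE eq_diff_eq)
    have "\<tau> * (k - E) = (E - 1) + E * (l - \<tau> - 1)" using l by (simp add: algebra_simps)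
    then have "(\<tau> * (k - E)) mod E = (E - 1) mod E" by (simp only: mod_mult_self2)
    moreover have "(E - 1) mod E = E - 1" using E by (intro mod_pos_pos_trivial) auto
    ultimately have "1 * (k - E) + (\<tau> * (k - E)) mod E + (k - E - m') div k
        - (1 * 0 + (\<tau> * 0) mod E + (0 - m') div k) = k" by simp
    then have "k dvd 1 * (k - E) + (\<tau> * (k - E)) mod E + (k - E - m') div k
        - (1 * 0 + (\<tau> * 0) mod E + (0 - m') div k)" by (simp only: dvd_refl)
    moreover have "0 \<le> k - E" "k - E < k" "0 \<le> (0::int)" "0 < k" using E by auto
    ultimately have "k - E = 0"
      using iffD1[OF separating_shift_iff_residues[OF k E(1) E(3) \<tau>, of 1 m'] sep', rule_format, of "k - E" 0]
      by blast
    then show False using E by simp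
  qed
  then show ?thesis using that[of "k - m'"] sep' m' by simp
qed

text \<open>Here \<open>\<psi> (- i) = \<pi> i - i\<close>, where \<pi> is multiplication by 1/k
  modulo E, so the sign of \<psi> at negative arguments is in question. An argument below the window
  is represented in it after adding k, where \<psi> grows by k - 1 and not by k. This defect of 1
  drives a descent on the value of \<psi>, which ends at the known values
  \<open>\<psi> 0 = 0\<close> and \<open>\<psi> (k - E) = k - 1\<close>.\<close>

lemma mult_Suc_sign_pattern:
  fixes k E \<tau> w :: int
  assumes k: "k \<ge> 2" and E: "0 < E" "E < k" "coprime E k" and \<tau>: "E dvd k * \<tau> + 1"
    and w: "0 \<le> w" "w < E" and sep: "separating_shift k (E * (1 + k)) (k - w)"
  shows "1 \<le> i \<Longrightarrow> i \<le> w \<Longrightarrow> i < (- \<tau> * i) mod E"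
    and "w < i \<Longrightarrow> i < E \<Longrightarrow> (- \<tau> * i) mod E < i"
proof -
  define \<psi> where "\<psi> b = b + (\<tau> * b) mod E" for b
  define \<pi> where "\<pi> i = (- \<tau> * i) mod E" for i
  have inj: "b = b'" if "- w \<le> b" "b < k - w" "- w \<le> b'" "b' < k - w" "k dvd \<psi> b - \<psi> b'" for b b'
    using separating_shift_iff_window[OF k E \<tau> w, of 1] sep that by (simp add: \<psi>_def)
  have \<pi>: "0 \<le> \<pi> i" "\<pi> i < E" for i using E by (auto simp: \<pi>_def)
  have \<psi>\<pi>: "\<psi> (- i) = \<pi> i - i" for i by (simp add: \<psi>_def \<pi>_def)
  have bounds: "b \<le> \<psi> b" "\<psi> b < b + E" for b using E by (auto simp: \<psi>_def)
  have cop\<tau>: "coprime \<tau> E"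
  proof (rule coprimeI)
    fix d assume "d dvd \<tau>" "d dvd E"
    then have "d dvd (k * \<tau> + 1) - k * \<tau>" using \<tau> by (meson dvd_diff dvd_mult dvd_trans)
    then show "is_unit d" by simp
  qed
  obtain l where l: "k * \<tau> = E * l - 1" using \<tau> by (metis dvdE eq_diff_eq)
  have shift: "\<psi> (x + k) = \<psi> x + k - 1" if "\<not> E dvd x" for x
  proof -
    have "\<not> E dvd \<tau> * x" using that cop\<tau> by (simp add: coprime_commute coprime_dvd_mult_right_iff)
    then have "(\<tau> * x - 1 + 1) mod E = (\<tau> * x - 1) mod E + 1"
      using E by (intro mod_add_one_int) auto
    moreover have "\<tau> * (x + k) = (\<tau> * x - 1) + E * l" using l by (simp add: algebra_simps)
    then have "(\<tau> * (x + k)) mod E = (\<tau> * x - 1) mod E" by simp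
    ultimately show ?thesis by (simp add: \<psi>_def)
  qed
  have top: "\<psi> (k - E) = k - 1"
  proof -
    have "\<tau> * (k - E) = (E - 1) + E * (l - \<tau> - 1)" using l by (simp add: algebra_simps)
    then have "(\<tau> * (k - E)) mod E = (E - 1) mod E" by (simp only: mod_mult_self2)
    also have "\<dots> = E - 1" using E by (intro mod_pos_pos_trivial) auto
    finally show ?thesis by (simp add: \<psi>_def)
  qed
  have ndvd: "\<not> E dvd - i" if "1 \<le> i" "i < E" for i
    using that zdvd_not_zless[of i E] by simp
  have fixfree: "\<pi> i \<noteq> i" if i: "1 \<le> i" "i < E" for i
  proof
    assume eq: "\<pi> i = i"
    then have 0: "\<psi> (- i) = 0" using \<psi>\<pi> by simp
    show False
    proof (cases "i \<le> w")
      case True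
      then show False using inj[of "- i" 0] 0 i w E by (simp add: \<psi>_def)
    next
      case False
      have "\<psi> (- i + k) = k - 1" using shift[OF ndvd[OF i]] 0 by simp
      then have "- i + k = k - E" using inj[of "- i + k" "k - E"] top False i w E by simp
      then show False using i by simp
    qed
  qed
  \<comment> \<open>A common divisor d would make E/|d| a fixed point of \<pi>.\<close>
  have cop1: "coprime (1 + \<tau>) E"
  proof (rule coprimeI)
    fix d assume d: "d dvd 1 + \<tau>" "d dvd E"
    show "is_unit d"
    proof (rule ccontr)
      assume nu: "\<not> is_unit d"
      obtain e where e: "E = \<bar>d\<bar> * e" using d by (metis abs_dvd_iff dvdE)
      have "d \<noteq> 0" "\<bar>d\<bar> \<noteq> 1" using d nu E by auto
      then have "\<bar>d\<bar> > 1" by linarith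
      moreover have "0 < \<bar>d\<bar> * e" using e E by simp
      ultimately have "e > 0" by (simp add: zero_less_mult_iff)
      have "1 * e < \<bar>d\<bar> * e" using \<open>\<bar>d\<bar> > 1\<close> \<open>e > 0\<close> by (rule mult_strict_right_mono)
      then have ei: "1 \<le> e" "e < E" using e \<open>e > 0\<close> by auto
      have "\<bar>d\<bar> * e dvd (1 + \<tau>) * e" using d by (intro mult_dvd_mono) auto
      then have "E dvd (1 + \<tau>) * e" using e by simp
      then have "E dvd e - (- \<tau> * e)" by (simp add: algebra_simps)
      then have "e mod E = \<pi> e" unfolding \<pi>_def by (simp only: mod_eq_dvd_iff)
      then have "\<pi> e = e" using ei by simp
      then show False using fixfree ei by blast
    qed
  qed
  \<comment> \<open>Subtracting a multiple of E from b leaves the residue of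
    \<open>\<tau> * b\<close> alone, so solving modulo E suffices to reach every integer.\<close>
  have surj: "\<exists>b. \<psi> b = v" for v
  proof -
    obtain u where "[(1 + \<tau>) * u = 1] (mod E)" using cop1 cong_solve_coprime_int by blast
    then have "E dvd (1 + \<tau>) * u - 1" by (simp add: cong_iff_dvd_diff)
    then have "E dvd ((1 + \<tau>) * u - 1) * v" by simp
    then have e1: "E dvd (1 + \<tau>) * (u * v) - v" by (simp add: algebra_simps)
    define b where "b = u * v"
    have "E dvd (\<tau> * b) mod E - \<tau> * b" by (simp add: mod_eq_dvd_iff[symmetric])
    then have "E dvd ((\<tau> * b) mod E - \<tau> * b) + ((1 + \<tau>) * (u * v) - v)" using e1 by (rule dvd_add)
    then have "E dvd \<psi> b - v" by (simp add: \<psi>_def b_def algebra_simps)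
    then obtain j where j: "\<psi> b - v = E * j" by blast
    have "\<tau> * (b - E * j) = \<tau> * b + E * (- (\<tau> * j))" by (simp add: algebra_simps)
    then have "(\<tau> * (b - E * j)) mod E = (\<tau> * b) mod E" by (simp only: mod_mult_self2)
    then have "\<psi> (b - E * j) = v" using j by (simp add: \<psi>_def)
    then show ?thesis by blast
  qed
  have above: "\<pi> i < i" if "w < i" "i < E" for i
  proof (rule ccontr)
    assume "\<not> \<pi> i < i"
    then have "i < \<pi> i" using fixfree[of i] that w by linarith
    \<comment> \<open>Let b have the value one smaller than -i. If b is in the window, it collides
      with k - i; otherwise -b is a counterexample with a smaller value.\<close>
    have "False" if "\<psi> (- i) = int (Suc n)" "w < i" "i < E" for n i
      using that
    proof (induction n arbitrary: i)
      case (0 i)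
      obtain b where b: "\<psi> b = 0" using surj by blast
      have x: "\<psi> (- i + k) = k" using shift[OF ndvd[of i]] 0 w by simp
      have "\<psi> 0 = 0" by (simp add: \<psi>_def)
      then have "- i + k = 0" using inj[of "- i + k" 0] x 0 w E by simp
      then show False using 0 E by simp
    next
      case (Suc n i)
      obtain b where b: "\<psi> b = int (Suc n)" using surj by blast
      have x: "\<psi> (- i + k) = int (Suc n) + k" using shift[OF ndvd[of i]] Suc.prems w by simp
      have bE: "b \<le> int (Suc n)" "int (Suc n) < b + E" using bounds[of b] b by auto
      have iE: "int (Suc (Suc n)) < - i + E" using bounds[of "- i"] Suc.prems by simp
      show False
      proof (cases "- w \<le> b")
        case True
        have "k dvd \<psi> (- i + k) - \<psi> b" using x b by simp
        then have "- i + k = b" using inj[of "- i + k" b] True bE iE Suc.prems w E by simp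
        then show False using bE iE Suc.prems E by simp
      next
        case False
        then show False using Suc.IH[of "- b"] b bE by simp
      qed
    qed
    moreover have "\<psi> (- i) = int (Suc (nat (\<pi> i - i - 1)))" using \<open>i < \<pi> i\<close> \<psi>\<pi> by simp
    ultimately show False using that by blast
  qed
  have below: "i < \<pi> i" if "1 \<le> i" "i \<le> w" for i
  proof (rule ccontr)
    assume "\<not> i < \<pi> i"
    then have "\<pi> i < i" using fixfree[of i] that w by linarith
    \<comment> \<open>Let x have the value one larger than -i. If x \<ge> -w, then -x is a
      counterexample nearer to 0; otherwise x + k collides with -i.\<close>
    have "False" if "\<psi> (- i) = - int (Suc n)" "1 \<le> i" "i \<le> w" for n i
      using that
    proof (induction n arbitrary: i)
      case (0 i)
      have "k dvd \<psi> (k - E) - \<psi> (- i)" using top 0 by simp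
      then have "k - E = - i" using inj[of "k - E" "- i"] 0 w E by simp
      then show False using 0 E by simp
    next
      case (Suc n i)
      obtain x where x: "\<psi> x = - int (Suc n)" using surj by blast
      have xE: "x \<le> - int (Suc n)" "- int (Suc n) < x + E" using bounds[of x] x by auto
      have iE: "- i \<le> - int (Suc (Suc n))" using bounds[of "- i"] Suc.prems by simp
      show False
      proof (cases "- w \<le> x")
        case True
        then show False using Suc.IH[of "- x"] x xE by simp
      next
        case False
        have "\<not> E dvd x"
        proof
          assume "E dvd x"
          then have "\<psi> x = x" by (simp add: \<psi>_def)
          then have "x = - int (Suc n)" using x by simp
          then show False using False iE Suc.prems by simp
        qed
        then have xk: "\<psi> (x + k) = k - int (Suc (Suc n))" using shift x by simp
        then have "k dvd \<psi> (x + k) - \<psi> (- i)" using Suc.prems by simp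
        then have "x + k = - i" using inj[of "x + k" "- i"] xE iE False Suc.prems w E by simp
        then have "\<psi> (x + k) = \<psi> (- i)" by simp
        then show False using xk Suc.prems k by simp
      qed
    qed
    moreover have "\<psi> (- i) = - int (Suc (nat (i - \<pi> i - 1)))" using \<open>\<pi> i < i\<close> \<psi>\<pi> by simp
    ultimately show False using that by blast
  qed
  show "1 \<le> i \<Longrightarrow> i \<le> w \<Longrightarrow> i < (- \<tau> * i) mod E" using below by (simp add: \<pi>_def)
  show "w < i \<Longrightarrow> i < E \<Longrightarrow> (- \<tau> * i) mod E < i" using above by (simp add: \<pi>_def)
qed

lemma first_multiple_bound:
  fixes j s w :: int
  assumes "(j - 1) * s \<le> w" "2 * w + 1 - j * s < j"
  shows "(j - 2) * (s - 1) \<le> 0"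
  using assms by (simp add: algebra_simps)

text \<open>Multiplication by 1/k modulo E respects i \<mapsto> -i, so the sign pattern must be
  symmetric and its threshold w is the middle. What is left is to see which multipliers lie above
  the diagonal exactly on the lower half.\<close>

theorem genus_minimizing_mult_Suc_imp:
  fixes k E :: int
  assumes k: "k \<ge> 2" and E: "0 < E" "E < k" "coprime E k"
    and gm: "genus_minimizing (k\<^sup>2) (E * (1 + k)) k"
  shows "odd E \<and> (E dvd k + 1 \<or> E dvd 2 * k - 1)"
proof -
  have "coprime (1 + k) k" by (rule coprimeI) (metis dvd_add_left_iff)
  then have cop: "coprime (E * (1 + k)) (k\<^sup>2)" using E by simp
  obtain m where m: "separating_shift k (E * (1 + k)) m"
    using genus_minimizing_imp_separating_shift[OF k cop gm] by blast
  obtain u where "[k * u = 1] (mod E)" using E(3) cong_solve_coprime_int[of k E] by (auto simp: coprime_commute)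
  then have u: "E dvd k * u - 1" by (simp add: cong_iff_dvd_diff)
  then have "E dvd - (k * u - 1)" by (simp only: dvd_minus_iff)
  then have \<tau>: "E dvd k * (- u) + 1" by (simp add: algebra_simps)
  obtain w where w: "0 \<le> w" "w < E" "separating_shift k (E * (1 + k)) (k - w)"
    using mult_Suc_window[OF k E \<tau> m] by blast
  define \<pi> where "\<pi> i = (u * i) mod E" for i
  have below: "i < \<pi> i" if "1 \<le> i" "i \<le> w" for i
    using mult_Suc_sign_pattern(1)[OF k E \<tau> w that] by (simp add: \<pi>_def)
  have above: "\<pi> i < i" if "w < i" "i < E" for i
    using mult_Suc_sign_pattern(2)[OF k E \<tau> w that] by (simp add: \<pi>_def)
  have refl: "\<pi> (E - i) = E - \<pi> i" if "\<pi> i \<noteq> 0" for i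
  proof -
    have "E dvd \<pi> i - u * i" by (simp add: \<pi>_def mod_eq_dvd_iff[symmetric])
    then have "E dvd (\<pi> i - u * i) + E * (u - 1)" by simp
    then have "E dvd u * (E - i) - (E - \<pi> i)" by (simp add: algebra_simps)
    then have "\<pi> (E - i) = (E - \<pi> i) mod E"
      unfolding \<pi>_def[of "E - i"] by (simp only: mod_eq_dvd_iff)
    moreover have "0 \<le> \<pi> i" "\<pi> i < E" using E by (auto simp: \<pi>_def)
    moreover from this that have "(E - \<pi> i) mod E = E - \<pi> i" by (intro mod_pos_pos_trivial) auto
    ultimately show ?thesis by (simp only:)
  qed
  \<comment> \<open>Otherwise some i and E - i lie on the same side of the threshold, although their
    images add up to E.\<close>
  have Ew: "E = 2 * w + 1"
  proof (rule linorder_cases[of E "2 * w + 1"])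
    assume "E < 2 * w + 1"
    then have "w < \<pi> w" "E - w < \<pi> (E - w)" using below[of w] below[of "E - w"] w by auto
    then show ?thesis using refl[of w] w by simp
  next
    assume "E > 2 * w + 1"
    then have lt: "\<pi> (w + 1) < w + 1" "\<pi> (E - (w + 1)) < E - (w + 1)"
      using above[of "w + 1"] above[of "E - (w + 1)"] w by auto
    have "\<pi> (w + 1) \<noteq> 0"
    proof
      assume "\<pi> (w + 1) = 0"
      then have "E dvd u * (w + 1)" by (simp add: \<pi>_def mod_eq_0_iff_dvd)
      then have "E dvd k * (u * (w + 1)) - (k * u - 1) * (w + 1)"
        by (rule dvd_diff[OF dvd_mult dvd_mult2[OF u]])
      moreover have "k * (u * (w + 1)) - (k * u - 1) * (w + 1) = w + 1" by (simp add: algebra_simps)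
      ultimately have "E dvd w + 1" by simp
      then show False using \<open>E > 2 * w + 1\<close> w zdvd_not_zless[of "w + 1" E] by simp
    qed
    then show ?thesis using refl[of "w + 1"] lt by simp
  qed simp
  then have "odd E" by simp
  moreover have "E dvd k + 1 \<or> E dvd 2 * k - 1"
  proof (cases "w = 0")
    case True
    then have "E = 1" using Ew by simp
    then show ?thesis by simp
  next
    case False
    define s where "s = (- k) mod E"
    have sk: "E dvd s + k" 
    proof -
      have "(- k) mod E = s mod E" by (simp add: s_def)
      then have "E dvd - k - s" by (simp only: mod_eq_dvd_iff)
      then have "E dvd - (- k - s)" by (simp only: dvd_minus_iff)
      then show ?thesis by (simp add: add.commute)
    qed
    have "\<not> E dvd k"
    proof
      assume "E dvd k"
      then have "is_unit E" by (rule coprime_common_divisor[OF E(3) dvd_refl])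
      then have "E = 1" using E(1) by simp
      then show False using Ew w(1) False by linarith
    qed
    have s: "0 < s" "s < E"
    proof -
      have "s \<noteq> 0" using \<open>\<not> E dvd k\<close> by (simp add: s_def mod_eq_0_iff_dvd)
      moreover have "0 \<le> s" "s < E" using E by (auto simp: s_def)
      ultimately show "0 < s" "s < E" by auto
    qed
    text \<open>The multiples of \<open>s\<close> have the known images \<open>E - j\<close>; the first of them beyond \<open>w\<close>
      decides the matter.\<close>
    have \<pi>s: "\<pi> (E - j * s) = j" if "0 \<le> j" "j < E" for j
    proof -
      have "E dvd (u * (s + k) - (k * u - 1)) * j" 
        by (rule dvd_mult2[OF dvd_diff[OF dvd_mult[OF sk] u]])
      then have "E dvd E * u - (u * (s + k) - (k * u - 1)) * j" by (rule dvd_diff[OF dvd_triv_left])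
      moreover have "E * u - (u * (s + k) - (k * u - 1)) * j = u * (E - j * s) - j" by (simp add: algebra_simps)
      ultimately have "E dvd u * (E - j * s) - j" by simp
      then have "\<pi> (E - j * s) = j mod E" unfolding \<pi>_def by (simp only: mod_eq_dvd_iff)
      also have "\<dots> = j" using that by (intro mod_pos_pos_trivial)
      finally show ?thesis .
    qed
    define t r where "t = w div s" and "r = w mod s"
    have wt: "w = s * t + r" "0 \<le> r" "r < s" using s by (auto simp: t_def r_def)
    define j where "j = t + 1"
    have js: "(j - 1) * s = s * t" "j * s = s * t + s" by (simp_all add: j_def algebra_simps)
    have j: "(j - 1) * s \<le> w" "w < j * s" unfolding js using wt by auto
    have j1: "1 \<le> j" using w s by (simp add: j_def t_def pos_imp_zdiv_nonneg_iff)
    have jj: "j * s = (j - 1) * s + s" by (simp add: algebra_simps)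
    show ?thesis
    proof (cases "s \<le> w")
      case False
      then have "E - s < \<pi> (E - s)" using below[of "E - s"] Ew s by simp
      moreover have "\<pi> (E - s) = 1" using \<pi>s[of 1] E w \<open>w \<noteq> 0\<close> Ew by simp
      ultimately show ?thesis using s by simp
    next
      case True
      have "j * s < E" using jj j True Ew by linarith
      moreover have "j * 1 \<le> j * s" using j1 s by (intro mult_left_mono) auto
      ultimately have "\<pi> (E - j * s) = j" using \<pi>s[of j] j1 by linarith
      moreover have "1 \<le> E - j * s" "E - j * s \<le> w" using \<open>j * s < E\<close> j Ew by linarith+
      ultimately have "E - j * s < j" using below[of "E - j * s"] by simp
      then have le: "(j - 2) * (s - 1) \<le> 0"
        using first_multiple_bound[of j s w] j(1) Ew by simp
      have "j \<le> 2 \<or> s \<le> 1"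
      proof (rule ccontr)
        assume "\<not> (j \<le> 2 \<or> s \<le> 1)"
        then have "0 < (j - 2) * (s - 1)" by (intro mult_pos_pos) auto
        with le show False by simp
      qed
      \<comment> \<open>Since s = -k modulo E, s = 1 means that E divides k + 1. For j = 2 the
        inequality 0 < E - 2s < 2 gives 2s = E - 1, hence E divides 2k - 1.\<close>
      then consider "s = 1" | "j = 1" | "j = 2" using s j1 by linarith
      then show ?thesis
      proof cases
        case 1
        then show ?thesis using sk by (simp add: add.commute)
      next
        case 2
        then show ?thesis using j True by simp
      next
        case 3
        then have "2 * s = E - 1" using \<open>E - j * s < j\<close> \<open>j * s < E\<close> Ew by simp
        then have "2 * k - 1 = 2 * (s + k) - E" by simp
        moreover have "E dvd 2 * (s + k) - E" by (rule dvd_diff[OF dvd_mult[OF sk] dvd_refl])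
        ultimately have "E dvd 2 * k - 1" by (simp only:)
        then show ?thesis ..
      qed
    qed
  qed
  ultimately show ?thesis by blast
qed

section \<open>One short vector\<close>

text \<open>Adding the two vector equations eliminates \<alpha> and \<beta>:
  \<open>r * (X + Y - g) = t * a + (g - t) * b\<close>. Their positivity confines t to 1, ..., g -
  1, so the right side is at most \<open>(g - 1) * a + b\<close>. On the left
  \<open>X + Y - g \<ge> L\<close>. The comparison forces r = 1 and then
  \<open>(g - 2) * (b - 1) \<le> 0\<close>.\<close>

lemma chain_arith_aux:
  fixes g a b r X Y t \<alpha> \<beta> :: int
  assumes pos: "g \<ge> 1" "b \<ge> 1" "a \<ge> b" "r \<ge> 1" "\<alpha> \<ge> 1" "\<beta> \<ge> 1"
    and X: "X \<ge> (g - 1) * a + 1" and Y: "Y \<ge> (g - 1) * b + 1"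
    and \<alpha>: "\<alpha> = r * X - t * a" and \<beta>: "g * b + \<beta> = r * Y + t * b" and sum: "\<alpha> + \<beta> = g * r"
  shows "r = 1 \<and> (g = 2 \<and> \<alpha> = 1 \<and> \<beta> = 1 \<or> b = 1 \<and> \<alpha> = 1 \<and> \<beta> = g - 1 \<or> a = 1 \<and> b = 1)"
proof -
  have eq: "r * (X + Y - g) = t * a + (g - t) * b"
    using \<alpha> \<beta> sum by (simp add: algebra_simps)
  have "(g - 1) * 1 \<le> (g - 1) * a" "(g - 1) * 1 \<le> (g - 1) * b" using pos by (intro mult_left_mono; simp)+
  then have XY: "X \<ge> g" "Y \<ge> g" using X Y by simp_all
  have tg: "t < g"
  proof (rule ccontr)
    assume "\<not> t < g"
    then have "0 \<le> (t - g) * b" "0 \<le> r * (Y - g)" using pos XY by auto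
    moreover have "r * (Y - g) = - \<alpha> - (t - g) * b" using eq \<alpha> by (simp add: algebra_simps)
    ultimately show False using pos by linarith
  qed
  have t0: "t \<ge> 1"
  proof (rule ccontr)
    assume "\<not> t \<ge> 1"
    then have "t * a \<le> 0" "0 \<le> r * (X - g)" using pos XY by (auto simp: mult_le_0_iff)
    moreover have "r * (X - g) = t * a - \<beta>" using eq \<beta> by (simp add: algebra_simps)
    ultimately show False using pos by linarith
  qed
  have g2: "g \<ge> 2" using tg t0 by simp
  have "0 \<le> (g - 1 - t) * (a - b)" using tg pos by simp
  then have up: "t * a + (g - t) * b \<le> (g - 1) * a + b" by (simp add: algebra_simps)
  define L where "L = (g - 1) * a + (g - 1) * b + 2 - g"
  have L: "L \<le> X + Y - g" using X Y by (simp add: L_def)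
  have r1: "r = 1"
  proof (rule ccontr)
    assume "r \<noteq> 1"
    have "2 * (X + Y - g) \<le> r * (X + Y - g)" using \<open>r \<noteq> 1\<close> pos XY by (intro mult_right_mono) auto
    moreover have "2 * L \<le> 2 * (X + Y - g)" using L by simp
    ultimately have "2 * L \<le> r * (X + Y - g)" by (rule order_trans[rotated])
    also have "\<dots> \<le> (g - 1) * a + b" unfolding eq by (rule up)
    finally have "2 * L \<le> (g - 1) * a + b" .
    then have "(g - 1) * a + (2 * g - 3) * b + 4 - 2 * g \<le> 0" by (simp add: L_def algebra_simps)
    moreover have "(g - 1) * 1 \<le> (g - 1) * a" "(2 * g - 3) * 1 \<le> (2 * g - 3) * b"
      using pos g2 by (intro mult_left_mono; simp)+
    then have "(g - 1) * 1 + (2 * g - 3) * 1 \<le> (g - 1) * a + (2 * g - 3) * b" by (rule add_mono)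
    ultimately show False using g2 by simp
  qed
  have le: "L \<le> t * a + (g - t) * b" using L eq r1 by simp
  then have "L \<le> (g - 1) * a + b" using up by linarith
  then have "(g - 2) * (b - 1) \<le> 0" by (simp add: L_def algebra_simps)
  then have "g = 2 \<or> b = 1" using g2 pos by (auto simp: mult_le_0_iff)
  then show ?thesis
  proof
    assume "g = 2"
    then show ?thesis using sum pos r1 by auto
  next
    assume b: "b = 1"
    have "(g - 1 - t) * (a - 1) \<le> 0" using le b by (simp add: L_def algebra_simps)
    then have "t = g - 1 \<or> a = 1" using tg pos b by (auto simp: mult_le_0_iff)
    then show ?thesis
    proof
      assume t: "t = g - 1"
      have "X + Y - g = (g - 1) * a + 1" using eq r1 t b by simp
      then have "X = (g - 1) * a + 1" using X Y b by simp
      then have "\<alpha> = 1" using \<alpha> r1 t by simp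
      then show ?thesis using sum r1 b by simp
    qed (use r1 b in simp)
  qed
qed

text \<open>The hypotheses are symmetric under exchanging (a, X, \<alpha>, t) with (b, Y, \<beta>, g
  - t), so one may assume a \<ge> b.\<close>

lemma chain_arith:
  fixes g a b r X Y t \<alpha> \<beta> :: int
  assumes pos: "g \<ge> 1" "a \<ge> 1" "b \<ge> 1" "r \<ge> 1" "\<alpha> \<ge> 1" "\<beta> \<ge> 1"
    and X: "X \<ge> (g - 1) * a + 1" and Y: "Y \<ge> (g - 1) * b + 1"
    and \<alpha>: "\<alpha> = r * X - t * a" and \<beta>: "g * b + \<beta> = r * Y + t * b" and sum: "\<alpha> + \<beta> = g * r"
  shows "r = 1 \<and> (g = 2 \<and> \<alpha> = 1 \<and> \<beta> = 1 \<or> b = 1 \<and> \<alpha> = 1 \<and> \<beta> = g - 1 \<or>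
    a = 1 \<and> \<beta> = 1 \<and> \<alpha> = g - 1 \<or> a = 1 \<and> b = 1)"
proof (cases "a \<ge> b")
  case True
  then show ?thesis using chain_arith_aux[OF pos(1,3) True pos(4-6) X Y \<alpha> \<beta> sum] by blast
next
  case False
  have "\<beta> = r * Y - (g - t) * b" "g * a + \<alpha> = r * X + (g - t) * a"
    using \<alpha> \<beta> by (simp_all add: algebra_simps)
  moreover have "b \<ge> a" "\<beta> + \<alpha> = g * r" using False sum by auto
  ultimately show ?thesis
    using chain_arith_aux[OF pos(1,2) _ pos(4,6,5) Y X] by blast
qed

text \<open>Primitivity is meant in the lattice: g is the gcd of n and the second lattice
  coordinate, which need not be the gcd of n and n'.\<close>

lemma lattice_gcd_decomposition:
  fixes k q n n' :: int
  assumes "n \<ge> 1" "n' \<ge> 1" "k dvd n' - q * n"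
  obtains g a b e where "g \<ge> 1" "a \<ge> 1" "b \<ge> 1" "n = g * a" "n' = g * b" "b = a * q - e * k" "coprime a e"
proof -
  obtain f where f: "n' - q * n = k * f" using assms(3) by blast
  define g where "g = gcd n (- f)"
  have g: "g \<ge> 1" using assms(1) by (simp add: g_def int_one_le_iff_zero_less)
  obtain a e where ae: "n = g * a" "- f = g * e" by (metis g_def gcd_dvd1 gcd_dvd2 dvdE)
  have "coprime a e"
  proof -
    have "coprime (n div g) (- f div g)" unfolding g_def using assms(1) by (intro div_gcd_coprime) simp
    moreover have "n div g = a" "- f div g = e" using ae g by auto
    ultimately show ?thesis by simp
  qed
  define b where "b = a * q - e * k"
  have "n' = q * (g * a) + k * f" using f ae by simp
  also have "k * f = - (k * (g * e))" using ae(2) by (metis minus_minus mult_minus_right)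
  finally have "n' = g * b" by (simp add: b_def algebra_simps)
  moreover have "a \<ge> 1" "b \<ge> 1" using assms ae(1) \<open>n' = g * b\<close> g
    by (auto simp: int_one_le_iff_zero_less zero_less_mult_iff)
  ultimately show ?thesis using that g ae \<open>coprime a e\<close> b_def by blast
qed

text \<open>The short vector is \<open>(k - n, k - n')\<close>, and
  \<open>(- k - \<alpha>, n' + \<beta>)\<close> completes it to a basis; \<open>det\<close> is the
  determinant k^2. Modulo k they become the coarse vectors (n, n') and (-\<alpha>, n' + \<beta>), up
  to sign. The strip lemma provides a further coarse vector (-X, Y) that is long in both directions,
  and writing (-\<alpha>, n' + \<beta>) in terms of it and the primitive (a, b) leads to
  \<open>chain_arith\<close>.\<close>

lemma single_vector_classification:
  fixes k q n n' \<alpha> \<beta> m :: int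
  assumes k: "k \<ge> 2" and cop: "coprime q k" and n: "n \<ge> 1" "n' \<ge> 1" "n + n' \<le> k"
    and ab0: "\<alpha> \<ge> 0" "\<beta> \<ge> 0"
    and V: "k\<^sup>2 dvd (k - n') - q * (k - n)" and W: "k\<^sup>2 dvd (n' + \<beta>) + q * (k + \<alpha>)"
    and det: "k * (\<alpha> + \<beta>) = n * n' + n * \<beta> + n' * \<alpha>"
    and box: "empty_box k q 0 n m n'" and q1: "\<not> k dvd q - 1" and q2: "\<not> k dvd q + 1"
  shows "(\<exists>a b. a \<ge> 1 \<and> b \<ge> 1 \<and> 2 * k + 1 = (2 * a + 1) * (2 * b + 1) \<and> k\<^sup>2 dvd q - (2 * b + 1) * (k - 1)) \<or>
    (\<exists>g a. g \<ge> 1 \<and> a \<ge> 1 \<and> k - 1 = (2 * g - 1) * a \<and> k\<^sup>2 dvd q - (2 * g - 1) * (k - 1)) \<or>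
    (\<exists>g b. g \<ge> 1 \<and> b \<ge> 1 \<and> k - 1 = (2 * g - 1) * b \<and> k\<^sup>2 dvd q - b * (2 * k + 1))"
proof -
  have dk: "k dvd x" if "k\<^sup>2 dvd x" for x using that by (auto simp: power2_eq_square dest: dvd_mult_left)
  have VW: "k\<^sup>2 dvd (k + \<beta>) + q * (n + \<alpha>)"
    using dvd_add[OF V W] by (simp add: algebra_simps)
  have no: "\<not> k\<^sup>2 dvd k + q * k"
  proof
    assume "k\<^sup>2 dvd k + q * k"
    moreover have "k + q * k = k * (q + 1)" by (simp add: algebra_simps)
    ultimately have "k * k dvd k * (q + 1)" by (simp add: power2_eq_square)
    then show False using q2 k by simp
  qed
  have one: "e = 1" if "x = e * y" "1 \<le> x" "x \<le> y" for e x y :: int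
  proof -
    have "y \<ge> 1" using that by simp
    have "e \<ge> 1"
    proof (rule ccontr)
      assume "\<not> e \<ge> 1"
      then have "e * y \<le> 0" using \<open>y \<ge> 1\<close> by (simp add: mult_le_0_iff)
      then show False using that by simp
    qed
    moreover have "e < 2"
    proof (rule ccontr)
      assume "\<not> e < 2"
      then have "2 * y \<le> e * y" using \<open>y \<ge> 1\<close> by (intro mult_right_mono) auto
      then show False using that \<open>y \<ge> 1\<close> by linarith
    qed
    ultimately show ?thesis by simp
  qed
  \<comment> \<open>If \<alpha> or \<beta> vanishes, the determinant turns into a divisibility that
    puts (-k, k) into the fine lattice, so q = -1 modulo k.\<close>
  have \<alpha>: "\<alpha> \<ge> 1"
  proof (rule ccontr)
    assume "\<not> \<alpha> \<ge> 1"
    then have 0: "\<alpha> = 0" using ab0 by simp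
    have "k dvd (n' + \<beta> + q * k) - q * k" 
      by (rule dvd_diff) (use dk[OF W] 0 in auto)
    then obtain e where e: "n' + \<beta> = k * e" by auto
    have "k * \<beta> = n * (n' + \<beta>)" using det 0 by (simp add: algebra_simps)
    then have "k * \<beta> = k * (n * e)" by (simp only: e mult.left_commute)
    then have "\<beta> = n * e" using k by simp
    then have "n' = e * (k - n)" using e by (simp add: algebra_simps)
    moreover have "1 \<le> n'" "n' \<le> k - n" using n by auto
    ultimately have "e = 1" by (rule one)
    then show False using no W 0 e by simp
  qed
  have \<beta>: "\<beta> \<ge> 1"
  proof (rule ccontr)
    assume "\<not> \<beta> \<ge> 1"
    then have 0: "\<beta> = 0" using ab0 by simp
    have "k dvd (k + q * (n + \<alpha>)) - k"
      by (rule dvd_diff) (use dk[OF VW] 0 in auto)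
    then have "k dvd q * (n + \<alpha>)" by simp
    then have "k dvd n + \<alpha>" using cop by (simp add: coprime_commute coprime_dvd_mult_right_iff)
    then obtain e where e: "n + \<alpha> = k * e" by auto
    have "k * \<alpha> = n' * (n + \<alpha>)" using det 0 by (simp add: algebra_simps)
    then have "k * \<alpha> = k * (n' * e)" by (simp only: e mult.left_commute)
    then have "\<alpha> = n' * e" using k by simp
    then have "n = e * (k - n')" using e by (simp add: algebra_simps)
    moreover have "1 \<le> n" "n \<le> k - n'" using n by auto
    ultimately have "e = 1" by (rule one)
    then have "n + \<alpha> = k" using e by simp
    moreover have "k\<^sup>2 dvd k + q * (n + \<alpha>)" using VW 0 by simp
    ultimately show False using no by simp
  qed
  have "k dvd k * (1 - q) - ((k - n') - q * (k - n))" 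
    by (rule dvd_diff[OF dvd_triv_left dk[OF V]])
  then have u: "k dvd n' - q * n" by (simp add: algebra_simps)
  have "k dvd ((n' + \<beta>) + q * (k + \<alpha>)) - k * q"
    by (rule dvd_diff[OF dk[OF W] dvd_triv_left])
  then have m2: "k dvd (n' + \<beta>) + q * \<alpha>" by (simp add: algebra_simps)
  obtain g a b e where g: "g \<ge> 1" "a \<ge> 1" "b \<ge> 1" and na: "n = g * a" "n' = g * b"
    and b: "b = a * q - e * k" and cope: "coprime a e"
    using lattice_gcd_decomposition[OF n(1,2) u] by blast
  have ge: "a \<le> n" "b \<le> n'" using g na by (simp_all add: mult_le_cancel_right1)
  have k0: "k > 0" using k by simp
  obtain x1 y1 x2 y2 where z: "k dvd y1 - q * x1" "k dvd y2 - q * x2" "0 \<le> x1" "x1 < 0 + a"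
    "m + n' \<le> y1" "m \<le> y2" "y2 < m + b" "0 + n \<le> x2" "a * (y1 - y2) + b * (x2 - x1) = k"
    by (rule empty_box_strip[OF k0 b cope g(2,3) ge box])
  define X Y where "X = x2 - x1" and "Y = y1 - y2"
  have kXY: "a * Y + b * X = k" using z by (simp add: X_def Y_def)
  have X: "X \<ge> (g - 1) * a + 1" and Y: "Y \<ge> (g - 1) * b + 1"
    using z na by (simp_all add: X_def Y_def algebra_simps)
  have "k dvd (y1 - q * x1) - (y2 - q * x2)" by (rule dvd_diff[OF z(1,2)])
  then have zXY: "k dvd Y + q * X" by (simp add: X_def Y_def algebra_simps)
  have "k dvd a * ((n' + \<beta>) + q * \<alpha>) - k * (e * \<alpha>)"
    by (rule dvd_diff[OF dvd_mult[OF m2] dvd_triv_left])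
  moreover have "a * ((n' + \<beta>) + q * \<alpha>) - k * (e * \<alpha>) = a * (g * b + \<beta>) + b * \<alpha>"
    by (simp add: na b algebra_simps)
  ultimately obtain r where r: "a * (g * b + \<beta>) + b * \<alpha> = k * r" by auto
  have "0 < a * (g * b + \<beta>) + b * \<alpha>" using g \<alpha> \<beta> by (intro add_pos_pos mult_pos_pos) auto
  then have "0 < k * r" using r by simp
  then have r1: "r \<ge> 1" using k by (simp add: zero_less_mult_iff)
  have "k * (\<alpha> + \<beta>) = g * (a * (g * b + \<beta>) + b * \<alpha>)" using det by (simp add: na algebra_simps)
  then have "k * (\<alpha> + \<beta>) = k * (g * r)" using r by simp
  then have sum: "\<alpha> + \<beta> = g * r" using k by simp
  have "k dvd ((n' + \<beta>) + q * \<alpha>) - r * (Y + q * X)"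
    by (rule dvd_diff[OF m2 dvd_mult[OF zXY]])
  then have "k dvd (g * b + \<beta> - r * Y) - q * (r * X - \<alpha>)" by (simp add: na algebra_simps)
  moreover have "k * r = r * (a * Y) + r * (b * X)" unfolding kXY[symmetric] by (simp add: algebra_simps)
  then have "a * (g * b + \<beta> - r * Y) = b * (r * X - \<alpha>)" using r by (simp add: algebra_simps)
  moreover have "k \<noteq> 0" "a \<noteq> 0" using k g by auto
  \<comment> \<open>\<open>(- \<alpha>, n' + \<beta>) = r * (- X, Y) + t * (a, b)\<close>: the
    difference is parallel to the primitive vector (a, b).\<close>
  ultimately obtain t where t: "r * X - \<alpha> = t * a" "g * b + \<beta> - r * Y = t * b"
    using lattice_primitive_multiple[OF _ _ b cope, of "g * b + \<beta> - r * Y" "r * X - \<alpha>"] by blast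
  have fin: "r = 1 \<and> (g = 2 \<and> \<alpha> = 1 \<and> \<beta> = 1 \<or> b = 1 \<and> \<alpha> = 1 \<and> \<beta> = g - 1 \<or>
    a = 1 \<and> \<beta> = 1 \<and> \<alpha> = g - 1 \<or> a = 1 \<and> b = 1)"
    using t by (intro chain_arith[OF g r1 \<alpha> \<beta> X Y _ _ sum, of t]) auto
  then have kk: "k = a * (g * b + \<beta>) + b * \<alpha>" using r by simp
  \<comment> \<open>Division by k + 1 is multiplication by 1 - k, since (k - 1)(k + 1) = -1 modulo
    k^2.\<close>
  have solve: "k\<^sup>2 dvd q - c * (k - 1)" if "k\<^sup>2 dvd c + q * (k + 1)" for c
  proof -
    have "k\<^sup>2 dvd k\<^sup>2 * q - (k - 1) * (c + q * (k + 1))"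
      by (rule dvd_diff[OF dvd_triv_left dvd_mult[OF that]])
    then show ?thesis by (simp add: power2_eq_square algebra_simps)
  qed
  from fin consider (1) "g = 2" "\<alpha> = 1" "\<beta> = 1" | (2) "b = 1" "\<alpha> = 1" "\<beta> = g - 1"
    | (3) "a = 1" "\<beta> = 1" "\<alpha> = g - 1" | (4) "a = 1" "b = 1" by blast
  then show ?thesis
  proof cases
    case 1
    have "2 * k + 1 = (2 * a + 1) * (2 * b + 1)" using kk 1 by (simp add: algebra_simps)
    moreover have "k\<^sup>2 dvd (2 * b + 1) + q * (k + 1)" using W 1 na by simp
    ultimately show ?thesis using solve g by blast
  next
    case 2
    have "k - 1 = (2 * g - 1) * a" using kk 2 by (simp add: algebra_simps)
    moreover have "k\<^sup>2 dvd (2 * g - 1) + q * (k + 1)" using W 2 na by simp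
    ultimately show ?thesis using solve g by blast
  next
    case 3
    have kb: "k - 1 = (2 * g - 1) * b" using kk 3 by (simp add: algebra_simps)
    have "n + \<alpha> = 2 * g - 1" using na 3 by simp
    then have "k\<^sup>2 dvd (k + 1) + q * (2 * g - 1)" using VW 3 by simp
    then have "k\<^sup>2 dvd ((k + 1) + q * (2 * g - 1)) - k\<^sup>2 * 2"
      by (rule dvd_diff[OF _ dvd_triv_left])
    moreover have "((k + 1) + q * (2 * g - 1)) - k\<^sup>2 * 2 = (2 * g - 1) * q - (k - 1) * (2 * k + 1)"
      by (simp add: power2_eq_square algebra_simps)
    moreover have "(2 * g - 1) * q - (k - 1) * (2 * k + 1) = (2 * g - 1) * (q - b * (2 * k + 1))"
      by (simp only: kb right_diff_distrib mult.assoc)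
    ultimately have "k\<^sup>2 dvd (2 * g - 1) * (q - b * (2 * k + 1))" by simp
    moreover have "coprime (2 * g - 1) k"
    proof (rule coprimeI)
      fix c assume c: "c dvd 2 * g - 1" "c dvd k"
      have "c dvd k - 1" unfolding kb using c(1) by (rule dvd_mult2)
      then have "c dvd k - (k - 1)" by (rule dvd_diff[OF c(2)])
      then show "is_unit c" by simp
    qed
    then have "coprime (2 * g - 1) (k\<^sup>2)" by simp
    ultimately have "k\<^sup>2 dvd q - b * (2 * k + 1)" by (simp add: coprime_commute coprime_dvd_mult_right_iff)
    then show ?thesis using kb g by blast
  next
    case 4
    then have "q - 1 = k * e" using b by (simp add: algebra_simps)
    then show ?thesis using q1 by simp
  qed
qed

section \<open>Two short vectors\<close>

text \<open>All terms on the right of \<open>eq\<close> are nonnegative, and the lower bounds on T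
  and X2 give \<open>m3 \<ge> g * \<gamma>\<close>. With n = gb and M = \<gamma>A this yields nM
  \<le> n + M, so n = 1, M = 1 or n = M = 2. In the last case the first three terms vanish, and of
  the four factorisations g = \<gamma> = 2 is incompatible with the bound on m3.\<close>

lemma cross_arith:
  fixes g \<gamma> A b R Y Y2 X2 T m3 :: int
  assumes pos: "g \<ge> 1" "\<gamma> \<ge> 1" "A \<ge> 1" "b \<ge> 1" "R \<ge> 1"
    and Y: "Y \<ge> (g - 1) * b + 1" and Y2: "Y2 \<ge> (\<gamma> - 1) * A + 1"
    and X2: "X2 \<ge> (\<gamma> - 1) * R + 1" and T: "T \<ge> (g - 1) * R + 1" and m3: "R * m3 = 1 + T * X2"
    and eq: "g * b + \<gamma> * A = R * (Y - g) * (Y2 - \<gamma>) + (Y - g) * A * X2 + (Y2 - \<gamma>) * T * b + A * b * m3"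
  shows "g * b = 1 \<or> \<gamma> * A = 1 \<or>
    (g = 1 \<and> \<gamma> = 1 \<and> A = 2 \<and> b = 2 \<and> m3 = 1 \<and> Y = 1 \<and> Y2 = 1) \<or>
    (g = 2 \<and> \<gamma> = 1 \<and> A = 2 \<and> b = 1 \<and> m3 = 2 \<and> Y = 2 \<and> Y2 = 1) \<or>
    (g = 1 \<and> \<gamma> = 2 \<and> A = 1 \<and> b = 2 \<and> m3 = 2 \<and> Y = 1 \<and> Y2 = 2)"
proof -
  have Yg: "Y - g \<ge> 0"
  proof -
    have "0 \<le> (g - 1) * (b - 1)" using pos by simp
    then show ?thesis using Y by (simp add: algebra_simps)
  qed
  have Yg2: "Y2 - \<gamma> \<ge> 0"
  proof -
    have "0 \<le> (\<gamma> - 1) * (A - 1)" using pos by simp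
    then show ?thesis using Y2 by (simp add: algebra_simps)
  qed
  define p s where "p = g - 1" and "s = \<gamma> - 1"
  have ps: "p \<ge> 0" "s \<ge> 0" "g = p + 1" "\<gamma> = s + 1" using pos by (auto simp: p_def s_def)
  have TX: "T \<ge> p * R + 1" "X2 \<ge> s * R + 1" using T X2 by (auto simp: p_def s_def)
  have pR: "0 \<le> p * R" "0 \<le> s * R" using ps pos by auto
  then have TX1: "T \<ge> 1" "X2 \<ge> 1" using TX by linarith+
  have "(p * R + 1) * (s * R + 1) \<le> T * X2" using TX pR by (intro mult_mono) auto
  then have "R * m3 \<ge> 2 + R * (p + s + p * s * R)" using m3 by (simp add: algebra_simps)
  then have "R * (p + s + p * s * R) < R * m3" by linarith
  then have m3R: "m3 \<ge> p + s + p * s * R + 1" using pos by simp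
  have "p * s * 1 \<le> p * s * R" using ps pos by (intro mult_left_mono) auto
  then have m3g: "m3 \<ge> g * \<gamma>" using m3R ps by (simp add: algebra_simps)
  define n M where "n = g * b" and "M = \<gamma> * A"
  have nM: "n \<ge> 1" "M \<ge> 1" using pos by (auto simp: n_def M_def int_one_le_iff_zero_less)
  have AB: "A * b \<ge> 1" using pos by (simp add: int_one_le_iff_zero_less)
  define S where "S = R * (Y - g) * (Y2 - \<gamma>) + (Y - g) * A * X2 + (Y2 - \<gamma>) * T * b"
  have Spos: "0 \<le> R * (Y - g) * (Y2 - \<gamma>)" "0 \<le> (Y - g) * A * X2" "0 \<le> (Y2 - \<gamma>) * T * b"
    using Yg Yg2 pos TX1 by auto
  have S: "n + M = S + A * b * m3" using eq by (simp add: n_def M_def S_def)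
  have "A * b * (g * \<gamma>) \<le> A * b * m3" using m3g AB by (intro mult_left_mono) auto
  moreover have "A * b * (g * \<gamma>) = n * M" by (simp add: n_def M_def algebra_simps)
  ultimately have le: "n * M \<le> A * b * m3" by simp
  have S0: "0 \<le> S" using Spos unfolding S_def by simp
  have "n * M \<le> n + M" using le S S0 by linarith
  then have "(n - 1) * (M - 1) \<le> 1" by (simp add: algebra_simps)
  show ?thesis
  proof (cases "n = 1 \<or> M = 1")
    case True
    then show ?thesis by (auto simp: n_def M_def)
  next
    case False
    then have ge: "n - 1 \<ge> 1" "M - 1 \<ge> 1" using nM by auto
    have "(n - 1) * 1 \<le> (n - 1) * (M - 1)" "1 * (M - 1) \<le> (n - 1) * (M - 1)"
      using ge by (auto intro!: mult_left_mono mult_right_mono)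
    then have "(n - 1) * 1 \<le> 1" "1 * (M - 1) \<le> 1"
      using \<open>(n - 1) * (M - 1) \<le> 1\<close> by (meson order_trans)+
    then have n2: "n = 2" "M = 2" using ge by simp_all
    then have "S = 0" and abm: "A * b * m3 = 4" using S S0 le by simp_all
    then have "(Y - g) * A * X2 = 0" "(Y2 - \<gamma>) * T * b = 0" using Spos unfolding S_def by linarith+
    then have YY: "Y = g" "Y2 = \<gamma>" using pos TX1 by auto
    have two: "x = 1 \<and> y = 2 \<or> x = 2 \<and> y = 1" if "x * y = 2" "x \<ge> 1" "y \<ge> 1" for x y :: int
    proof -
      have "x dvd 2" using that(1) by (metis dvd_triv_left)
      then have "x \<le> 2" by (simp add: zdvd_imp_le)
      then have "x = 1 \<or> x = 2" using that by linarith
      then show ?thesis using that by auto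
    qed
    have gb: "g = 1 \<and> b = 2 \<or> g = 2 \<and> b = 1" using two[of g b] n2 pos by (simp add: n_def)
    have gA: "\<gamma> = 1 \<and> A = 2 \<or> \<gamma> = 2 \<and> A = 1" using two[of \<gamma> A] n2 pos by (simp add: M_def)
    have "\<not> (g = 2 \<and> \<gamma> = 2)"
    proof
      assume gg: "g = 2 \<and> \<gamma> = 2"
      then have "m3 = 4" using abm gb gA by auto
      have "p = 1" "s = 1" using gg by (auto simp: p_def s_def)
      then have "R \<le> 1" using m3R \<open>m3 = 4\<close> by simp
      then have "R = 1" using pos by simp
      then have "2 + (p + s + p * s) \<le> m3"
        using \<open>R * m3 \<ge> 2 + R * (p + s + p * s * R)\<close> by simp
      then show False using \<open>m3 = 4\<close> \<open>p = 1\<close> \<open>s = 1\<close> by simp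
    qed
    then show ?thesis using gb gA abm YY by auto
  qed
qed

text \<open>The two short vectors are \<open>(k - n, k - n')\<close> and \<open>(\<mu> - k, k - \<mu>')\<close>; that they span a lattice of index
  \<open>k\<^sup>2\<close> is the equation \<open>rel\<close>.\<close>

locale crossing_pair =
  fixes k q n n' \<mu> \<mu>' m :: int
  assumes k: "k \<ge> 2" and cop: "coprime q k"
    and pos: "n \<ge> 1" "n' \<ge> 1" "\<mu> \<ge> 1" "\<mu>' \<ge> 1"
    and u: "k dvd n' - q * n" and om: "k dvd \<mu>' + q * \<mu>"
    and rel: "n * \<mu>' + n' * \<mu> = k * (n + n' + \<mu> + \<mu>' - k)"
    and Q1: "empty_box k q 0 n m n'" and Q4: "empty_box k q 0 \<mu> (m - \<mu>') \<mu>'"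
begin

lemma om_pos: "k dvd \<mu>' - q * (- \<mu>)" and u_neg: "k dvd - n' - q * (- n)"
proof -
  show "k dvd \<mu>' - q * (- \<mu>)" using om by simp
  have "k dvd - (n' - q * n)" using u by (simp only: dvd_minus_iff)
  then show "k dvd - n' - q * (- n)" by simp
qed

lemma Q2: "empty_box k q (- \<mu>) \<mu> m \<mu>'"
  by (rule empty_box_translate[OF om_pos Q4]) auto

lemma Q3: "empty_box k q (- n) n (m - n') n'"
  by (rule empty_box_translate[OF u_neg Q1]) auto

lemma Q4u: "empty_box k q n \<mu> (m - \<mu>' + n') \<mu>'"
  by (rule empty_box_translate[OF u Q4]) auto

lemma Q2u: "empty_box k q (n - \<mu>) \<mu> (m + n') \<mu>'"
  by (rule empty_box_translate[OF u Q2]) auto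

lemma Q1w: "empty_box k q (- \<mu>) n (m + \<mu>') n'"
  by (rule empty_box_translate[OF om_pos Q1]) auto

text \<open>Three translates of the two boxes stand side by side; the hypothesis makes the outer
  ones cover the full height of the middle one. The two vertical boxes arise likewise by
  stacking.\<close>

lemma horizontal_box:
  assumes "n' \<le> \<mu>'"
  shows "empty_box k q (- \<mu>) (n + 2 * \<mu>) m n'"
  unfolding empty_box_def
proof (intro allI impI notI)
  fix x y assume *: "- \<mu> \<le> x" "x < - \<mu> + (n + 2 * \<mu>)" "m \<le> y" "y < m + n'" "k dvd y - q * x"
  consider "x < 0" | "0 \<le> x" "x < n" | "n \<le> x" by linarith
  then show False
  proof cases
    case 1 then show False using empty_boxD[OF Q2 *(5)] * assms by simp
  next
    case 2 then show False using empty_boxD[OF Q1 *(5)] * by simp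
  next
    case 3 then show False using empty_boxD[OF Q4u *(5)] * assms by simp
  qed
qed

lemma vertical_box:
  assumes "\<mu> \<le> n"
  shows "empty_box k q (- \<mu>) \<mu> (m - n') (\<mu>' + 2 * n')"
  unfolding empty_box_def
proof (intro allI impI notI)
  fix x y assume *: "- \<mu> \<le> x" "x < - \<mu> + \<mu>" "m - n' \<le> y" "y < m - n' + (\<mu>' + 2 * n')" "k dvd y - q * x"
  consider "y < m" | "m \<le> y" "y < m + \<mu>'" | "m + \<mu>' \<le> y" by linarith
  then show False
  proof cases
    case 1 then show False using empty_boxD[OF Q3 *(5)] * assms by simp
  next
    case 2 then show False using empty_boxD[OF Q2 *(5)] * by simp
  next
    case 3 then show False using empty_boxD[OF Q1w *(5)] * assms by simp
  qed
qed

lemma vertical_box':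
  assumes "n \<le> \<mu>"
  shows "empty_box k q 0 n (m - \<mu>') (n' + 2 * \<mu>')"
  unfolding empty_box_def
proof (intro allI impI notI)
  fix x y assume *: "0 \<le> x" "x < 0 + n" "m - \<mu>' \<le> y" "y < m - \<mu>' + (n' + 2 * \<mu>')" "k dvd y - q * x"
  consider "y < m" | "m \<le> y" "y < m + n'" | "m + n' \<le> y" by linarith
  then show False
  proof cases
    case 1 then show False using empty_boxD[OF Q4 *(5)] * assms by simp
  next
    case 2 then show False using empty_boxD[OF Q1 *(5)] * by simp
  next
    case 3 then show False using empty_boxD[OF Q2u *(5)] * assms by simp
  qed
qed

text \<open>The two elongated boxes satisfy \<open>empty_box_dims\<close>; adding both bounds makes
  the right side of \<open>rel\<close> nonpositive.\<close>

lemma not_nested: "\<not> (n \<le> \<mu> \<and> n' \<le> \<mu>')"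
proof
  assume *: "n \<le> \<mu> \<and> n' \<le> \<mu>'"
  have "n + 2 * \<mu> + n' \<le> k"
    using empty_box_dims[OF cop _ horizontal_box] * k pos by simp
  moreover have "n + (n' + 2 * \<mu>') \<le> k"
    using empty_box_dims[OF cop _ vertical_box'] * k pos by simp
  ultimately have "n + n' + \<mu> + \<mu>' - k \<le> 0" by simp
  then have "k * (n + n' + \<mu> + \<mu>' - k) \<le> 0" using k by (simp add: mult_le_0_iff)
  moreover have "0 < n * \<mu>' + n' * \<mu>" using pos by (intro add_pos_pos mult_pos_pos) auto
  ultimately show False using rel by simp
qed

text \<open>Row m has a point among any k successive columns. The k columns chosen end exactly where
  the horizontal box ends, so the point must lie to the left of that box.\<close>

lemma row_point_left:
  assumes "n' \<le> \<mu>'"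
  obtains x0 where "k dvd m - q * x0" "n + \<mu> - k \<le> x0" "x0 < - \<mu>"
proof -
  obtain v where "[q * v = 1] (mod k)" using cop cong_solve_coprime_int by blast
  then have v: "k dvd q * v - 1" by (simp add: cong_iff_dvd_diff)
  define x0 where "x0 = n + \<mu> - k + (m * v - (n + \<mu> - k)) mod k"
  have x0k: "n + \<mu> - k \<le> x0" "x0 < n + \<mu>" using k pos_mod_bound[of k "m * v - (n + \<mu> - k)"] pos_mod_sign[of k "m * v - (n + \<mu> - k)"]
    unfolding x0_def by linarith+
  define D where "D = (m * v - (n + \<mu> - k)) div k"
  have "x0 = m * v - k * D"
    by (simp add: x0_def D_def minus_mult_div_eq_mod[symmetric])
  then have "m - q * x0 = k * (q * D) - m * (q * v - 1)"
    by (simp only:) (simp add: algebra_simps)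
  moreover have "k dvd k * (q * D) - m * (q * v - 1)"
    by (rule dvd_diff[OF dvd_triv_left dvd_mult[OF v]])
  ultimately have dv: "k dvd m - q * x0" by simp
  have "x0 < - \<mu>" using empty_boxD[OF horizontal_box[OF assms] dv] x0k pos by fastforce
  then show ?thesis using that dv x0k by blast
qed

end

context crossing_pair
begin

text \<open>The inequality behind \<open>crossing_thin\<close> is \<open>(n' - 1) (\<mu> - 1) \<le> 1\<close>, so \<open>n' = \<mu> = 2\<close> has to be excluded by
  hand: for each solution of the equality case some lattice point lies in one of the two boxes.\<close>

lemma exceptional_both_two:
  assumes wide: "\<mu> \<le> n" "n' \<le> \<mu>'" and two: "n' = 2" "\<mu> = 2"
    and T: "T \<ge> 1" "X2 \<ge> 1" and nk: "n = R + 2 * X2" "\<mu>' = R + 2 * T" "R = 1 + T * X2"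
      "k = R + 2 * X2 + 2 * T + 4" and z: "k dvd 1 + q * (T + 2)"
  shows False
proof -
  \<comment> \<open>Since k = (T + 2)(X2 + 2) + 1, the relation \<open>z\<close> determines q modulo
    k: it is X2 + 2.\<close>
  have "k dvd k * q - (X2 + 2) * (1 + q * (T + 2))" by (rule dvd_diff[OF dvd_triv_left dvd_mult[OF z]])
  moreover have "k = (T + 2) * (X2 + 2) + 1" using nk by (simp add: algebra_simps)
  then have "k * q - (X2 + 2) * (1 + q * (T + 2)) = q - (X2 + 2)" by (simp only:) (simp add: algebra_simps)
  ultimately have c: "k dvd q - (X2 + 2)" by simp
  obtain x0 where x0: "k dvd m - q * x0" "n + \<mu> - k \<le> x0" "x0 < - \<mu>"
    using row_point_left wide by blast
  have "T * 1 \<le> T * X2" using T by (intro mult_left_mono) auto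
  then have RT: "R \<ge> 1 + T" using nk by simp
  have lo: "- T \<le> x0"
  proof (rule ccontr)
    assume a: "\<not> - T \<le> x0"
    have "k dvd (m - q * x0) + (1 + q * (T + 2)) - k * q"
      by (rule dvd_diff[OF dvd_add[OF x0(1) z] dvd_triv_left])
    then have "k dvd (m + 1) - q * (x0 - (T + 2) + k)" by (simp add: algebra_simps)
    then show False
      by (rule empty_boxD[OF horizontal_box[OF wide(2)]]) (use a x0 two nk(1,4) RT T in linarith)+
  qed
  \<comment> \<open>Going j columns to the right along q = X2 + 2 reaches the column -2 of the
    vertical box; the bound on x0 keeps the height inside.\<close>
  define j where "j = - 2 - x0"
  have j: "1 \<le> j" "j \<le> T - 2" using lo x0 two by (auto simp: j_def)
  have "k dvd (m - q * x0) - (q - (X2 + 2)) * j" by (rule dvd_diff[OF x0(1) dvd_mult2[OF c]])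
  then have pt: "k dvd (m + (X2 + 2) * j) - q * (- 2)" by (simp add: j_def algebra_simps)
  have "(X2 + 2) * j \<le> (X2 + 2) * (T - 2)" using j T by (intro mult_left_mono) auto
  also have "\<dots> < \<mu>' + 2" using nk T by (simp add: algebra_simps)
  finally have "(X2 + 2) * j < \<mu>' + 2" .
  moreover have "0 \<le> (X2 + 2) * j" using j T by simp
  ultimately show False
    using empty_boxD[OF vertical_box[OF wide(1)] pt] two by simp
qed

lemma exceptional_twice_u:
  assumes wide: "\<mu> \<le> n" "n' \<le> \<mu>'" and two: "n' = 2" "\<mu> = 2" and R: "R \<ge> 1"
    and nk: "n = 2 * R + 4" "\<mu>' = 4 * R - 1" "k = 4 * R + 7"
    and z: "k dvd 1 - q * (R + 2)" "k dvd 2 + q * (2 * R + 3)"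
  shows False
proof -
  have "k dvd 2 * (1 - q * (R + 2)) + (2 + q * (2 * R + 3))" 
    by (rule dvd_add[OF dvd_mult[OF z(1)] z(2)])
  then have c: "k dvd 4 - q" by (simp add: algebra_simps)
  obtain x0 where x0: "k dvd m - q * x0" "n + \<mu> - k \<le> x0" "x0 < - \<mu>"
    using row_point_left wide by blast
  have hi: "x0 \<le> - R - 5"
  \<comment> \<open>Otherwise the translate of \<open>(x0, m)\<close> by \<open>(R + 2, 1)\<close>
    lies in the second row of the horizontal box.\<close>
  proof (rule ccontr)
    assume a: "\<not> x0 \<le> - R - 5"
    have "k dvd (m - q * x0) + (1 - q * (R + 2))" by (rule dvd_add[OF x0(1) z(1)])
    then have "k dvd (m + 1) - q * (x0 + R + 2)" by (simp add: algebra_simps)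
    then show False
      by (rule empty_boxD[OF horizontal_box[OF wide(2)]]) (use a x0 two nk R in auto)
  qed
  define j where "j = - 2 - x0"
  have j: "R + 3 \<le> j" "j \<le> 2 * R - 1" using hi x0 two nk by (auto simp: j_def)
  have "k dvd (m - q * x0) + (4 - q) * j" by (rule dvd_add[OF x0(1) dvd_mult2[OF c]])
  then have "k dvd (m - q * x0) + (4 - q) * j - k" by (rule dvd_diff[OF _ dvd_refl])
  then have pt: "k dvd (m + 4 * j - k) - q * (- 2)" by (simp add: j_def algebra_simps)
  then show False
    by (rule empty_boxD[OF vertical_box[OF wide(1)]]) (use two nk j in auto)
qed

lemma exceptional_twice_om:
  assumes wide: "\<mu> \<le> n" "n' \<le> \<mu>'" and two: "n' = 2" "\<mu> = 2" and R: "R \<ge> 1"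
    and nk: "n = 4 * R - 1" "k = 4 * R + 7" and z: "k dvd 1 + q * 4"
  shows False
proof -
  obtain x0 where x0: "k dvd m - q * x0" "n + \<mu> - k \<le> x0" "x0 < - \<mu>"
    using row_point_left wide by blast
  \<comment> \<open>Only -6 \<le> x0 \<le> -3 is left, and the translate by (k - 4, 1) hits the
    second row of the horizontal box.\<close>
  have "k dvd (m - q * x0) + (1 + q * 4) - k * q"
    by (rule dvd_diff[OF dvd_add[OF x0(1) z] dvd_triv_left])
  then have "k dvd (m + 1) - q * (x0 - 4 + k)" by (simp add: algebra_simps)
  then show False
    by (rule empty_boxD[OF horizontal_box[OF wide(2)]]) (use x0 two nk R in auto)
qed

text \<open>The row of lattice points just above the horizontal box runs past the vertical box; reading off
  its abscissae modulo \<open>a\<close> gives an empty box for a lattice of index \<open>a\<close>, to which the strip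
  lemma applies once more.\<close>

theorem crossing_thin:
  assumes wide: "\<mu> \<le> n" "n' \<le> \<mu>'"
  shows "n' = 1 \<or> \<mu> = 1"
proof -
  note H = horizontal_box[OF wide(2)] and V = vertical_box[OF wide(1)]
  have k0: "k > 0" using k by simp
  obtain g a b e where g: "g \<ge> 1" "a \<ge> 1" "b \<ge> 1" and na: "n = g * a" "n' = g * b"
    and b: "b = a * q - e * k" and cope: "coprime a e"
    using lattice_gcd_decomposition[OF pos(1,2) u] by blast
  have ge: "a \<le> n + 2 * \<mu>" "b \<le> n'"
  proof -
    have "1 * a \<le> g * a" "1 * b \<le> g * b" using g by (intro mult_right_mono; simp)+
    then show "a \<le> n + 2 * \<mu>" "b \<le> n'" using na pos by simp_all
  qed
  obtain x1 y1 x2 y2 where z: "k dvd y1 - q * x1" "k dvd y2 - q * x2" "- \<mu> \<le> x1" "x1 < - \<mu> + a"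
    "m + n' \<le> y1" "m \<le> y2" "y2 < m + b" "- \<mu> + (n + 2 * \<mu>) \<le> x2" "a * (y1 - y2) + b * (x2 - x1) = k"
    by (rule empty_box_strip[OF k0 b cope g(2,3) ge H])
  define X Y where "X = x2 - x1" and "Y = y1 - y2"
  have kXY: "a * Y + b * X = k" using z by (simp add: X_def Y_def)
  have X: "X \<ge> (g - 1) * a + 2 * \<mu> + 1" and Y: "Y \<ge> (g - 1) * b + 1"
    using z na by (simp_all add: X_def Y_def algebra_simps)
  have "k dvd (y1 - q * x1) - (y2 - q * x2)" by (rule dvd_diff[OF z(1,2)])
  then have zXY: "k dvd Y + q * X" by (simp add: X_def Y_def algebra_simps)
  have u0: "k dvd b - q * a" by (simp add: b)
  have "k dvd a * (\<mu>' + q * \<mu>) - k * (e * \<mu>)" by (rule dvd_diff[OF dvd_mult[OF om] dvd_triv_left])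
  moreover have "a * (\<mu>' + q * \<mu>) - k * (e * \<mu>) = a * \<mu>' + b * \<mu>" by (simp add: b algebra_simps)
  ultimately obtain R' where R': "a * \<mu>' + b * \<mu> = k * R'" by auto
  have "0 < a * \<mu>' + b * \<mu>" using g pos by (intro add_pos_pos mult_pos_pos) auto
  then have R'1: "R' \<ge> 1" using R' k by (simp add: zero_less_mult_iff)
  have "k dvd (\<mu>' + q * \<mu>) - R' * (Y + q * X)" by (rule dvd_diff[OF om dvd_mult[OF zXY]])
  then have "k dvd (\<mu>' - R' * Y) - q * (R' * X - \<mu>)" by (simp add: algebra_simps)
  moreover have "k * R' = R' * (a * Y) + R' * (b * X)" unfolding kXY[symmetric] by (simp add: algebra_simps)
  then have "a * (\<mu>' - R' * Y) = b * (R' * X - \<mu>)" using R' by (simp add: algebra_simps)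
  moreover have "k \<noteq> 0" "a \<noteq> 0" using k g by auto
  ultimately obtain t where t: "R' * X - \<mu> = t * a" "\<mu>' - R' * Y = t * b"
    using lattice_primitive_multiple[OF _ _ b cope, of "\<mu>' - R' * Y" "R' * X - \<mu>"] by blast
  \<comment> \<open>The coarse vector \<open>(- \<mu>, \<mu>')\<close> equals
    \<open>R' * (- X, Y) + t * (a, b)\<close>. Dividing by \<gamma> gives
    \<open>(R', \<mu>) = \<gamma> * (R, A)\<close> with (R, A) primitive in the lattice of index
    \<open>a\<close>, as the second strip argument requires.\<close>
  define \<gamma> where "\<gamma> = gcd R' t"
  have \<gamma>: "\<gamma> \<ge> 1" using R'1 by (simp add: \<gamma>_def int_one_le_iff_zero_less)
  obtain R T where RT: "R' = \<gamma> * R" "t = \<gamma> * T" by (metis \<gamma>_def gcd_dvd1 gcd_dvd2 dvdE)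
  have copRT: "coprime R T"
  proof -
    have "coprime (R' div \<gamma>) (t div \<gamma>)" unfolding \<gamma>_def using R'1 by (intro div_gcd_coprime) simp
    moreover have "R' div \<gamma> = R" "t div \<gamma> = T" using RT \<gamma> by auto
    ultimately show ?thesis by simp
  qed
  define A where "A = R * X - T * a"
  have \<mu>A: "\<mu> = \<gamma> * A" using t(1) RT by (simp add: A_def algebra_simps)
  have A1: "A \<ge> 1" using \<mu>A pos \<gamma> by (auto simp: int_one_le_iff_zero_less zero_less_mult_iff)
  have R1: "R \<ge> 1" using RT R'1 \<gamma> by (auto simp: int_one_le_iff_zero_less zero_less_mult_iff)
  have A\<mu>: "A \<le> \<mu>"
  proof -
    have "1 * A \<le> \<gamma> * A" using \<gamma> A1 by (intro mult_right_mono) auto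
    then show ?thesis using \<mu>A by simp
  qed
  \<comment> \<open>The horizontal box exceeds the single box by 2\<mu> columns; this surplus
    outweighs A \<le> \<mu>.\<close>
  have T: "T \<ge> (g - 1) * R + 1"
  proof -
    have "R * ((g - 1) * a + 2 * \<mu> + 1) \<le> R * X" using X R1 by (intro mult_left_mono) auto
    then have "((g - 1) * R) * a + R * (2 * \<mu> + 1) \<le> T * a + A" by (simp add: A_def algebra_simps)
    moreover have "1 * (2 * \<mu> + 1) \<le> R * (2 * \<mu> + 1)" using R1 pos by (intro mult_right_mono) auto
    then have "((g - 1) * R) * a + 1 * (2 * \<mu> + 1) \<le> ((g - 1) * R) * a + R * (2 * \<mu> + 1)" by (rule add_left_mono)
    ultimately have "((g - 1) * R) * a + 1 * (2 * \<mu> + 1) \<le> T * a + A" by (rule order_trans[rotated])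
    then have "((g - 1) * R) * a < T * a" using A\<mu> pos by simp
    then have "(g - 1) * R < T" using g by (simp add: mult_less_cancel_right_pos)
    then show ?thesis by simp
  qed
  \<comment> \<open>An entry (j, y) of this box comes from the coarse lattice point in column x1 - y
    on the j-th row above the one through (x1, y1). That column belongs to the vertical box, and 0
    \<le> j < R' keeps the height between its lower and upper ends.\<close>
  have L2: "empty_box a X 0 R' (x1 + 1) \<mu>"
    unfolding empty_box_def
  proof (intro allI impI notI)
    fix j y assume jy: "0 \<le> j" "j < 0 + R'" "x1 + 1 \<le> y" "y < x1 + 1 + \<mu>" "a dvd y - X * j"
    then obtain i where i: "y - X * j = a * i" by blast
    define x w where "x = x1 - y" and "w = y1 + j * Y - i * b"
    have x: "- \<mu> \<le> x" "x < 0" using jy by (auto simp: x_def)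
    have xe: "x = x1 - j * X - i * a" using i by (simp add: x_def algebra_simps)
    have "k dvd (y1 - q * x1) + j * (Y + q * X) - i * (b - q * a)"
      by (rule dvd_diff[OF dvd_add[OF z(1) dvd_mult[OF zXY]] dvd_mult[OF u0]])
    then have mem: "k dvd w - q * x" by (simp add: xe w_def algebra_simps)
    have f: "a * w - b * x = a * y1 - b * x1 + j * k"
      unfolding kXY[symmetric] by (simp add: xe w_def algebra_simps)
    have "y1 - b < w"
    proof -
      have "0 \<le> j * k" using jy k by simp
      then have "b * (x - x1) \<le> a * (w - y1)" using f by (simp add: algebra_simps)
      moreover have "b * (- a) < b * (x - x1)" using x z g by (intro mult_strict_left_mono) auto
      ultimately have "a * (- b) < a * (w - y1)" by (simp add: mult.commute)
      then have "- b < w - y1" by (rule mult_left_less_imp_less) (use g in simp)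
      then show ?thesis by simp
    qed
    then have lo: "m \<le> w" using z ge by simp
    have "w < y2 + \<mu>'"
    proof -
      have "(j + 1) * k \<le> R' * k" using jy k by (intro mult_right_mono) auto
      moreover have "a * y1 - b * x1 = a * y2 - b * x2 + k" using z(9) by (simp add: algebra_simps)
      ultimately have "a * w - b * x \<le> a * y2 - b * x2 + (a * \<mu>' + b * \<mu>)"
        using f R' by (simp add: algebra_simps)
      then have "a * (w - y2 - \<mu>') \<le> b * (x - x2 + \<mu>)" by (simp add: algebra_simps)
      also have "\<dots> < b * 0" using x z pos g by (intro mult_strict_left_mono) auto
      finally have "a * (w - y2 - \<mu>') < 0" by simp
      then show ?thesis using g by (simp add: mult_less_0_iff)
    qed
    then have hi: "w < m + \<mu>' + n'" using z ge by simp
    show False using empty_boxD[OF V mem] x lo hi pos by simp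
  qed
  have WH: "R \<le> R'" "A \<le> \<mu>"
  proof -
    have "1 * R \<le> \<gamma> * R" using \<gamma> R1 by (intro mult_right_mono) auto
    then show "R \<le> R'" using RT by simp
  qed (rule A\<mu>)
  have a0: "a > 0" using g by simp
  obtain x1' y1' x2' y2' where z': "a dvd y1' - X * x1'" "a dvd y2' - X * x2'" "0 \<le> x1'" "x1' < 0 + R"
    "x1 + 1 + \<mu> \<le> y1'" "x1 + 1 \<le> y2'" "y2' < x1 + 1 + A" "0 + R' \<le> x2'" "R * (y1' - y2') + A * (x2' - x1') = a"
    by (rule empty_box_strip[OF a0 A_def copRT R1 A1 WH L2])
  define X2 Y2 where "X2 = x2' - x1'" and "Y2 = y1' - y2'"
  have aXY: "a = R * Y2 + A * X2" using z' by (simp add: X2_def Y2_def)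
  have X2: "X2 \<ge> (\<gamma> - 1) * R + 1" and Y2: "Y2 \<ge> (\<gamma> - 1) * A + 1"
    using z' RT \<mu>A by (simp_all add: X2_def Y2_def algebra_simps)
  have "a dvd (y1' - X * x1') - (y2' - X * x2')" by (rule dvd_diff[OF z'(1,2)])
  then have "a dvd Y2 + X * X2" by (simp add: X2_def Y2_def algebra_simps)
  then obtain m3 where m3: "Y2 + X * X2 = a * m3" by blast
  have RX: "R * X = T * a + A" by (simp add: A_def)
  have "a * (R * m3) = R * (Y2 + X * X2)" unfolding m3 by (simp only: mult_ac)
  also have "\<dots> = R * Y2 + (R * X) * X2" by (simp add: algebra_simps)
  also have "\<dots> = a * (1 + T * X2)" unfolding RX by (simp add: algebra_simps aXY)
  finally have Rm3: "R * m3 = 1 + T * X2" using a0 by simp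
  have "R * X = R * (T * Y2 + A * m3)"
  proof -
    have "R * X = T * (R * Y2 + A * X2) + A" using RX aXY by simp
    also have "\<dots> = R * (T * Y2) + A * (1 + T * X2)" by (simp add: algebra_simps)
    also have "\<dots> = R * (T * Y2 + A * m3)" unfolding Rm3[symmetric] by (simp add: algebra_simps)
    finally show ?thesis .
  qed
  then have XT: "X = T * Y2 + A * m3" using R1 by simp
  have \<mu>': "\<mu>' = \<gamma> * (R * Y + T * b)" using t(2) RT by (simp add: algebra_simps)
  have "k * (n + n' + \<mu> + \<mu>' - k) = g * (a * \<mu>' + b * \<mu>)" using rel na by (simp add: algebra_simps)
  then have "k * (n + n' + \<mu> + \<mu>' - k) = k * (g * R')" unfolding R' by (simp add: algebra_simps)
  then have N: "n + n' + \<mu> + \<mu>' - k = g * R'" using k by simp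
  \<comment> \<open>This is \<open>rel\<close> divided by k, with all sides expressed by the
    parameters of the two strips.\<close>
  have key: "g * b + \<gamma> * A = R * (Y - g) * (Y2 - \<gamma>) + (Y - g) * A * X2 + (Y2 - \<gamma>) * T * b + A * b * m3"
  proof -
    have "g * a + g * b + \<gamma> * A + \<gamma> * (R * Y + T * b) - (a * Y + b * X) = g * (\<gamma> * R)"
      using N na \<mu>A \<mu>' RT kXY by simp
    then show ?thesis unfolding XT aXY by (simp add: algebra_simps)
  qed
  have "g * b = 1 \<or> \<gamma> * A = 1 \<or>
    (g = 1 \<and> \<gamma> = 1 \<and> A = 2 \<and> b = 2 \<and> m3 = 1 \<and> Y = 1 \<and> Y2 = 1) \<or>
    (g = 2 \<and> \<gamma> = 1 \<and> A = 2 \<and> b = 1 \<and> m3 = 2 \<and> Y = 2 \<and> Y2 = 1) \<or>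
    (g = 1 \<and> \<gamma> = 2 \<and> A = 1 \<and> b = 2 \<and> m3 = 2 \<and> Y = 1 \<and> Y2 = 2)"
    by (rule cross_arith[OF g(1) \<gamma> A1 g(3) R1 Y Y2 X2 T Rm3 key])
  then consider (thin_u) "g * b = 1" | (thin_om) "\<gamma> * A = 1"
    | (both_two) "g = 1" "\<gamma> = 1" "A = 2" "b = 2" "m3 = 1" "Y = 1" "Y2 = 1"
    | (twice_u) "g = 2" "\<gamma> = 1" "A = 2" "b = 1" "m3 = 2" "Y = 2" "Y2 = 1"
    | (twice_om) "g = 1" "\<gamma> = 2" "A = 1" "b = 2" "m3 = 2" "Y = 1" "Y2 = 2"
    by blast
  then show ?thesis
  proof cases
    case both_two
    have XX: "X = T + 2" using XT both_two by simp
    have "a = R + 2 * X2" using aXY both_two by simp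
    then have False
      using exceptional_both_two[OF wide, of T X2 R] na \<mu>A \<mu>' kXY zXY T X2 Rm3 both_two XX
      by (simp add: algebra_simps)
    then show ?thesis ..
  next
    case twice_u
    have TR: "T \<ge> R + 1" "X2 \<ge> 1" using T X2 twice_u by simp_all
    have "X2 = 1"
    proof (rule ccontr)
      assume "X2 \<noteq> 1"
      then have "T * 2 \<le> T * X2" using TR R1 by (intro mult_left_mono) auto
      then show False using Rm3 TR twice_u by simp
    qed
    then have T2: "T = 2 * R - 1" using Rm3 twice_u by simp
    have a: "a = R + 2" using aXY twice_u \<open>X2 = 1\<close> by simp
    have XX: "X = 2 * R + 3" using XT T2 twice_u by simp
    have False
      using exceptional_twice_u[OF wide, of R] na \<mu>A \<mu>' kXY zXY u0 twice_u XX a T2 R1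
      by (simp add: algebra_simps)
    then show ?thesis ..
  next
    case twice_om
    have TR: "X2 \<ge> R + 1" "T \<ge> 1" using T X2 twice_om by simp_all
    have "T = 1"
    proof (rule ccontr)
      assume "T \<noteq> 1"
      then have "2 * X2 \<le> T * X2" using TR R1 by (intro mult_right_mono) auto
      then show False using Rm3 TR twice_om by simp
    qed
    then have T2: "X2 = 2 * R - 1" using Rm3 twice_om by simp
    have a: "a = 4 * R - 1" using aXY twice_om T2 by simp
    have XX: "X = 4" using XT \<open>T = 1\<close> twice_om by simp
    have False
      using exceptional_twice_om[OF wide, of R] na \<mu>A kXY zXY twice_om XX a R1
      by (simp add: algebra_simps)
    then show ?thesis ..
  qed (use na \<mu>A in auto)
qed

end

section \<open>The classification\<close>

definition listed :: "int \<Rightarrow> int \<Rightarrow> bool" where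
  "listed k q \<longleftrightarrow>
      (\<exists>i. gcd i k \<in> {1, 2} \<and>
         ([q = i * k + 1] (mod k ^ 2) \<or> [q = i * k - 1] (mod k ^ 2))) \<or>
      (\<exists>d>0. d dvd k + 1 \<and> odd ((k + 1) div d) \<and>
         ([q = ((k + 1) div d) * (k + 1)] (mod k ^ 2) \<or>
          [q = - (((k + 1) div d) * (k + 1))] (mod k ^ 2))) \<or>
      (\<exists>d>0. d dvd k - 1 \<and> odd ((k - 1) div d) \<and>
         ([q = ((k - 1) div d) * (k - 1)] (mod k ^ 2) \<or>
          [q = - (((k - 1) div d) * (k - 1))] (mod k ^ 2))) \<or>
      (\<exists>d>0. d dvd k - 1 \<and> odd d \<and>
         ([q = ((k - 1) div d) * (2 * k + 1)] (mod k ^ 2) \<or>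
          [q = - (((k - 1) div d) * (2 * k + 1))] (mod k ^ 2))) \<or>
      (\<exists>d>0. d dvd k + 1 \<and> odd d \<and>
         ([q = ((k + 1) div d) * (2 * k - 1)] (mod k ^ 2) \<or>
          [q = - (((k + 1) div d) * (2 * k - 1))] (mod k ^ 2))) \<or>
      (\<exists>d>0. d dvd 2 * k + 1 \<and> odd d \<and>
         ([q = ((2 * k + 1) div d) * (k - 1)] (mod k ^ 2) \<or>
          [q = - (((2 * k + 1) div d) * (k - 1))] (mod k ^ 2))) \<or>
      (\<exists>d>0. d dvd 2 * k - 1 \<and> odd d \<and>
         ([q = ((2 * k - 1) div d) * (k + 1)] (mod k ^ 2) \<or>
          [q = - (((2 * k - 1) div d) * (k + 1))] (mod k ^ 2)))"

lemma cong_uminus_left_iff: "[- q = c] (mod m) \<longleftrightarrow> [q = - c] (mod m)" for q c m :: int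
  by (metis cong_minus_minus_iff minus_minus)

text \<open>Only family (0) needs a new witness, -i for i; the other families contain both
  signs.\<close>

lemma listed_uminus:
  assumes "listed k q"
  shows "listed k (- q)"
proof -
  have zero: "\<exists>i. gcd i k \<in> {1, 2} \<and> ([- q = i * k + 1] (mod k ^ 2) \<or> [- q = i * k - 1] (mod k ^ 2))"
    if i: "gcd i k \<in> {1, 2}" and c: "[q = i * k + 1] (mod k ^ 2) \<or> [q = i * k - 1] (mod k ^ 2)" for i
  proof (intro exI[of _ "- i"] conjI)
    show "gcd (- i) k \<in> {1, 2}" using i by simp
    show "[- q = - i * k + 1] (mod k ^ 2) \<or> [- q = - i * k - 1] (mod k ^ 2)"
      using c
    proof
      assume "[q = i * k + 1] (mod k ^ 2)"
      then have "[- q = - (i * k + 1)] (mod k ^ 2)" by (simp only: cong_minus_minus_iff)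
      moreover have "- (i * k + 1) = - i * k - 1" by simp
      ultimately show ?thesis by (simp only: simp_thms)
    next
      assume "[q = i * k - 1] (mod k ^ 2)"
      then have "[- q = - (i * k - 1)] (mod k ^ 2)" by (simp only: cong_minus_minus_iff)
      moreover have "- (i * k - 1) = - i * k + 1" by simp
      ultimately show ?thesis by (simp only: simp_thms)
    qed
  qed
  have swap: "[- q = c] (mod m) \<or> [- q = - c] (mod m) \<longleftrightarrow> [q = c] (mod m) \<or> [q = - c] (mod m)" for c m
    by (auto simp: cong_uminus_left_iff)
  show ?thesis
    using assms unfolding listed_def swap
  proof (rule disj_forward)
    assume "\<exists>i. gcd i k \<in> {1, 2} \<and> ([q = i * k + 1] (mod k ^ 2) \<or> [q = i * k - 1] (mod k ^ 2))"
    then show "\<exists>i. gcd i k \<in> {1, 2} \<and> ([- q = i * k + 1] (mod k ^ 2) \<or> [- q = i * k - 1] (mod k ^ 2))"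
      by (elim exE conjE) (rule zero)
  qed
qed

lemma mult_Suc_divides:
  assumes k: "k \<ge> 2" and cop: "coprime q (k\<^sup>2)" and gm: "genus_minimizing (k\<^sup>2) q k"
    and E: "0 < E" "E < k" and q: "[q = E * (k + 1)] (mod k\<^sup>2)"
  shows "odd E \<and> (E dvd k + 1 \<or> E dvd 2 * k - 1)"
proof (rule genus_minimizing_mult_Suc_imp[OF k E])
  have "coprime (E * (k + 1)) (k\<^sup>2)" using cop q cong_imp_coprime by blast
  then show "coprime E k" by simp
  show "genus_minimizing (k\<^sup>2) (E * (1 + k)) k"
    using genus_minimizing_cong[OF k cop q] gm by (simp add: add.commute)
qed

lemma pos_of_dvd:
  fixes a d :: int
  assumes "d > 0" "d dvd a" "a > 0"
  shows "a div d > 0" "a div d * d = a" "d \<le> a"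
proof -
  show "a div d > 0" using assms by (simp add: pos_imp_zdiv_pos_iff zdvd_imp_le)
  show "a div d * d = a" using assms by simp
  show "d \<le> a" using assms by (simp add: zdvd_imp_le)
qed

lemma listed_mult_Suc:
  assumes k: "k \<ge> 2" and E: "0 < E" "odd E" and dvd: "E dvd k + 1 \<or> E dvd 2 * k - 1"
    and q: "[q = E * (k + 1)] (mod k\<^sup>2)"
  shows "listed k q"
  using dvd
proof
  assume d: "E dvd k + 1"
  define d where "d = (k + 1) div E"
  have "d > 0" "d * E = k + 1" using pos_of_dvd[OF E(1) d] k by (auto simp: d_def)
  then have "(k + 1) div d = E" "d dvd k + 1" by (auto simp flip: \<open>d * E = k + 1\<close>)
  then have "d > 0 \<and> d dvd k + 1 \<and> odd ((k + 1) div d) \<and> ([q = ((k + 1) div d) * (k + 1)] (mod k ^ 2) \<or>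
          [q = - (((k + 1) div d) * (k + 1))] (mod k ^ 2))" using E q \<open>d > 0\<close> by simp
  then show ?thesis unfolding listed_def by blast
next
  assume d: "E dvd 2 * k - 1"
  define d where "d = (2 * k - 1) div E"
  have "d > 0" and dE: "d * E = 2 * k - 1" using pos_of_dvd[OF E(1) d] k by (auto simp: d_def)
  then have "(2 * k - 1) div d = E" "d dvd 2 * k - 1" by (auto simp flip: dE)
  moreover have "odd (d * E)" unfolding dE by simp
  then have "odd d" by simp
  ultimately have "d > 0 \<and> d dvd 2 * k - 1 \<and> odd d \<and> ([q = ((2 * k - 1) div d) * (k + 1)] (mod k ^ 2) \<or>
          [q = - (((2 * k - 1) div d) * (k + 1))] (mod k ^ 2))" using E q \<open>d > 0\<close> by simp
  then show ?thesis unfolding listed_def by blast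
qed

text \<open>By (k + 1)^2 (2k - 1) = -1 modulo k^2, the negative inverse of E(k + 1) is the cofactor
  of E times the remaining factor: 2k - 1 if E divides k + 1, and k + 1 if E divides 2k - 1.\<close>

lemma listed_inverse_mult_Suc:
  assumes k: "k \<ge> 2" and E: "0 < E" "odd E" and dvd: "E dvd k + 1 \<or> E dvd 2 * k - 1"
    and q: "k\<^sup>2 dvd q * (E * (k + 1)) + 1"
  shows "listed k q"
proof -
  have "coprime (E * (k + 1)) (k\<^sup>2)"
  proof (rule coprimeI)
    fix c assume c: "c dvd E * (k + 1)" "c dvd k\<^sup>2"
    have "c dvd (q * (E * (k + 1)) + 1) - q * (E * (k + 1))"
      by (rule dvd_diff[OF dvd_trans[OF c(2) q] dvd_mult[OF c(1)]])
    then show "is_unit c" by simp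
  qed
  then have cancel: "k\<^sup>2 dvd q - x" if "k\<^sup>2 dvd x * (E * (k + 1)) + 1" for x
    using dvd_diff[OF q that] by (simp add: coprime_commute coprime_dvd_mult_left_iff left_diff_distrib[symmetric])
  have poly: "k\<^sup>2 dvd (k + 1) * (2 * k - 1) * (k + 1) + 1"
  proof -
    have "(k + 1) * (2 * k - 1) * (k + 1) + 1 = k\<^sup>2 * (2 * k + 3)" by (simp add: power2_eq_square algebra_simps)
    then show ?thesis by simp
  qed
  from dvd show ?thesis
  proof
    assume d: "E dvd k + 1"
    define D where "D = (k + 1) div E"
    have D: "D * E = k + 1" using pos_of_dvd[OF E(1) d] k by (auto simp: D_def)
    have "D * (2 * k - 1) * (E * (k + 1)) + 1 = (D * E) * (2 * k - 1) * (k + 1) + 1" by (simp only: mult_ac)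
    then have "k\<^sup>2 dvd q - D * (2 * k - 1)" using poly by (intro cancel) (simp only: D)
    then have "[q = (k + 1) div E * (2 * k - 1)] (mod k\<^sup>2)" by (simp add: D_def cong_iff_dvd_diff)
    then show ?thesis unfolding listed_def using d E by blast
  next
    assume d: "E dvd 2 * k - 1"
    define D where "D = (2 * k - 1) div E"
    have D: "D * E = 2 * k - 1" using pos_of_dvd[OF E(1) d] k by (auto simp: D_def)
    have "D * (k + 1) * (E * (k + 1)) + 1 = (k + 1) * (D * E) * (k + 1) + 1" by (simp only: mult_ac)
    then have "k\<^sup>2 dvd q - D * (k + 1)" using poly by (intro cancel) (simp only: D)
    then have "[q = (2 * k - 1) div E * (k + 1)] (mod k\<^sup>2)" by (simp add: D_def cong_iff_dvd_diff)
    then show ?thesis unfolding listed_def using d E by blast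
  qed
qed

text \<open>A side of length 1 means that a short vector has a coordinate k - 1 up to sign, and
  multiplication by k + 1 makes it invertible: q = E(k + 1) for \<mu> = 1, and -1/q = E(k + 1) for
  n' = 1.\<close>

lemma listed_of_thin:
  assumes k: "k \<ge> 2" and cop: "coprime q (k\<^sup>2)" and gm: "genus_minimizing (k\<^sup>2) q k"
    and V: "k\<^sup>2 dvd (k - n') - q * (k - n)" and W: "k\<^sup>2 dvd (k - \<mu>') + q * (k - \<mu>)"
    and rng: "1 \<le> n" "n < k" "1 \<le> \<mu>'" "\<mu>' < k" and thin: "n' = 1 \<or> \<mu> = 1"
  shows "listed k q"
  using thin
proof
  assume \<mu>: "\<mu> = 1"
  define E where "E = k - \<mu>'"
  have E: "0 < E" "E < k" using rng by (auto simp: E_def)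
  have "k\<^sup>2 dvd k\<^sup>2 * q - ((k - \<mu>') + q * (k - \<mu>)) * (k + 1)"
    by (rule dvd_diff[OF dvd_triv_left dvd_mult2[OF W]])
  then have "k\<^sup>2 dvd q - E * (k + 1)"
    by (simp add: \<mu> E_def power2_eq_square algebra_simps)
  then have q: "[q = E * (k + 1)] (mod k\<^sup>2)" by (simp add: cong_iff_dvd_diff)
  show ?thesis using mult_Suc_divides[OF k cop gm E q] listed_mult_Suc[OF k E(1) _ _ q] by blast
next
  assume n': "n' = 1"
  define E where "E = k - n"
  have E: "0 < E" "E < k" using rng by (auto simp: E_def)
  have "k\<^sup>2 dvd k\<^sup>2 - ((k - n') - q * (k - n)) * (k + 1)"
    by (rule dvd_diff[OF dvd_refl dvd_mult2[OF V]])
  then have inv: "k\<^sup>2 dvd q * (E * (k + 1)) + 1"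
    by (simp add: n' E_def power2_eq_square algebra_simps)
  then have "k\<^sup>2 dvd - (q * (E * (k + 1)) + 1)" by (simp only: dvd_minus_iff)
  then have inv': "k\<^sup>2 dvd q * (- (E * (k + 1))) - 1" by simp
  then have gm': "genus_minimizing (k\<^sup>2) (- (E * (k + 1))) k"
    by (rule genus_minimizing_inverse_imp[OF k _ gm])
  have copE: "coprime (E * (k + 1)) (k\<^sup>2)"
  proof (rule coprimeI)
    fix c assume c: "c dvd E * (k + 1)" "c dvd k\<^sup>2"
    have "c dvd (q * (E * (k + 1)) + 1) - q * (E * (k + 1))"
      by (rule dvd_diff[OF dvd_trans[OF c(2) inv] dvd_mult[OF c(1)]])
    then show "is_unit c" by simp
  qed
  then have "genus_minimizing (k\<^sup>2) (E * (k + 1)) k"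
    using gm' genus_minimizing_uminus[OF k copE] by simp
  then have "odd E \<and> (E dvd k + 1 \<or> E dvd 2 * k - 1)"
    using mult_Suc_divides[OF k copE _ E] by simp
  then show ?thesis using listed_inverse_mult_Suc[OF k E(1) _ _ inv] by blast
qed

lemma short_vector_exists:
  fixes k q :: int
  assumes k: "k \<ge> 2" and cop: "coprime q (k\<^sup>2)"
  obtains d s where "0 < d" "d < k" "s \<noteq> 0" "- k < s" "s < k" "k\<^sup>2 dvd s - q * d"
proof -
  let ?p = "k\<^sup>2"
  define f where "f a = ((a * q) mod ?p) div k" for a
  have p: "?p > 0" "?p = k * k" using k by (auto simp: power2_eq_square)
  have "f ` {0..k} \<subseteq> {0..<k}"
  proof
    fix y assume "y \<in> f ` {0..k}"
    then obtain a where a: "y = f a" by blast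
    have "0 \<le> (a * q) mod ?p" "(a * q) mod ?p < ?p" using p(1) by simp_all
    then have "0 \<le> (a * q) mod ?p" "(a * q) mod ?p < k * k" by (simp_all only: p(2))
    moreover have "k * ((a * q) mod ?p div k) = (a * q) mod ?p - (a * q) mod ?p mod k"
      by (simp only: minus_mod_eq_mult_div)
    moreover have "0 \<le> (a * q) mod ?p mod k" using k by simp
    ultimately have "k * ((a * q) mod ?p div k) < k * k" by linarith
    then have "(a * q) mod ?p div k < k" using k by simp
    moreover have "0 \<le> (a * q) mod ?p div k" using k \<open>0 \<le> (a * q) mod ?p\<close>
      by (simp add: pos_imp_zdiv_nonneg_iff)
    ultimately show "y \<in> {0..<k}" by (simp add: a f_def)
  qed
  then have "card (f ` {0..k}) \<le> card {0..<k}" by (intro card_mono) auto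
  then have "card (f ` {0..k}) < card {0..k}" using k by simp
  then have "\<not> inj_on f {0..k}" by (rule pigeonhole)
  then obtain a' b' where ab': "a' \<in> {0..k}" "b' \<in> {0..k}" "f a' = f b'" "a' \<noteq> b'"
    unfolding inj_on_def by blast
  define a b where "a = min a' b'" and "b = max a' b'"
  have ab: "0 \<le> a" "a < b" "b \<le> k" "f a = f b"
    using ab' by (auto simp: a_def b_def min_def max_def)
  define d s where "d = b - a" and "s = (b * q) mod ?p - (a * q) mod ?p"
  have sd: "?p dvd s - q * d"
  proof -
    have "?p dvd ((b * q) mod ?p - b * q) - ((a * q) mod ?p - a * q)"
      by (rule dvd_diff) (simp_all add: mod_eq_dvd_iff[symmetric])
    then show ?thesis by (simp add: d_def s_def algebra_simps)
  qed
  have "(b * q) mod ?p = k * f b + ((b * q) mod ?p) mod k" "(a * q) mod ?p = k * f a + ((a * q) mod ?p) mod k"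
    by (simp_all add: f_def)
  then have "s = ((b * q) mod ?p) mod k - ((a * q) mod ?p) mod k" using ab(4) by (simp add: s_def)
  moreover have "0 \<le> ((b * q) mod ?p) mod k" "((b * q) mod ?p) mod k < k"
    "0 \<le> ((a * q) mod ?p) mod k" "((a * q) mod ?p) mod k < k" using k by simp_all
  ultimately have sk: "- k < s" "s < k" by linarith+
  have s0: False if "s = 0"
  proof -
    have "?p dvd q * d" using sd that by simp
    then have "?p dvd d" using cop by (simp add: coprime_commute coprime_dvd_mult_right_iff)
    then have "?p \<le> d" using ab by (intro zdvd_imp_le) (auto simp: d_def)
    moreover have "k * 2 \<le> k * k" using k by (intro mult_left_mono) auto
    ultimately show False using ab k p by (simp add: d_def)
  qed
  \<comment> \<open>The k + 1 multiples with indices 0, ..., k leave the index difference k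
    possible, but then k divides s and s would be 0.\<close>
  have "d \<noteq> k"
  proof
    assume "d = k"
    have "k dvd s - q * d" using sd by (auto simp: power2_eq_square dest: dvd_mult_left)
    then have "k dvd (s - q * d) + q * d" unfolding \<open>d = k\<close> by (intro dvd_add) auto
    then have "k dvd s" by simp
    then show False using s0 sk zdvd_not_zless[of "\<bar>s\<bar>" k] by force
  qed
  then show ?thesis using that[of d s] ab s0 sk sd by (auto simp: d_def)
qed

text \<open>By \<open>empty_box_dims\<close> every short vector of this quadrant has d + s \<ge> k,
  so (d, s) is primitive: an integral fraction of it would be too short. Complete it to a basis by a
  vector (x, w) just beyond abscissa -k; one step along (d, s) enters the range, and the height w +
  s decides whether a second short vector is present.\<close>

lemma classification_first_quadrant:
  assumes k: "k \<ge> 2" and cop: "coprime q (k\<^sup>2)" and gm: "genus_minimizing (k\<^sup>2) q k"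
    and q1: "\<not> k dvd q - 1" and q2: "\<not> k dvd q + 1"
    and d: "0 < d" "d < k" and s: "0 < s" "s < k" and sd: "k\<^sup>2 dvd s - q * d"
  shows "listed k q"
proof -
  have copk: "coprime q k" using cop by simp
  have dk: "k dvd x" if "k\<^sup>2 dvd x" for x using that by (auto simp: power2_eq_square dest: dvd_mult_left)
  obtain m where box: "box_condition k q 0 m"
    using gm genus_minimizing_iff_box_condition[OF k cop] by blast
  have long: "d + s \<ge> k" if "0 < d" "d < k" "0 < s" "s < k" "k\<^sup>2 dvd s - q * d" for d s
  proof -
    have e: "empty_box k q 0 (k - d) m (k - s)" using box that by (simp add: box_condition_def)
    have "(k - d) + (k - s) \<le> k" using that k by (intro empty_box_dims[OF copk _ e]) auto
    then show ?thesis by simp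
  qed
  obtain f where f: "s - q * d = k\<^sup>2 * f" using sd by blast
  have copdf: "coprime d f"
  proof (rule coprimeI)
    fix c assume c: "c dvd d" "c dvd f"
    define h where "h = \<bar>c\<bar>"
    obtain d' f' where df: "d = h * d'" "f = h * f'" using c by (metis abs_dvd_iff dvdE h_def)
    show "is_unit c"
    proof (rule ccontr)
      assume nu: "\<not> is_unit c"
      have "h \<noteq> 0" using df d by auto
      moreover have "h \<noteq> 1" using nu by (simp add: h_def)
      ultimately have h: "h \<ge> 2" unfolding h_def by linarith
      define s' where "s' = q * d' + k\<^sup>2 * f'"
      have hs: "s = h * s'" using f df by (simp add: s'_def algebra_simps)
      have pos: "0 < d'" "0 < s'" using df hs d s h by (auto simp: zero_less_mult_iff)
      have "2 * d' \<le> h * d'" "2 * s' \<le> h * s'" using h pos by (intro mult_right_mono; simp)+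
      then have "2 * d' \<le> d" "2 * s' \<le> s" using df hs by auto
      moreover have "k \<le> d' + s'"
        by (rule long) (use pos \<open>2 * d' \<le> d\<close> \<open>2 * s' \<le> s\<close> d s in \<open>auto simp: s'_def\<close>)
      ultimately show False using d s by linarith
    qed
  qed
  obtain x0 y0 where bez: "x0 * f + y0 * d = - 1"
  proof -
    obtain u v where "u * d + v * f = 1" using bezout_int[of d f] copdf by (auto simp: coprime_iff_gcd_eq_1)
    then have "(- v) * f + (- u) * d = - 1" by (simp add: algebra_simps)
    then show ?thesis using that by blast
  qed
  \<comment> \<open>The second basis vector is free up to multiples of \<open>(d, f)\<close>; this
    choice gives -k - d < x \<le> -k.\<close>
  define j where "j = (- k - x0) div d"
  define x y where "x = x0 + j * d" and "y = y0 - j * f"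
  have xf: "x * f + y * d = - 1" using bez by (simp add: x_def y_def algebra_simps)
  have "x = - k - (- k - x0) mod d"
    by (simp add: x_def j_def minus_mult_div_eq_mod[symmetric] algebra_simps)
  then have x: "x \<le> - k" "- k < x + d" using d pos_mod_bound[of d "- k - x0"] pos_mod_sign[of d "- k - x0"] by linarith+
  define w where "w = q * x - k\<^sup>2 * y"
  have wq: "k\<^sup>2 dvd w - q * x" by (simp add: w_def)
  have det: "d * w - s * x = k\<^sup>2"
  proof -
    have "d * w - s * x = - (k\<^sup>2 * (x * f + y * d)) + x * (q * d - s + k\<^sup>2 * f)"
      by (simp add: w_def algebra_simps)
    then show ?thesis using f xf by simp
  qed
  define n n' where "n = k - d" and "n' = k - s"
  have n: "n \<ge> 1" "n' \<ge> 1" "n < k" "n' < k" "n + n' \<le> k" using long[OF d s sd] d s by (auto simp: n_def n'_def)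
  have Q1: "empty_box k q 0 n m n'" using box d s sd by (simp add: box_condition_def n_def n'_def)
  have V: "k\<^sup>2 dvd (k - n') - q * (k - n)" using sd by (simp add: n_def n'_def)
  show ?thesis
  proof (cases "w + s < k")
    case True
    define \<mu> \<mu>' where "\<mu> = k + (x + d)" and "\<mu>' = k - (w + s)"
    have "d * (w + s) = k\<^sup>2 + s * (x + d)" using det by (simp add: algebra_simps)
    moreover have "s * (- k) < s * (x + d)" using x s by (intro mult_strict_left_mono) auto
    moreover have "s * k < k * k" using s by simp
    ultimately have "0 < d * (w + s)" by (simp add: power2_eq_square)
    then have ws: "0 < w + s" using d by (simp add: zero_less_mult_iff)
    have rng: "1 \<le> \<mu>" "\<mu> < k" "1 \<le> \<mu>'" "\<mu>' < k" using x d True ws by (auto simp: \<mu>_def \<mu>'_def)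
    have "k\<^sup>2 dvd (w - q * x) + (s - q * d)" by (rule dvd_add[OF wq sd])
    then have W: "k\<^sup>2 dvd (k - \<mu>') + q * (k - \<mu>)" by (simp add: \<mu>_def \<mu>'_def algebra_simps)
    then have "k\<^sup>2 dvd - ((k - \<mu>') + q * (k - \<mu>))" by (simp only: dvd_minus_iff)
    then have "k\<^sup>2 dvd (\<mu>' - k) - q * (k - \<mu>)" by (simp add: algebra_simps)
    then have "empty_box k q 0 (k - (k - \<mu>)) (m - (k + (\<mu>' - k))) (k + (\<mu>' - k))"
      using box[unfolded box_condition_def, rule_format, of "k - \<mu>" "\<mu>' - k"] rng by simp
    then have Q4: "empty_box k q 0 \<mu> (m - \<mu>') \<mu>'" by simp
    have "k dvd k * (1 - q) - ((k - n') - q * (k - n))" by (rule dvd_diff[OF dvd_triv_left dk[OF V]])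
    then have u: "k dvd n' - q * n" by (simp add: algebra_simps)
    have "k dvd k * (1 + q) - ((k - \<mu>') + q * (k - \<mu>))" by (rule dvd_diff[OF dvd_triv_left dk[OF W]])
    then have om: "k dvd \<mu>' + q * \<mu>" by (simp add: algebra_simps)
    have rel: "n * \<mu>' + n' * \<mu> = k * (n + n' + \<mu> + \<mu>' - k)"
      using det by (simp add: n_def n'_def \<mu>_def \<mu>'_def power2_eq_square algebra_simps)
    have pair: "crossing_pair k q n n' \<mu> \<mu>' m"
      by unfold_locales (use k copk n rng u om rel Q1 Q4 in auto)
    have neg: "crossing_pair k (- q) \<mu> \<mu>' n n' (1 - m)"
    proof
      show "empty_box k (- q) 0 \<mu> (1 - m) \<mu>'" by (rule empty_box_mirror[OF Q4]) simp
      show "empty_box k (- q) 0 n (1 - m - n') n'" by (rule empty_box_mirror[OF Q1]) simp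
    qed (use k copk n rng u om rel in \<open>auto simp: algebra_simps\<close>)
    have copn: "coprime (- q) (k\<^sup>2)" using cop by simp
    have gmn: "genus_minimizing (k\<^sup>2) (- q) k" using gm genus_minimizing_uminus[OF k cop] by simp
    \<comment> \<open>Replacing q by -q exchanges the two vectors, which turns the second and the
      fourth case into the first and the third.\<close>
    consider "\<mu> \<le> n" "n' \<le> \<mu>'" | "n \<le> \<mu>" "\<mu>' \<le> n'" | "n \<le> \<mu>" "n' \<le> \<mu>'" | "\<mu> \<le> n" "\<mu>' \<le> n'" by linarith
    then show ?thesis
    proof cases
      case 1
      then show ?thesis
        using listed_of_thin[OF k cop gm V W n(1,3) rng(3,4)] crossing_pair.crossing_thin[OF pair 1] by blast
    next
      case 2
      have "k\<^sup>2 dvd (k - \<mu>') - (- q) * (k - \<mu>)" "k\<^sup>2 dvd (k - n') + (- q) * (k - n)" using V W by simp_all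
      then have "listed k (- q)"
        using listed_of_thin[OF k copn gmn _ _ rng(1,2) n(2,4)] crossing_pair.crossing_thin[OF neg 2] by blast
      then show ?thesis using listed_uminus[of k "- q"] by simp
    next
      case 3
      then show ?thesis using crossing_pair.not_nested[OF pair] by blast
    next
      case 4
      then show ?thesis using crossing_pair.not_nested[OF neg] by blast
    qed
  next
    case False
    define \<alpha> \<beta> where "\<alpha> = - k - x" and "\<beta> = w + s - k"
    have ab: "\<alpha> \<ge> 0" "\<beta> \<ge> 0" using x False by (auto simp: \<alpha>_def \<beta>_def)
    have W: "k\<^sup>2 dvd (n' + \<beta>) + q * (k + \<alpha>)"
      using wq by (simp add: n'_def \<alpha>_def \<beta>_def algebra_simps)
    have dt: "k * (\<alpha> + \<beta>) = n * n' + n * \<beta> + n' * \<alpha>"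
      using det by (simp add: n_def n'_def \<alpha>_def \<beta>_def power2_eq_square algebra_simps)
    have "(\<exists>a b. a \<ge> 1 \<and> b \<ge> 1 \<and> 2 * k + 1 = (2 * a + 1) * (2 * b + 1) \<and> k\<^sup>2 dvd q - (2 * b + 1) * (k - 1)) \<or>
      (\<exists>g a. g \<ge> 1 \<and> a \<ge> 1 \<and> k - 1 = (2 * g - 1) * a \<and> k\<^sup>2 dvd q - (2 * g - 1) * (k - 1)) \<or>
      (\<exists>g b. g \<ge> 1 \<and> b \<ge> 1 \<and> k - 1 = (2 * g - 1) * b \<and> k\<^sup>2 dvd q - b * (2 * k + 1))"
      by (rule single_vector_classification[OF k copk n(1,2,5) ab V W dt Q1 q1 q2])
    then show ?thesis
    proof (elim disjE exE conjE)
      fix a b :: int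
      assume *: "a \<ge> 1" "b \<ge> 1" "2 * k + 1 = (2 * a + 1) * (2 * b + 1)" "k\<^sup>2 dvd q - (2 * b + 1) * (k - 1)"
      then have "2 * a + 1 > 0" "2 * a + 1 dvd 2 * k + 1" "odd (2 * a + 1)" "(2 * k + 1) div (2 * a + 1) = 2 * b + 1"
        by (simp_all only: dvd_triv_left nonzero_mult_div_cancel_left) simp_all
      moreover from * this have "[q = (2 * k + 1) div (2 * a + 1) * (k - 1)] (mod k ^ 2)"
        by (simp only: cong_iff_dvd_diff)
      ultimately show ?thesis unfolding listed_def by blast
    next
      fix g a :: int
      assume *: "g \<ge> 1" "a \<ge> 1" "k - 1 = (2 * g - 1) * a" "k\<^sup>2 dvd q - (2 * g - 1) * (k - 1)"
      then have a: "a > 0" "a dvd k - 1" and g: "(k - 1) div a = 2 * g - 1" by simp_all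
      have "odd ((k - 1) div a)" unfolding g by simp
      moreover have "[q = (k - 1) div a * (k - 1)] (mod k ^ 2)"
        using *(4) unfolding g by (simp only: cong_iff_dvd_diff)
      ultimately show ?thesis unfolding listed_def using a by blast
    next
      fix g b :: int
      assume *: "g \<ge> 1" "b \<ge> 1" "k - 1 = (2 * g - 1) * b" "k\<^sup>2 dvd q - b * (2 * k + 1)"
      then have "2 * g - 1 > 0" "2 * g - 1 dvd k - 1" "odd (2 * g - 1)" "(k - 1) div (2 * g - 1) = b" by simp_all
      moreover from * this have "[q = (k - 1) div (2 * g - 1) * (2 * k + 1)] (mod k ^ 2)"
        by (simp only: cong_iff_dvd_diff)
      ultimately show ?thesis unfolding listed_def by blast
    qed
  qed
qed

lemma genus_minimizing_imp_listed:
  assumes k: "k \<ge> 2" and cop: "coprime q (k\<^sup>2)" and gm: "genus_minimizing (k\<^sup>2) q k"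
  shows "listed k q"
proof -
  have type0: "listed k q" if cop: "coprime q (k\<^sup>2)" and gm: "genus_minimizing (k\<^sup>2) q k" and dvd: "k dvd q - 1" for q
  proof -
    obtain i where "q - 1 = k * i" using dvd by blast
    then have q: "q = i * k + 1" by (simp add: algebra_simps)
    then have "gcd i k \<in> {1, 2}" using gm genus_minimizing_type0_iff[OF k] by simp
    then have "\<exists>i. gcd i k \<in> {1, 2} \<and> ([q = i * k + 1] (mod k ^ 2) \<or> [q = i * k - 1] (mod k ^ 2))"
      unfolding q by (intro exI[of _ i] conjI disjI1 cong_refl)
    then show ?thesis unfolding listed_def by (rule disjI1)
  qed
  have copn: "coprime (- q) (k\<^sup>2)" using cop by simp
  have gmn: "genus_minimizing (k\<^sup>2) (- q) k" using gm genus_minimizing_uminus[OF k cop] by simp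
  have neg: "listed k q" if "listed k (- q)" using listed_uminus[OF that] by simp
  have m1: "k dvd - q - 1 \<longleftrightarrow> k dvd q + 1" "k dvd - q + 1 \<longleftrightarrow> k dvd q - 1"
  proof -
    have "- q - 1 = - (q + 1)" "- q + 1 = - (q - 1)" by simp_all
    then show "k dvd - q - 1 \<longleftrightarrow> k dvd q + 1" "k dvd - q + 1 \<longleftrightarrow> k dvd q - 1"
      by (simp_all only: dvd_minus_iff)
  qed
  show ?thesis
  proof (cases "k dvd q - 1 \<or> k dvd q + 1")
    case True
    then show ?thesis using type0[OF cop gm] type0[OF copn gmn] neg m1 by blast
  next
    case False
    obtain d s where *: "0 < d" "d < k" "s \<noteq> 0" "- k < s" "s < k" "k\<^sup>2 dvd s - q * d"
      using short_vector_exists[OF k cop] by blast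
    show ?thesis
    proof (cases "s > 0")
      case True
      then show ?thesis using classification_first_quadrant[OF k cop gm _ _ *(1,2) _ *(5,6)] False by blast
    next
      case s: False
      have "k\<^sup>2 dvd - (s - q * d)" using *(6) by (simp only: dvd_minus_iff)
      then have "k\<^sup>2 dvd (- s) - (- q) * d" by simp
      then show ?thesis
        using classification_first_quadrant[OF k copn gmn _ _ *(1,2), of "- s"] neg m1 False s * by simp
    qed
  qed
qed

section \<open>The listed residues are genus-minimizing\<close>

lemma genus_minimizing_of_signed_cong:
  assumes k: "k \<ge> 2" and cop: "coprime q (k\<^sup>2)" and c: "[q = c] (mod k\<^sup>2) \<or> [q = - c] (mod k\<^sup>2)"
    and gm: "genus_minimizing (k\<^sup>2) c k \<or> genus_minimizing (k\<^sup>2) (- c) k"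
  shows "genus_minimizing (k\<^sup>2) q k"
proof -
  have "coprime c (k\<^sup>2)"
    using c cong_imp_coprime[OF _ cop] by force
  then have "genus_minimizing (k\<^sup>2) c k" "genus_minimizing (k\<^sup>2) (- c) k"
    using gm genus_minimizing_uminus[OF k] by blast+
  then show ?thesis using c genus_minimizing_cong[OF k cop] by blast
qed

lemma genus_minimizing_type0:
  assumes "k \<ge> 2" "gcd i k = 1 \<or> gcd i k = 2" "k\<^sup>2 dvd c - (i * k + 1)"
  shows "genus_minimizing (k\<^sup>2) c k"
proof -
  have "coprime (i * k + 1) k" by (rule coprimeI) (metis dvd_add_right_iff dvd_mult)
  then have "coprime (i * k + 1) (k\<^sup>2)" by simp
  moreover have "[i * k + 1 = c] (mod k\<^sup>2)" using assms(3) by (simp add: cong_iff_dvd_diff dvd_diff_commute)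
  moreover have "gcd i k \<in> {1, 2}" using assms(2) by (metis insertI1 insertI2)
  then have "genus_minimizing (k\<^sup>2) (i * k + 1) k" using genus_minimizing_type0_iff[OF assms(1)] by simp
  ultimately show ?thesis using genus_minimizing_cong[OF assms(1)] by blast
qed

lemma gcd_two_cases: "gcd 2 k = 1 \<or> gcd 2 k = 2" for k :: int
proof -
  have "gcd 2 k dvd 2" "0 \<le> gcd 2 k" by simp_all
  then have "gcd 2 k \<le> 2" "gcd 2 k \<noteq> 0" by (auto intro: zdvd_imp_le)
  with \<open>0 \<le> gcd 2 k\<close> show ?thesis by linarith
qed

lemma cofactor_less:
  fixes a d k :: int
  assumes "d > 0" "d dvd a" "a > 0" "d \<ge> c" "a < c * k" "c > 0"
  shows "0 < a div d" "a div d < k"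
proof -
  note D = pos_of_dvd[OF assms(1-3)]
  show "0 < a div d" by (rule D)
  have "c * (a div d) \<le> d * (a div d)" using assms D by (intro mult_right_mono) auto
  also have "d * (a div d) = a" using D(2) by (simp only: mult.commute)
  finally have "c * (a div d) < c * k" using assms(5) by (rule le_less_trans)
  then show "a div d < k" using mult_less_cancel_left_pos[OF assms(6)] by blast
qed

lemma odd_divisor_ge_three:
  fixes d :: int
  assumes "d > 0" "odd d" "d \<noteq> 1"
  shows "d \<ge> 3"
proof -
  have "d \<noteq> 2" using assms by auto
  then show ?thesis using assms by linarith
qed

text \<open>The window lemmas need E < k. When the factor in question is k + 1, 2k + 1 or 2k - 1
  itself, the product reduces modulo k^2 to ik + 1 or its negative with i among 1, -1, 2, -2, which
  belongs to family (0).\<close>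

lemma listed_imp_genus_minimizing:
  assumes k: "k \<ge> 2" and cop: "coprime q (k\<^sup>2)" and "listed k q"
  shows "genus_minimizing (k\<^sup>2) q k"
  using assms(3) unfolding listed_def
proof (elim disjE; elim exE conjE)
  fix i assume i: "gcd i k \<in> {1, 2}" and c: "[q = i * k + 1] (mod k ^ 2) \<or> [q = i * k - 1] (mod k ^ 2)"
  from c show ?thesis
  proof
    assume "[q = i * k + 1] (mod k ^ 2)"
    then show ?thesis
      using genus_minimizing_cong[OF k cop] iffD2[OF genus_minimizing_type0_iff[OF k] i] by (simp only:)
  next
    assume c: "[q = i * k - 1] (mod k ^ 2)"
    have "gcd (- i) k \<in> {1, 2}" using i by simp
    then have "genus_minimizing (k\<^sup>2) (- i * k + 1) k" by (rule iffD2[OF genus_minimizing_type0_iff[OF k]])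
    then have "genus_minimizing (k\<^sup>2) (- (i * k - 1)) k" by simp
    then show ?thesis using genus_minimizing_of_signed_cong[OF k cop] c by blast
  qed
next
  fix d assume d: "0 < d" "d dvd k + 1" "odd ((k + 1) div d)"
    and c: "[q = (k + 1) div d * (k + 1)] (mod k ^ 2) \<or> [q = - ((k + 1) div d * (k + 1))] (mod k ^ 2)"
  have D: "(k + 1) div d * d = k + 1" using pos_of_dvd[OF d(1,2)] k by simp
  have "genus_minimizing (k\<^sup>2) ((k + 1) div d * (k + 1)) k"
  proof (cases "d = 1")
    case True
    have "(k + 1) div d * (k + 1) - (2 * k + 1) = k\<^sup>2" using True by (simp add: power2_eq_square algebra_simps)
    then show ?thesis by (intro genus_minimizing_type0[OF k gcd_two_cases]) (simp only: dvd_refl)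
  next
    case False
    have "0 < (k + 1) div d" "(k + 1) div d < k"
      using cofactor_less[OF d(1,2), of 2 k] False d k by simp_all
    moreover have "(k + 1) div d dvd k + 1" using dvd_triv_left[of "(k + 1) div d" d] unfolding D .
    ultimately show ?thesis using genus_minimizing_mult_Suc_of_dvd_Suc[OF k] d(3) by (simp add: add.commute)
  qed
  then show ?thesis using genus_minimizing_of_signed_cong[OF k cop c] by blast
next
  fix d assume d: "0 < d" "d dvd k - 1" "odd ((k - 1) div d)"
    and c: "[q = (k - 1) div d * (k - 1)] (mod k ^ 2) \<or> [q = - ((k - 1) div d * (k - 1))] (mod k ^ 2)"
  have D: "(k - 1) div d * d = k - 1" "0 < (k - 1) div d" using pos_of_dvd[OF d(1,2)] k by simp_all
  have "(k - 1) div d < k" using cofactor_less[OF d(1,2), of 1 k] d k by simp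
  moreover have "(k - 1) div d dvd k - 1" using dvd_triv_left[of "(k - 1) div d" d] unfolding D .
  ultimately have "genus_minimizing (k\<^sup>2) ((k - 1) div d * (1 - k)) k"
    using genus_minimizing_mult_pred_of_dvd_pred[OF k D(2)] d(3) by simp
  then have "genus_minimizing (k\<^sup>2) (- ((k - 1) div d * (k - 1))) k" by (simp add: algebra_simps)
  then show ?thesis using genus_minimizing_of_signed_cong[OF k cop c] by blast
next
  fix d assume d: "0 < d" "d dvd k - 1" "odd d"
    and c: "[q = (k - 1) div d * (2 * k + 1)] (mod k ^ 2) \<or> [q = - ((k - 1) div d * (2 * k + 1))] (mod k ^ 2)"
  have D: "(k - 1) div d * d = k - 1" "d < k" using pos_of_dvd[OF d(1,2)] k by simp_all
  have "genus_minimizing (k\<^sup>2) (d * (1 - k)) k"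
    using genus_minimizing_mult_pred_of_dvd_pred[OF k d(1) D(2) d(3,2)] .
  \<comment> \<open>Up to sign this residue is the inverse of d(1 - k), as (k - 1)^2 (2k + 1) = 1
    modulo k^2.\<close>
  moreover have "k\<^sup>2 dvd d * (1 - k) * (- ((k - 1) div d * (2 * k + 1))) - 1"
  proof -
    have "d * (1 - k) * (- ((k - 1) div d * (2 * k + 1))) - 1 = ((k - 1) div d * d) * ((k - 1) * (2 * k + 1)) - 1"
      by (simp add: algebra_simps)
    also have "\<dots> = k\<^sup>2 * (2 * k - 3)" unfolding D by (simp add: power2_eq_square algebra_simps)
    finally show ?thesis by simp
  qed
  ultimately have "genus_minimizing (k\<^sup>2) (- ((k - 1) div d * (2 * k + 1))) k"
    using genus_minimizing_inverse_imp[OF k] by blast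
  then show ?thesis using genus_minimizing_of_signed_cong[OF k cop c] by blast
next
  fix d assume d: "0 < d" "d dvd k + 1" "odd d"
    and c: "[q = (k + 1) div d * (2 * k - 1)] (mod k ^ 2) \<or> [q = - ((k + 1) div d * (2 * k - 1))] (mod k ^ 2)"
  have D: "(k + 1) div d * d = k + 1" "0 < (k + 1) div d" "d \<le> k + 1" using pos_of_dvd[OF d(1,2)] k by simp_all
  have "genus_minimizing (k\<^sup>2) (- ((k + 1) div d * (2 * k - 1))) k"
  proof (cases "(k + 1) div d = 1")
    case True
    have "gcd (- 2) k = 1 \<or> gcd (- 2) k = 2" using gcd_two_cases[of k] by simp
    then show ?thesis by (rule genus_minimizing_type0[OF k]) (simp add: True)
  next
    case False
    have "d * 2 \<le> d * ((k + 1) div d)" using False D d by (intro mult_left_mono) auto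
    then have "d < k" using D(1) k by (simp add: mult.commute) 
    then have "genus_minimizing (k\<^sup>2) (d * (1 + k)) k"
      using genus_minimizing_mult_Suc_of_dvd_Suc[OF k d(1) _ d(3,2)] by blast
    moreover have "k\<^sup>2 dvd d * (1 + k) * (- ((k + 1) div d * (2 * k - 1))) - 1"
    proof -
      have "d * (1 + k) * (- ((k + 1) div d * (2 * k - 1))) - 1 = - (((k + 1) div d * d) * ((k + 1) * (2 * k - 1))) - 1"
        by (simp add: algebra_simps)
      also have "\<dots> = k\<^sup>2 * (- 2 * k - 3)" unfolding D by (simp add: power2_eq_square algebra_simps)
      finally show ?thesis by simp
    qed
    ultimately show ?thesis using genus_minimizing_inverse_imp[OF k] by blast
  qed
  then show ?thesis using genus_minimizing_of_signed_cong[OF k cop c] by blast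
next
  fix d assume d: "0 < d" "d dvd 2 * k + 1" "odd d"
    and c: "[q = (2 * k + 1) div d * (k - 1)] (mod k ^ 2) \<or> [q = - ((2 * k + 1) div d * (k - 1))] (mod k ^ 2)"
  have D: "(2 * k + 1) div d * d = 2 * k + 1" "0 < (2 * k + 1) div d" using pos_of_dvd[OF d(1,2)] k by simp_all
  have "genus_minimizing (k\<^sup>2) (- ((2 * k + 1) div d * (k - 1))) k"
  proof (cases "d = 1")
    case True
    have "- ((2 * k + 1) div d * (k - 1)) - (1 * k + 1) = k\<^sup>2 * (- 2)" using True by (simp add: power2_eq_square algebra_simps)
    moreover have "gcd 1 k = 1 \<or> gcd 1 k = 2" by simp
    ultimately show ?thesis by (intro genus_minimizing_type0[OF k, of 1]) (simp_all only: dvd_triv_left)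
  next
    case False
    then have "d \<ge> 3" using odd_divisor_ge_three d by blast
    then have "(2 * k + 1) div d < k" using cofactor_less[OF d(1,2), of 3 k] k by simp
    moreover have "odd ((2 * k + 1) div d * d)" unfolding D by simp
    then have "odd ((2 * k + 1) div d)" by simp
    moreover have "(2 * k + 1) div d dvd 2 * k + 1" using dvd_triv_left[of "(2 * k + 1) div d" d] unfolding D .
    ultimately have "genus_minimizing (k\<^sup>2) ((2 * k + 1) div d * (1 - k)) k"
      using genus_minimizing_mult_pred_of_dvd_double_Suc[OF k D(2)] by blast
    then show ?thesis by (simp add: algebra_simps)
  qed
  then show ?thesis using genus_minimizing_of_signed_cong[OF k cop c] by blast
next
  fix d assume d: "0 < d" "d dvd 2 * k - 1" "odd d"
    and c: "[q = (2 * k - 1) div d * (k + 1)] (mod k ^ 2) \<or> [q = - ((2 * k - 1) div d * (k + 1))] (mod k ^ 2)"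
  have D: "(2 * k - 1) div d * d = 2 * k - 1" "0 < (2 * k - 1) div d" using pos_of_dvd[OF d(1,2)] k by simp_all
  have "genus_minimizing (k\<^sup>2) ((2 * k - 1) div d * (k + 1)) k \<or> genus_minimizing (k\<^sup>2) (- ((2 * k - 1) div d * (k + 1))) k"
  proof (cases "d = 1")
    case True
    have "- ((2 * k - 1) div d * (k + 1)) - (- 1 * k + 1) = k\<^sup>2 * (- 2)" using True by (simp add: power2_eq_square algebra_simps)
    moreover have "gcd (- 1) k = 1 \<or> gcd (- 1) k = 2" by simp
    ultimately have "genus_minimizing (k\<^sup>2) (- ((2 * k - 1) div d * (k + 1))) k"
      by (intro genus_minimizing_type0[OF k, of "- 1"]) (simp_all only: dvd_triv_left)
    then show ?thesis ..
  next
    case False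
    then have "d \<ge> 3" using odd_divisor_ge_three d by blast
    then have "(2 * k - 1) div d < k" using cofactor_less[OF d(1,2), of 3 k] k by simp
    moreover have "odd ((2 * k - 1) div d * d)" unfolding D by simp
    then have "odd ((2 * k - 1) div d)" by simp
    moreover have "(2 * k - 1) div d dvd 2 * k - 1" using dvd_triv_left[of "(2 * k - 1) div d" d] unfolding D .
    ultimately have "genus_minimizing (k\<^sup>2) ((2 * k - 1) div d * (1 + k)) k"
      using genus_minimizing_mult_Suc_of_dvd_double_pred[OF k D(2)] by blast
    then show ?thesis by (simp add: add.commute)
  qed
  then show ?thesis using genus_minimizing_of_signed_cong[OF k cop c] by blast
qed

theorem proposition3p27:
  fixes k q :: int
  assumes "k \<ge> 2" and "coprime q (k ^ 2)"
  shows "genus_minimizing (k ^ 2) q k \<longleftrightarrow>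
      (\<exists>i. gcd i k \<in> {1, 2} \<and>
         ([q = i * k + 1] (mod k ^ 2) \<or> [q = i * k - 1] (mod k ^ 2))) \<or>
      (\<exists>d>0. d dvd k + 1 \<and> odd ((k + 1) div d) \<and>
         ([q = ((k + 1) div d) * (k + 1)] (mod k ^ 2) \<or>
          [q = - (((k + 1) div d) * (k + 1))] (mod k ^ 2))) \<or>
      (\<exists>d>0. d dvd k - 1 \<and> odd ((k - 1) div d) \<and>
         ([q = ((k - 1) div d) * (k - 1)] (mod k ^ 2) \<or>
          [q = - (((k - 1) div d) * (k - 1))] (mod k ^ 2))) \<or>
      (\<exists>d>0. d dvd k - 1 \<and> odd d \<and>
         ([q = ((k - 1) div d) * (2 * k + 1)] (mod k ^ 2) \<or>
          [q = - (((k - 1) div d) * (2 * k + 1))] (mod k ^ 2))) \<or>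
      (\<exists>d>0. d dvd k + 1 \<and> odd d \<and>
         ([q = ((k + 1) div d) * (2 * k - 1)] (mod k ^ 2) \<or>
          [q = - (((k + 1) div d) * (2 * k - 1))] (mod k ^ 2))) \<or>
      (\<exists>d>0. d dvd 2 * k + 1 \<and> odd d \<and>
         ([q = ((2 * k + 1) div d) * (k - 1)] (mod k ^ 2) \<or>
          [q = - (((2 * k + 1) div d) * (k - 1))] (mod k ^ 2))) \<or>
      (\<exists>d>0. d dvd 2 * k - 1 \<and> odd d \<and>
         ([q = ((2 * k - 1) div d) * (k + 1)] (mod k ^ 2) \<or>
          [q = - (((2 * k - 1) div d) * (k + 1))] (mod k ^ 2)))"
  using genus_minimizing_imp_listed[OF assms] listed_imp_genus_minimizing[OF assms]
  unfolding listed_def by (rule iffI)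

end
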